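(* Let $\gamma:[0,\ell_\gamma]\to\mathbb R$ be a normalized profile function. Take $t_0\in(0,\ell_\gamma)$ such that $\dot\gamma(t_0)\ne0$ and let $m_{t_0}:=\left|\frac{\gamma(t_0)}{\dot\gamma(t_0)}\right|$. The lift to $SS^2_\gamma$ (by its unit tangent vector) of the latitude curve $\{t=t_0\}$ parametrized by arc length and oriented by $(\mathrm{sign}\,\dot\gamma(t_0))\,\partial_\theta$ is the support of a periodic orbit of $X^{m_{t_0}}_\gamma$. Let $\zeta_{t_0}$ be the associated invariant probability measure. Its action is $$\mathcal A(\zeta_{t_0})=\frac{\gamma(t_0)^2-\dot\gamma(t_0)\Gamma(t_0)}{\dot\gamma(t_0)^2},$$ and $I_{m_{t_0},\gamma}\big|_{\mathrm{supp}\,\zeta_{t_0}}=\dot\gamma(t_0)\,\mathcal A(\zeta_{t_0})$. In particular, $\mathcal A(\zeta_{t_0})>0$ when $K_{m_{t_0}}>0$.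
   Context: A normalized profile function is a smooth $\gamma:[0,\ell_\gamma]\to\mathbb R$ such that: (1) $\gamma(0)=\gamma(\ell_\gamma)=0$ and $\gamma>0$ otherwise; (2) $\dot\gamma(0)=1$, $\dot\gamma(\ell_\gamma)=-1$ and $|\dot\gamma|<1$ on $(0,\ell_\gamma)$; (3) all even derivatives of $\gamma$ vanish at $0$ and $\ell_\gamma$; (4) $\int_0^{\ell_\gamma}\gamma(t)\,dt=2$. The surface of revolution $S^2_\gamma$ is the sphere obtained from $[0,\ell_\gamma]\times\mathbb R/2\pi\mathbb Z$ with coordinates $(t,\theta)$ by collapsing each of the two boundary circles to a point, with metric $g_\gamma=dt^2+\gamma(t)^2d\theta^2$, area form $\mu_\gamma=\gamma\,dt\wedge d\theta$ (total area $4\pi$), curvature $K=-\ddot\gamma/\gamma$. On the unit tangent bundle $\pi:SS^2_\gamma\to S^2_\gamma$ use coordinates $(t,\varphi,\theta)$, where the unit vector is $v=\cos\varphi\,\partial_t+\frac{\sin\varphi}{\gamma(t)}\partial_\theta$. For $m>0$ let $X^m_\gamma:=mX+V$, with $X$ the geodesic vector field and $V=\partial_\varphi$ the generator of the fiberwise rotation, and let $\omega^\gamma_m:=m\,d\alpha-\pi^*\mu_\gamma$, where $\alpha_{(x,v)}(\xi)=g_\gamma(v,d\pi\,\xi)$; $\omega_m^\gamma$ is exact with kernel spanned by $X^m_\gamma$. The magnetic curvature is $K_m:=m^2K+1$. For an $X^m_\gamma$-invariant Borel probability measure $\zeta$ on $SS^2_\gamma$ (automatically null-homologous as $H^1(SS^2_\gamma;\mathbb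 R)=0$) the action is $\mathcal A(\zeta):=\int\tau(X^m_\gamma)\,d\zeta$, where $\tau$ is any primitive of $\omega^\gamma_m$; it does not depend on $\tau$. One such primitive is $m\alpha-\pi^*\beta+\psi$, with $\psi$ the Levi-Civita connection form ($\psi(V)=1$, $d\psi=-K\pi^*\mu_\gamma$) and $d\beta=(1-K)\mu_\gamma$. $\Gamma$ is the primitive of $\gamma$ with $\Gamma(0)=-1$, and $I_{m,\gamma}:SS^2_\gamma\to\mathbb R$ is the function $I_{m,\gamma}(t,\varphi,\theta)=m\gamma(t)\sin\varphi-\Gamma(t)$. *)

theory Defs
  imports "HOL-Probability.Probability"
begin

section \<open>Normalized profile functions\<close>

text \<open>Iterated derivatives relative to \<open>S\<close>; for \<open>S = {0..l}\<close> they are one-sided at \<open>0\<close> and \<open>l\<close>.\<close>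

primrec nderiv :: "real set \<Rightarrow> (real \<Rightarrow> real) \<Rightarrow> nat \<Rightarrow> real \<Rightarrow> real" where
  "nderiv S f 0 = f"
| "nderiv S f (Suc k) = (\<lambda>t. vector_derivative (nderiv S f k) (at t within S))"

definition normalized_profile :: "(real \<Rightarrow> real) \<Rightarrow> real \<Rightarrow> bool" where
  "normalized_profile \<gamma> l \<longleftrightarrow>
     0 < l \<and>
     (\<forall>k. nderiv {0..l} \<gamma> k differentiable_on {0..l}) \<and>
     \<gamma> 0 = 0 \<and> \<gamma> l = 0 \<and> (\<forall>t\<in>{0<..<l}. \<gamma> t > 0) \<and>
     nderiv {0..l} \<gamma> 1 0 = 1 \<and> nderiv {0..l} \<gamma> 1 l = -1 \<and>
     (\<forall>t\<in>{0<..<l}. \<bar>nderiv {0..l} \<gamma> 1 t\<bar> < 1) \<and>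
     (\<forall>k. even k \<longrightarrow> nderiv {0..l} \<gamma> k 0 = 0 \<and> nderiv {0..l} \<gamma> k l = 0) \<and>
     integral {0..l} \<gamma> = 2"

definition Gamma_prim :: "(real \<Rightarrow> real) \<Rightarrow> real \<Rightarrow> real" where
  "Gamma_prim \<gamma> t = -1 + integral {0..t} \<gamma>"

text \<open>The value at the poles is the continuous extension of \<open>-\<gamma>''/\<gamma>\<close>, by l'Hopital's rule
  (\<open>\<gamma>\<close> and \<open>\<gamma>''\<close> vanish there).\<close>

definition curvature :: "(real \<Rightarrow> real) \<Rightarrow> real \<Rightarrow> real \<Rightarrow> real" where
  "curvature \<gamma> l t =
     (if t \<in> {0<..<l} then - nderiv {0..l} \<gamma> 2 t / \<gamma> t
      else - nderiv {0..l} \<gamma> 3 t / nderiv {0..l} \<gamma> 1 t)"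

definition magnetic_curvature :: "(real \<Rightarrow> real) \<Rightarrow> real \<Rightarrow> real \<Rightarrow> real \<Rightarrow> real" where
  "magnetic_curvature \<gamma> l m t = m\<^sup>2 * curvature \<gamma> l t + 1"


section \<open>The unit tangent bundle as a space\<close>

text \<open>Coordinates \<open>(t, \<phi>, \<theta>)\<close> on the unit tangent bundle and \<open>(t, \<theta>)\<close> on the sphere, the angles
  being real numbers.  Over \<open>0 < t < l\<close>, two triples denote the same unit vector iff they agree
  modulo \<open>2\<pi>\<close> in both angles.  Letting \<open>t\<close> tend to \<open>0\<close> along the meridian \<open>\<theta>\<close>, the vector
  \<open>cos \<phi> \<partial>_t + (sin \<phi> / \<gamma>) \<partial>_\<theta>\<close> tends to the vector with direction angle \<open>\<phi> + \<theta>\<close> at the pole; for \<open>t\<close>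
  tending to \<open>l\<close>, where \<open>\<partial>_t\<close> points towards the pole, the direction angle is \<open>\<pi> - \<phi> + \<theta>\<close>.\<close>

type_synonym coords = "real \<times> real \<times> real"
type_synonym upoint = "coords set"

definition polar_box :: "real \<Rightarrow> coords set" where
  "polar_box l = {0..l} \<times> UNIV \<times> UNIV"

definition polar_interior :: "real \<Rightarrow> coords set" where
  "polar_interior l = {0<..<l} \<times> UNIV \<times> UNIV"

definition same_vector :: "real \<Rightarrow> (coords \<times> coords) set" where
  "same_vector l = {((t, \<phi>, \<theta>), (t', \<phi>', \<theta>')).
     t \<in> {0..l} \<and> t' = t \<and>
     (if t = 0 then cis (\<phi>' + \<theta>') = cis (\<phi> + \<theta>)
      else if t = l then cis (pi - \<phi>' + \<theta>') = cis (pi - \<phi> + \<theta>)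
      else cis \<phi>' = cis \<phi> \<and> cis \<theta>' = cis \<theta>)}"

definition SS :: "real \<Rightarrow> upoint set" where
  "SS l = polar_box l // same_vector l"

definition pt :: "real \<Rightarrow> coords \<Rightarrow> upoint" where
  "pt l x = same_vector l `` {x}"

definition SS_open :: "real \<Rightarrow> upoint set \<Rightarrow> bool" where
  "SS_open l U \<longleftrightarrow> U \<subseteq> SS l \<and> openin (top_of_set (polar_box l)) {x \<in> polar_box l. pt l x \<in> U}"

lemma istopology_SS_open: "istopology (SS_open l)"
proof -
  have eq1: "{x \<in> polar_box l. pt l x \<in> S \<inter> T}
      = {x \<in> polar_box l. pt l x \<in> S} \<inter> {x \<in> polar_box l. pt l x \<in> T}" for S T
    by auto
  have eq2: "{x \<in> polar_box l. pt l x \<in> \<Union>K} = (\<Union>S\<in>K. {x \<in> polar_box l. pt l x \<in> S})" for K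
    by auto
  show ?thesis
    unfolding istopology_def SS_open_def eq1 eq2 by (auto intro!: openin_Int openin_Union)
qed

definition SS_top :: "real \<Rightarrow> upoint topology" where
  "SS_top l = topology (SS_open l)"

definition SS_borel :: "real \<Rightarrow> upoint measure" where
  "SS_borel l = sigma (SS l) {U. openin (SS_top l) U}"

text \<open>The function on the unit tangent bundle given by the coordinate expression \<open>f\<close>.\<close>

definition on_SS :: "(coords \<Rightarrow> real) \<Rightarrow> upoint \<Rightarrow> real" where
  "on_SS f p = the_elem (f ` p)"

definition I_fun :: "(real \<Rightarrow> real) \<Rightarrow> real \<Rightarrow> upoint \<Rightarrow> real" where
  "I_fun \<gamma> m = on_SS (\<lambda>(t, \<phi>, \<theta>). m * \<gamma> t * sin \<phi> - Gamma_prim \<gamma> t)"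


section \<open>Smooth structure, one-forms and vector fields\<close>

text \<open>The smooth atlas has one chart for each pole, with domain \<open>disc \<times> \<real>\<close> (the circle coordinate is
  taken in \<open>\<real>\<close>).  It consists of the geodesic polar coordinates around the pole, read as a complex
  number \<open>z\<close>, and of the direction angle with respect to the orthonormal frame obtained by rotating
  \<open>(\<partial>_r, \<partial>_\<theta>/\<gamma>)\<close> by \<open>-\<theta>\<close>, with \<open>r = t\<close> respectively \<open>r = l - t\<close>; this frame extends smoothly over the
  pole.  The function \<open>polar l c\<close> is the transition map from the coordinates \<open>(t, \<phi>, \<theta>)\<close>.\<close>

datatype pole = Pole0 | Pole1

fun polar :: "real \<Rightarrow> pole \<Rightarrow> coords \<Rightarrow> complex \<times> real" where
  "polar l Pole0 (t, \<phi>, \<theta>) = (of_real t * cis \<theta>, \<phi> + \<theta>)"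
| "polar l Pole1 (t, \<phi>, \<theta>) = (of_real (l - t) * cis \<theta>, pi - \<phi> + \<theta>)"

definition chart_dom :: "real \<Rightarrow> (complex \<times> real) set" where
  "chart_dom l = ball 0 l \<times> UNIV"

definition chart_pt :: "real \<Rightarrow> pole \<Rightarrow> complex \<times> real \<Rightarrow> upoint" where
  "chart_pt l c w = (THE p. \<exists>x\<in>polar_box l. polar l c x = w \<and> p = pt l x)"

primrec Ck_on :: "'a::real_normed_vector set \<Rightarrow> nat \<Rightarrow> ('a \<Rightarrow> real) \<Rightarrow> bool" where
  "Ck_on S 0 = (\<lambda>f. continuous_on S f)"
| "Ck_on S (Suc k) = (\<lambda>f. (\<forall>x\<in>S. f differentiable (at x)) \<and>
     (\<forall>v. Ck_on S k (\<lambda>x. frechet_derivative f (at x) v)))"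

definition smooth_on :: "'a::real_normed_vector set \<Rightarrow> ('a \<Rightarrow> real) \<Rightarrow> bool" where
  "smooth_on S f \<longleftrightarrow> (\<forall>k. Ck_on S k f)"

text \<open>A one-form on an open subset of a vector space is a map \<open>\<tau>\<close>, \<open>\<tau> x\<close> being the linear form at \<open>x\<close>.\<close>

definition pullback :: "('a::real_normed_vector \<Rightarrow> 'b::real_normed_vector) \<Rightarrow>
    ('b \<Rightarrow> 'b \<Rightarrow> real) \<Rightarrow> 'a \<Rightarrow> 'a \<Rightarrow> real" where
  "pullback f \<tau> x \<xi> = \<tau> (f x) (frechet_derivative f (at x) \<xi>)"

definition ext_deriv :: "('a::real_normed_vector \<Rightarrow> 'a \<Rightarrow> real) \<Rightarrow> 'a \<Rightarrow> 'a \<Rightarrow> 'a \<Rightarrow> real" where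
  "ext_deriv \<tau> x \<xi> \<eta> =
     frechet_derivative (\<lambda>y. \<tau> y \<eta>) (at x) \<xi> - frechet_derivative (\<lambda>y. \<tau> y \<xi>) (at x) \<eta>"

text \<open>Global one-forms and vector fields on the unit tangent bundle are given by their expressions
  in the two charts.\<close>

type_synonym chart_form = "pole \<Rightarrow> complex \<times> real \<Rightarrow> complex \<times> real \<Rightarrow> real"
type_synonym chart_field = "pole \<Rightarrow> complex \<times> real \<Rightarrow> complex \<times> real"

definition smooth_one_form :: "real \<Rightarrow> chart_form \<Rightarrow> bool" where
  "smooth_one_form l \<tau> \<longleftrightarrow>
     (\<forall>c. (\<forall>w\<in>chart_dom l. linear (\<tau> c w)) \<and>
          (\<forall>v. smooth_on (chart_dom l) (\<lambda>w. \<tau> c w v)) \<and>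
          (\<forall>z\<in>ball 0 l. \<forall>\<psi>. \<tau> c (z, \<psi> + 2 * pi) = \<tau> c (z, \<psi>))) \<and>
     (\<forall>x\<in>polar_interior l. pullback (polar l Pole0) (\<tau> Pole0) x = pullback (polar l Pole1) (\<tau> Pole1) x)"

definition contraction :: "real \<Rightarrow> chart_form \<Rightarrow> chart_field \<Rightarrow> upoint \<Rightarrow> real" where
  "contraction l \<tau> Y p = (THE a. \<exists>c. \<exists>w\<in>chart_dom l. chart_pt l c w = p \<and> a = \<tau> c w (Y c w))"

definition integral_curve :: "real \<Rightarrow> chart_field \<Rightarrow> (real \<Rightarrow> upoint) \<Rightarrow> bool" where
  "integral_curve l Y u \<longleftrightarrow>
     (\<forall>s. \<exists>c w. \<exists>\<epsilon>>0. \<forall>r. \<bar>r - s\<bar> < \<epsilon> \<longrightarrow>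
        w r \<in> chart_dom l \<and> chart_pt l c (w r) = u r \<and>
        (w has_vector_derivative Y c (w r)) (at r))"

definition periodic_orbit :: "real \<Rightarrow> chart_field \<Rightarrow> (real \<Rightarrow> upoint) \<Rightarrow> real \<Rightarrow> bool" where
  "periodic_orbit l Y u T \<longleftrightarrow> integral_curve l Y u \<and> T > 0 \<and> (\<forall>s. u (s + T) = u s)"

definition flow_of :: "real \<Rightarrow> chart_field \<Rightarrow> (real \<Rightarrow> upoint \<Rightarrow> upoint) \<Rightarrow> bool" where
  "flow_of l Y \<Phi> \<longleftrightarrow>
     (\<forall>p\<in>SS l. \<Phi> 0 p = p \<and> integral_curve l Y (\<lambda>s. \<Phi> s p)) \<and>
     (\<forall>s. continuous_map (SS_top l) (SS_top l) (\<Phi> s))"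


section \<open>Geometry of the surface of revolution in polar coordinates\<close>

text \<open>Since \<open>base_pt\<close> is linear, it also serves as its own differential.\<close>

definition base_pt :: "coords \<Rightarrow> real \<times> real" where
  "base_pt x = (fst x, snd (snd x))"

definition metric :: "(real \<Rightarrow> real) \<Rightarrow> real \<times> real \<Rightarrow> real \<times> real \<Rightarrow> real \<times> real \<Rightarrow> real" where
  "metric \<gamma> q u w = fst u * fst w + (\<gamma> (fst q))\<^sup>2 * (snd u * snd w)"

definition area_form :: "(real \<Rightarrow> real) \<Rightarrow> real \<times> real \<Rightarrow> real \<times> real \<Rightarrow> real \<times> real \<Rightarrow> real" where
  "area_form \<gamma> q u w = \<gamma> (fst q) * (fst u * snd w - snd u * fst w)"

definition unit_vec :: "(real \<Rightarrow> real) \<Rightarrow> coords \<Rightarrow> real \<times> real" where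
  "unit_vec \<gamma> = (\<lambda>(t, \<phi>, \<theta>). (cos \<phi>, sin \<phi> / \<gamma> t))"

text \<open>Christoffel term of the Levi-Civita connection, from Koszul's formula for constant
  (coordinate) vector fields.\<close>

definition christoffel :: "(real \<Rightarrow> real) \<Rightarrow> real \<times> real \<Rightarrow> real \<times> real \<Rightarrow> real \<times> real \<Rightarrow> real \<times> real" where
  "christoffel \<gamma> q u w = (THE c. \<forall>e.
     2 * metric \<gamma> q c e =
       frechet_derivative (\<lambda>q. metric \<gamma> q w e) (at q) u
     + frechet_derivative (\<lambda>q. metric \<gamma> q u e) (at q) w
     - frechet_derivative (\<lambda>q. metric \<gamma> q u w) (at q) e)"

text \<open>The generator of the geodesic flow: the projected curve moves with velocity \<open>v = unit_vec \<gamma> x\<close>,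
  and \<open>v\<close> is parallel along it.\<close>

definition geodesic_field :: "(real \<Rightarrow> real) \<Rightarrow> coords \<Rightarrow> coords" where
  "geodesic_field \<gamma> x = (THE \<xi>.
     base_pt \<xi> = unit_vec \<gamma> x \<and>
     frechet_derivative (unit_vec \<gamma>) (at x) \<xi>
       + christoffel \<gamma> (base_pt x) (unit_vec \<gamma> x) (unit_vec \<gamma> x) = 0)"

definition magnetic_field_polar :: "(real \<Rightarrow> real) \<Rightarrow> real \<Rightarrow> coords \<Rightarrow> coords" where
  "magnetic_field_polar \<gamma> m x = m *\<^sub>R geodesic_field \<gamma> x + (0, 1, 0)"

text \<open>The field \<open>mX + V\<close> in the two charts.  Over a pole, \<open>X\<close> moves the base point in the direction
  \<open>cis \<psi>\<close> and, as geodesics through the pole are straight lines in the chart, keeps the direction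
  angle \<open>\<psi>\<close>; \<open>V\<close> is \<open>\<partial>_\<psi>\<close> in the first chart and \<open>-\<partial>_\<psi>\<close> in the second one, which reverses
  orientation.\<close>

definition magnetic_field :: "(real \<Rightarrow> real) \<Rightarrow> real \<Rightarrow> real \<Rightarrow> chart_field" where
  "magnetic_field \<gamma> l m c w =
     (if fst w = 0 then (of_real m * cis (snd w), case c of Pole0 \<Rightarrow> 1 | Pole1 \<Rightarrow> -1)
      else (THE \<eta>. \<exists>x\<in>polar_interior l. polar l c x = w \<and>
              \<eta> = frechet_derivative (polar l c) (at x) (magnetic_field_polar \<gamma> m x)))"

definition alpha :: "(real \<Rightarrow> real) \<Rightarrow> coords \<Rightarrow> coords \<Rightarrow> real" where
  "alpha \<gamma> x \<xi> = metric \<gamma> (base_pt x) (unit_vec \<gamma> x) (base_pt \<xi>)"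

definition omega :: "(real \<Rightarrow> real) \<Rightarrow> real \<Rightarrow> coords \<Rightarrow> coords \<Rightarrow> coords \<Rightarrow> real" where
  "omega \<gamma> m x \<xi> \<eta> =
     m * ext_deriv (alpha \<gamma>) x \<xi> \<eta> - area_form \<gamma> (base_pt x) (base_pt \<xi>) (base_pt \<eta>)"

text \<open>Equality of the smooth forms \<open>d\<tau>\<close> and \<open>\<omega>\<close> is only required off the polar fibres, that is, on
  a dense open set.\<close>

definition primitive_of_omega :: "(real \<Rightarrow> real) \<Rightarrow> real \<Rightarrow> real \<Rightarrow> chart_form \<Rightarrow> bool" where
  "primitive_of_omega \<gamma> l m \<tau> \<longleftrightarrow> smooth_one_form l \<tau> \<and>
     (\<forall>x\<in>polar_interior l. \<forall>\<xi> \<eta>.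
        ext_deriv (pullback (polar l Pole0) (\<tau> Pole0)) x \<xi> \<eta> = omega \<gamma> m x \<xi> \<eta>)"


section \<open>Invariant measures and their action\<close>

definition invariant_prob :: "real \<Rightarrow> chart_field \<Rightarrow> upoint measure \<Rightarrow> bool" where
  "invariant_prob l Y \<zeta> \<longleftrightarrow> prob_space \<zeta> \<and> sets \<zeta> = sets (SS_borel l) \<and>
     (\<forall>\<Phi>. flow_of l Y \<Phi> \<longrightarrow> (\<forall>s. distr \<zeta> (SS_borel l) (\<Phi> s) = \<zeta>))"

definition measure_support :: "real \<Rightarrow> upoint measure \<Rightarrow> upoint set" where
  "measure_support l \<zeta> =
     {p \<in> SS l. \<forall>U. openin (SS_top l) U \<and> p \<in> U \<longrightarrow> emeasure \<zeta> U > 0}"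

text \<open>The choice of the primitive does not matter for invariant measures, since every closed one-form on
  the unit tangent bundle of the sphere is exact.\<close>

definition action :: "(real \<Rightarrow> real) \<Rightarrow> real \<Rightarrow> real \<Rightarrow> upoint measure \<Rightarrow> real" where
  "action \<gamma> l m \<zeta> =
     (\<integral>p. contraction l (SOME \<tau>. primitive_of_omega \<gamma> l m \<tau>) (magnetic_field \<gamma> l m) p \<partial>\<zeta>)"

definition orbit_measure :: "real \<Rightarrow> (real \<Rightarrow> upoint) \<Rightarrow> real \<Rightarrow> upoint measure" where
  "orbit_measure l u T = distr (uniform_measure lborel {0..T}) (SS_borel l) u"

text \<open>The latitude \<open>t = t\<^sub>0\<close> parametrized by arc length in the direction \<open>\<sigma> \<partial>_\<theta>\<close>, where \<open>\<sigma> = \<plusminus>1\<close>.\<close>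

definition latitude :: "(real \<Rightarrow> real) \<Rightarrow> real \<Rightarrow> real \<Rightarrow> real \<Rightarrow> real \<times> real" where
  "latitude \<gamma> t\<^sub>0 \<sigma> s = (t\<^sub>0, \<sigma> * s / \<gamma> t\<^sub>0)"

text \<open>The lift of a unit speed curve avoiding the poles by its unit tangent vector.\<close>

definition unit_tangent_lift :: "(real \<Rightarrow> real) \<Rightarrow> real \<Rightarrow> (real \<Rightarrow> real \<times> real) \<Rightarrow> real \<Rightarrow> upoint" where
  "unit_tangent_lift \<gamma> l b s = (THE p. \<exists>x\<in>polar_interior l.
     p = pt l x \<and> base_pt x = b s \<and> unit_vec \<gamma> x = vector_derivative b (at s))"

end

(*
  In polar coordinates a primitive of omega is m alpha + dphi - Gamma dtheta.  It extends smoothly over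
  the poles because, by the vanishing of the even derivatives, (gamma(t) - t) / t^3 and
  (1 + Gamma(t)) / t^2 are smooth even functions of t, so that they give smooth functions of z in
  geodesic normal coordinates around the pole; likewise at the other end.

  For an arbitrary primitive tau, Stokes' theorem on the annuli {phi = const} and {theta = const} gives
  its integrals over the theta-circles and over the fibres up to constants.  Both circles degenerate to
  the polar fibres, but with opposite relative orientation at the two poles, which determines the
  constants: the integral of tau over the lifted latitude is 2 pi (m gamma sin phi - Gamma).

  On the lifted latitude the field m X + V reduces to a constant multiple of d/dtheta by the choice of m,
  and Gronwall's lemma shows that no other integral curve meets it; hence the orbit measure is invariant
  and is determined by the latitude.  Finally, if m^2 K + 1 > 0 then N = sigma m gamma' - gamma satisfies
  -sigma (exp(sigma t / m) N)' > 0, so that sigma m gamma - Gamma is increasing between the appropriate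
  pole and t_0; this gives the sign of the action.
*)
theory Submission
  imports Defs
begin

section \<open>Smooth functions and radial extension\<close>

text \<open>\<open>action\<close> integrates a primitive picked by choice. Hence one primitive has
  to be built, since otherwise the choice is void, and the value has to be computed for every
  primitive: the circle integrals of an arbitrary \<open>\<tau>\<close> take the place of the
  exactness of closed one-forms.

  Invariance is required under every map satisfying \<open>flow_of\<close>, none of which is
  constructed: what is shown is that any integral curve that meets the latitude once is the explicit
  rotation along it. The theorem speaks of every periodic orbit \<open>u\<close> over the latitude
  and of every period \<open>T\<close>, also a multiple of the least one. The same uniqueness
  identifies \<open>u\<close> with the rotation up to an unknown phase, and \<open>T\<close> enters
  only through the fact that the angle covered is a multiple of \<open>2 * pi\<close>, so that
  averages over \<open>{0..T}\<close> are averages over the circle.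

  Angles are real numbers and points are classes of triples. Angles are therefore compared through
  \<open>cis\<close>, while derivatives are taken of local real lifts.\<close>

lemma Ck_on_cong:
  assumes "open S" "\<And>x. x \<in> S \<Longrightarrow> f x = g x" "Ck_on S k f"
  shows "Ck_on S k g"
  using assms(2,3)
proof (induction k arbitrary: f g)
  case 0
  then show ?case by (auto cong: continuous_on_cong)
next
  case (Suc k)
  have d: "(g has_derivative frechet_derivative f (at x)) (at x)" if "x \<in> S" for x
  proof (rule has_derivative_transform_within_open)
    show "(f has_derivative frechet_derivative f (at x)) (at x)"
      using Suc.prems(2) that by (simp add: frechet_derivative_works)
  qed (use assms(1) that Suc.prems(1) in auto)
  have eq: "frechet_derivative f (at x) = frechet_derivative g (at x)" if "x \<in> S" for x
    using d[OF that] frechet_derivative_at by blast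
  have "Ck_on S k (\<lambda>x. frechet_derivative g (at x) v)" for v
    by (rule Suc.IH[where f = "\<lambda>x. frechet_derivative f (at x) v"]) (use eq Suc.prems(2) in auto)
  moreover have "\<forall>x\<in>S. g differentiable at x" using d unfolding differentiable_def by blast
  ultimately show ?case by simp
qed

text \<open>A candidate derivative may replace the \<open>frechet_derivative\<close> of the
  definition, since on an open set the two agree by uniqueness. The closure rules below go through
  this form.\<close>

lemma Ck_on_SucI:
  assumes "open S" "\<And>x. x \<in> S \<Longrightarrow> (f has_derivative f' x) (at x)" "\<And>v. Ck_on S k (\<lambda>x. f' x v)"
  shows "Ck_on S (Suc k) f"
proof -
  have "Ck_on S k (\<lambda>x. frechet_derivative f (at x) v)" for v
    by (rule Ck_on_cong[OF assms(1) _ assms(3)[of v]]) (simp add: frechet_derivative_at[OF assms(2)])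
  moreover have "\<forall>x\<in>S. f differentiable at x" using assms(2) unfolding differentiable_def by blast
  ultimately show ?thesis by simp
qed

lemma Ck_on_SucD:
  assumes "Ck_on S (Suc k) f" "x \<in> S"
  shows "(f has_derivative frechet_derivative f (at x)) (at x)"
  using assms by (simp add: frechet_derivative_works)

lemma Ck_on_frechet_derivative:
  "Ck_on S (Suc k) f \<Longrightarrow> Ck_on S k (\<lambda>x. frechet_derivative f (at x) v)"
  by simp

lemma Ck_on_imp_continuous_on: "Ck_on S k f \<Longrightarrow> continuous_on S f"
  by (cases k) (auto intro!: continuous_at_imp_continuous_on differentiable_imp_continuous_within)

lemma Ck_on_pred: "Ck_on S (Suc k) f \<Longrightarrow> Ck_on S k f"
proof (induction k arbitrary: f)
  case 0
  then show ?case using Ck_on_imp_continuous_on[OF 0] by simp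
next
  case (Suc k)
  from Suc.prems have "Ck_on S (Suc k) (\<lambda>x. frechet_derivative f (at x) v)" for v by simp
  then have "Ck_on S k (\<lambda>x. frechet_derivative f (at x) v)" for v by (rule Suc.IH)
  with Suc.prems show ?case by simp
qed

lemma Ck_on_const: "open S \<Longrightarrow> Ck_on S k (\<lambda>x. c)"
proof (induction k arbitrary: c)
  case (Suc k)
  then show ?case by (intro Ck_on_SucI[where f' = "\<lambda>x v. 0"]) auto
qed auto

lemma Ck_on_linear:
  assumes "open S" "bounded_linear f"
  shows "Ck_on S k f"
proof (cases k)
  case 0
  then show ?thesis using assms linear_continuous_on by auto
next
  case (Suc j)
  then show ?thesis using assms
    by (auto intro!: Ck_on_SucI[where f' = "\<lambda>x v. f v"] Ck_on_const bounded_linear_imp_has_derivative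
        simp del: Ck_on.simps)
qed

lemma Ck_on_add:
  assumes "open S" "Ck_on S k f" "Ck_on S k g"
  shows "Ck_on S k (\<lambda>x. f x + g x)"
  using assms(2,3)
proof (induction k arbitrary: f g)
  case 0
  then show ?case by (auto intro: continuous_on_add)
next
  case (Suc k)
  show ?case
  proof (rule Ck_on_SucI[OF assms(1)])
    show "((\<lambda>x. f x + g x) has_derivative
       (\<lambda>v. frechet_derivative f (at x) v + frechet_derivative g (at x) v)) (at x)" if "x \<in> S" for x
      by (intro has_derivative_add Ck_on_SucD[OF Suc.prems(1) that] Ck_on_SucD[OF Suc.prems(2) that])
    show "Ck_on S k (\<lambda>x. frechet_derivative f (at x) v + frechet_derivative g (at x) v)" for v
      by (rule Suc.IH) (use Suc.prems in auto)
  qed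
qed

lemma Ck_on_mult:
  assumes "open S" "Ck_on S k f" "Ck_on S k g"
  shows "Ck_on S k (\<lambda>x. f x * g x)"
  using assms(2,3)
proof (induction k arbitrary: f g)
  case 0
  then show ?case by (auto intro: continuous_on_mult)
next
  case (Suc k)
  show ?case
  proof (rule Ck_on_SucI[OF assms(1)])
    show "((\<lambda>x. f x * g x) has_derivative
       (\<lambda>v. f x * frechet_derivative g (at x) v + frechet_derivative f (at x) v * g x)) (at x)" if "x \<in> S" for x
      by (intro has_derivative_mult Ck_on_SucD[OF Suc.prems(1) that] Ck_on_SucD[OF Suc.prems(2) that])
    show "Ck_on S k (\<lambda>x. f x * frechet_derivative g (at x) v + frechet_derivative f (at x) v * g x)" for v
    proof (intro Ck_on_add[OF assms(1)] Suc.IH)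
      \<comment> \<open>The Leibniz rule keeps one factor undifferentiated; that factor has to be
        lowered from class \<open>Suc k\<close> to class \<open>k\<close>.\<close>
      show "Ck_on S k f" "Ck_on S k g" by (rule Ck_on_pred[OF Suc.prems(1)], rule Ck_on_pred[OF Suc.prems(2)])
    qed (use Suc.prems in auto)
  qed
qed

text \<open>Each function differentiates into the other, so the induction has to carry both.\<close>

lemma Ck_on_sin_cos:
  fixes a :: "'a::real_normed_vector \<Rightarrow> real"
  assumes "open S" "bounded_linear a"
  shows "Ck_on S k (\<lambda>x. sin (a x)) \<and> Ck_on S k (\<lambda>x. cos (a x))"
proof (induction k)
  case 0
  show ?case using linear_continuous_on[OF assms(2)] by (auto intro!: continuous_intros)
next
  case (Suc k)
  have s: "((\<lambda>x. sin (a x)) has_derivative (\<lambda>v. cos (a x) * a v)) (at x)"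
   and c: "((\<lambda>x. cos (a x)) has_derivative (\<lambda>v. (- a v) * sin (a x))) (at x)" for x
    by (auto intro!: derivative_eq_intros bounded_linear_imp_has_derivative[OF assms(2)] simp: fun_eq_iff)
  show ?case
  proof
    show "Ck_on S (Suc k) (\<lambda>x. sin (a x))"
      by (rule Ck_on_SucI[OF assms(1) s])
         (intro Ck_on_mult[OF assms(1)] Ck_on_const[OF assms(1)] conjunct2[OF Suc])
    show "Ck_on S (Suc k) (\<lambda>x. cos (a x))"
      by (rule Ck_on_SucI[OF assms(1) c])
         (intro Ck_on_mult[OF assms(1)] Ck_on_const[OF assms(1)] conjunct1[OF Suc])
  qed
qed

section \<open>Functions with all derivatives on a symmetric interval, and division by the
  argument\<close>

definition smooth_jet :: "real \<Rightarrow> (nat \<Rightarrow> real \<Rightarrow> real) \<Rightarrow> bool" where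
  "smooth_jet l D \<longleftrightarrow> (\<forall>k t. \<bar>t\<bar> < l \<longrightarrow> (D k has_real_derivative D (Suc k) t) (at t))"

text \<open>Hadamard's quotient: if \<open>D 0 0 = 0\<close>, entry 0 extends
  \<open>D 0 t / t\<close> smoothly to \<open>t = 0\<close>. Entry \<open>k\<close> is its
  \<open>k\<close>-th derivative, as each derivative under the integral sign brings out one factor
  \<open>s\<close>.\<close>

definition jet_quotient :: "(nat \<Rightarrow> real \<Rightarrow> real) \<Rightarrow> nat \<Rightarrow> real \<Rightarrow> real" where
  "jet_quotient D k t = integral {0..1} (\<lambda>s. s ^ k * D (Suc k) (s * t))"

lemma smooth_jet_continuous: "smooth_jet l D \<Longrightarrow> continuous_on {-l<..<l} (D k)"
  by (rule DERIV_continuous_on[of _ _ "D (Suc k)"], rule has_field_derivative_at_within)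
     (simp add: smooth_jet_def abs_less_iff)

lemma scaled_arg: "\<bar>t\<bar> < l \<Longrightarrow> s \<in> {0..1} \<Longrightarrow> \<bar>s * t\<bar> < (l::real)"
  using mult_left_le_one_le[of "\<bar>t\<bar>" s] by (auto simp: abs_mult)

lemma smooth_jet_quotient:
  assumes "smooth_jet l D"
  shows "smooth_jet l (jet_quotient D)"
  unfolding smooth_jet_def
proof (intro allI impI)
  fix k and t :: real assume t: "\<bar>t\<bar> < l"
  let ?f = "\<lambda>t s. s ^ k * D (Suc k) (s * t)" and ?f' = "\<lambda>t s. s ^ Suc k * D (Suc (Suc k)) (s * t)"
  have cont: "continuous_on ({-l<..<l} \<times> cbox 0 1) (\<lambda>(t, s). s ^ j * D i (s * t))" for i j
    unfolding case_prod_unfold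
    by (intro continuous_intros continuous_on_compose2[OF smooth_jet_continuous[OF assms]])
       (use scaled_arg in \<open>fastforce simp: abs_less_iff\<close>)
  have "((\<lambda>t. integral (cbox 0 1) (?f t)) has_field_derivative integral (cbox 0 1) (?f' t)) (at t within {-l<..<l})"
  proof (rule leibniz_rule_field_derivative[where fx = ?f'])
    show "((\<lambda>t. s ^ k * D (Suc k) (s * t)) has_field_derivative s ^ Suc k * D (Suc (Suc k)) (s * t)) (at t within {-l<..<l})"
      if "t \<in> {-l<..<l}" "s \<in> cbox 0 1" for t s :: real
    proof -
      have "\<bar>s * t\<bar> < l" using that scaled_arg[of t l s] by (auto simp: abs_less_iff)
      then have "(D (Suc k) has_real_derivative D (Suc (Suc k)) (s * t)) (at (s * t))"
        using assms by (auto simp: smooth_jet_def)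
      then have "((\<lambda>t. D (Suc k) (s * t)) has_real_derivative D (Suc (Suc k)) (s * t) * s) (at t)"
        by (rule DERIV_chain2) (auto intro!: derivative_eq_intros)
      from DERIV_cmult[OF this, of "s ^ k"]
      have "((\<lambda>t. s ^ k * D (Suc k) (s * t)) has_real_derivative s ^ Suc k * D (Suc (Suc k)) (s * t)) (at t)"
        by (simp add: mult_ac)
      then show ?thesis by (rule has_field_derivative_at_within)
    qed
    show "?f t integrable_on cbox 0 1" if "t \<in> {-l<..<l}" for t :: real
    proof (rule integrable_continuous)
      have "continuous_on (cbox 0 1) (\<lambda>s. (t, s))" by (intro continuous_intros)
      moreover have "continuous_on ((\<lambda>s. (t, s)) ` cbox 0 1) (\<lambda>(t, s). s ^ k * D (Suc k) (s * t))"
        by (rule continuous_on_subset[OF cont]) (use that in auto)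
      ultimately have "continuous_on (cbox 0 1) ((\<lambda>(t, s). s ^ k * D (Suc k) (s * t)) \<circ> (\<lambda>s. (t, s)))"
        by (rule continuous_on_compose)
      then show "continuous_on (cbox 0 1) (?f t)" by (simp add: o_def)
    qed
    show "continuous_on ({-l<..<l} \<times> cbox 0 1) (\<lambda>(t, s). s ^ Suc k * D (Suc (Suc k)) (s * t))" by (rule cont)
    show "t \<in> {-l<..<l}" using t by (simp add: abs_less_iff)
  qed (rule convex_real_interval)
  then show "(jet_quotient D k has_real_derivative jet_quotient D (Suc k) t) (at t)"
    using t by (simp add: jet_quotient_def[abs_def] at_within_open[of t "{-l<..<l}"] abs_less_iff)
qed

text \<open>The fundamental theorem of calculus on the segment from 0 to \<open>t\<close>,
  parametrised by \<open>s * t\<close>.\<close>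

lemma jet_quotient_mult:
  assumes "smooth_jet l D" "D 0 0 = 0" "\<bar>t\<bar> < l"
  shows "t * jet_quotient D 0 t = D 0 t"
proof -
  have "((\<lambda>s. D 1 (s * t) * t) has_integral (D 0 (1 * t) - D 0 (0 * t))) {0..1}"
  proof (rule fundamental_theorem_of_calculus)
    fix s :: real assume s: "s \<in> {0..1}"
    have "(D 0 has_real_derivative D 1 (s * t)) (at (s * t))"
      using assms scaled_arg[OF assms(3) s] by (auto simp: smooth_jet_def)
    then have "((\<lambda>s. D 0 (s * t)) has_real_derivative D 1 (s * t) * t) (at s)"
      by (rule DERIV_chain2) (auto intro!: derivative_eq_intros)
    then show "((\<lambda>s. D 0 (s * t)) has_vector_derivative D 1 (s * t) * t) (at s within {0..1})"
      by (simp add: has_real_derivative_iff_has_vector_derivative has_vector_derivative_at_within)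
  qed auto
  then have "integral {0..1} (\<lambda>s. D 1 (s * t) * t) = D 0 t" using assms(2) by (intro integral_unique) simp
  then show ?thesis by (simp add: jet_quotient_def mult.commute)
qed

lemma smooth_jet_shift: "smooth_jet l D \<Longrightarrow> smooth_jet l (\<lambda>k. D (Suc k))"
  by (auto simp: smooth_jet_def)

text \<open>The factor \<open>e\<close> stands for 1 or -1, so that even and odd functions share one
  lemma.\<close>

lemma jet_parity:
  assumes "smooth_jet l D" "\<And>t. \<bar>t\<bar> < l \<Longrightarrow> D 0 (-t) = e * D 0 t" "\<bar>t\<bar> < l"
  shows "D 1 (-t) = - e * D 1 t"
proof -
  have "((\<lambda>t. D 0 (-t)) has_real_derivative D 1 (-t) * (-1)) (at t)"
    by (rule DERIV_chain2[of "D 0"]) (use assms in \<open>auto simp: smooth_jet_def intro!: derivative_eq_intros\<close>)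
  moreover have "((\<lambda>t. D 0 (-t)) has_real_derivative e * D 1 t) (at t)"
  proof (rule has_field_derivative_transform_within_open[of "\<lambda>t. e * D 0 t"])
    show "((\<lambda>t. e * D 0 t) has_real_derivative e * D 1 t) (at t)"
      using assms by (auto simp: smooth_jet_def intro!: DERIV_cmult)
  qed (use assms in \<open>auto simp: abs_less_iff intro: open_greaterThanLessThan[of "-l" l]\<close>)
  ultimately show ?thesis using DERIV_unique by fastforce
qed

lemma jet_quotient_parity:
  assumes "smooth_jet l D" "\<And>t. \<bar>t\<bar> < l \<Longrightarrow> D 0 (-t) = e * D 0 t" "\<bar>t\<bar> < l"
  shows "jet_quotient D 0 (-t) = - e * jet_quotient D 0 t"
proof -
  have "integral {0..1} (\<lambda>s. D 1 (s * (-t))) = integral {0..1} (\<lambda>s. - e * D 1 (s * t))"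
    by (rule integral_cong) (use jet_parity[OF assms(1,2)] scaled_arg[OF assms(3)] in auto)
  then show ?thesis by (simp add: jet_quotient_def)
qed

lemma open_chart_dom: "open (chart_dom l)"
  by (simp add: chart_dom_def open_Times)

text \<open>Differentiating \<open>f(\<bar>z\<bar>)\<close> produces \<open>f'(t)/t\<close>, which is again smooth and even; hence the induction.\<close>

lemma Ck_on_radial:
  assumes "smooth_jet l D" "\<And>t. \<bar>t\<bar> < l \<Longrightarrow> D 0 (-t) = D 0 t"
  shows "Ck_on (chart_dom l) k (\<lambda>w. D 0 (norm (fst w)))"
  using assms
proof (induction k arbitrary: D)
  case 0
  have "(\<lambda>w. norm (fst w)) ` chart_dom l \<subseteq> {-l<..<l}"
  proof (rule image_subsetI)
    fix w assume "w \<in> chart_dom l"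
    then have "norm (fst w) < l" by (auto simp: chart_dom_def)
    then show "norm (fst w) \<in> {-l<..<l}" using norm_ge_zero[of "fst w"] unfolding greaterThanLessThan_iff by linarith
  qed
  then show ?case
    unfolding Ck_on.simps
    by (intro continuous_on_compose2[OF smooth_jet_continuous[OF 0(1)]] continuous_on_norm continuous_on_fst continuous_on_id)
next
  case (Suc k)
  let ?Q = "jet_quotient (\<lambda>k. D (Suc k))"
  have odd: "D 1 (-t) = - D 1 t" if "\<bar>t\<bar> < l" for t
    using jet_parity[OF Suc.prems(1), of 1 t] Suc.prems(2) that by simp
  have Q: "smooth_jet l ?Q" by (intro smooth_jet_quotient smooth_jet_shift Suc.prems)
  have even: "?Q 0 (-t) = ?Q 0 t" if "\<bar>t\<bar> < l" for t
    using jet_quotient_parity[OF smooth_jet_shift[OF Suc.prems(1)], of "-1" t] odd that by simp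
  have D1: "D 1 t = t * ?Q 0 t" if "\<bar>t\<bar> < l" for t
    using jet_quotient_mult[OF smooth_jet_shift[OF Suc.prems(1)] _ that] odd[of 0] that by simp
  have d: "((\<lambda>w. D 0 (norm (fst w))) has_derivative (\<lambda>v. ?Q 0 (norm (fst w)) * inner (fst w) (fst v))) (at w)"
    if w: "w \<in> chart_dom l" for w
  proof -
    have nw: "\<bar>norm (fst w)\<bar> < l" using w by (auto simp: chart_dom_def)
    have D0: "(D 0 has_derivative (*) (D 1 (norm (fst w)))) (at (norm (fst w)))"
      using Suc.prems(1) nw by (auto simp: smooth_jet_def has_field_derivative_def)
    have "((\<lambda>z. D 0 (norm z)) has_derivative (\<lambda>v. ?Q 0 (norm (fst w)) * inner (fst w) v)) (at (fst w))"
    proof (cases "fst w = 0")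
      case True
      \<comment> \<open>The norm is not differentiable at the origin. There the vanishing of
        \<open>D 1 0\<close> makes \<open>D 0\<close> constant to first order, and this estimate
        passes to the norm unchanged.\<close>
      have *: "(D 0 has_derivative (\<lambda>h. 0)) (at 0)"
        using D0 D1[OF nw] True by (simp add: fun_eq_iff mult.commute[of 0] lambda_zero)
      have "((\<lambda>z::complex. D 0 (norm z)) has_derivative (\<lambda>v. 0)) (at 0)"
        unfolding has_derivative_at_alt
      proof (intro conjI allI impI)
        fix e :: real assume "e > 0"
        with * obtain d where d: "d > 0" "\<And>y. \<bar>y\<bar> < d \<Longrightarrow> \<bar>D 0 y - D 0 0\<bar> \<le> e * \<bar>y\<bar>"
          unfolding has_derivative_at_alt by auto
        have "norm (D 0 (norm z) - D 0 (norm 0) - 0) \<le> e * norm (z - 0)" if "norm (z - 0) < d" for z :: complex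
          using that d(2)[of "norm z"] by simp
        then show "\<exists>d>0. \<forall>z::complex. norm (z - 0) < d \<longrightarrow>
            norm (D 0 (norm z) - D 0 (norm 0) - 0) \<le> e * norm (z - 0)"
          using d(1) by blast
      qed simp
      then show ?thesis using True by simp
    next
      case False
      have "(norm has_derivative (\<lambda>v. inner (fst w) v / norm (fst w))) (at (fst w))"
        using has_derivative_norm[OF False] by (simp add: sgn_div_norm inner_commute divide_inverse mult.commute)
      from has_derivative_compose[OF this D0]
      show ?thesis using False D1[OF nw] by (simp add: mult.commute)
    qed
    from has_derivative_compose[OF has_derivative_fst[OF has_derivative_ident] this]
    show ?thesis by simp
  qed
  show ?case
  proof (rule Ck_on_SucI[OF open_chart_dom d])
    show "Ck_on (chart_dom l) k (\<lambda>w. ?Q 0 (norm (fst w)) * inner (fst w) (fst v))" for v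
    proof (rule Ck_on_mult[OF open_chart_dom])
      show "Ck_on (chart_dom l) k (\<lambda>w. ?Q 0 (norm (fst w)))"
        by (rule Suc.IH[OF Q even])
      show "Ck_on (chart_dom l) k (\<lambda>w. inner (fst w) (fst v))"
        by (rule Ck_on_linear[OF open_chart_dom bounded_linear_compose[OF bounded_linear_inner_left bounded_linear_fst]])
    qed
  qed
qed

section \<open>Charts of the unit tangent bundle\<close>

lemma equiv_same_vector: "equiv (polar_box l) (same_vector l)"
  by (rule equivI) (auto simp: same_vector_def polar_box_def refl_on_def sym_def trans_def split: if_splits)

lemma pt_eq_iff:
  assumes "x \<in> polar_box l" "y \<in> polar_box l"
  shows "pt l x = pt l y \<longleftrightarrow> (x, y) \<in> same_vector l"
  unfolding pt_def using eq_equiv_class_iff[OF equiv_same_vector assms] .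

lemma pt_in_SS: "x \<in> polar_box l \<Longrightarrow> pt l x \<in> SS l"
  by (simp add: pt_def SS_def quotientI)

lemma SS_E:
  assumes "p \<in> SS l" obtains x where "x \<in> polar_box l" "p = pt l x"
  using assms by (auto simp: SS_def pt_def quotient_def)

lemma polar_interior_subset: "x \<in> polar_interior l \<Longrightarrow> x \<in> polar_box l"
  by (auto simp: polar_interior_def polar_box_def)

lemma open_polar_interior: "open (polar_interior l)"
  by (simp add: polar_interior_def open_Times)

lemma pt_interior_iff:
  assumes "0 < t" "t < l" "t' \<in> {0..l}"
  shows "pt l (t, \<phi>, \<theta>) = pt l (t', \<phi>', \<theta>') \<longleftrightarrow> t' = t \<and> cis \<phi>' = cis \<phi> \<and> cis \<theta>' = cis \<theta>"
  using assms by (subst pt_eq_iff) (auto simp: polar_box_def same_vector_def)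

lemma of_real_mult_cis_eq_iff:
  assumes "r > 0" "s \<ge> 0"
  shows "of_real r * cis a = of_real s * cis b \<longleftrightarrow> r = s \<and> cis a = cis b"
proof
  assume *: "of_real r * cis a = of_real s * cis b"
  then have "norm (of_real r * cis a) = norm (of_real s * cis b)" by simp
  then have "r = s" using assms by (simp add: norm_mult)
  then show "r = s \<and> cis a = cis b" using * assms by simp
qed auto

text \<open>Off the pole of the chart, the complex coordinate yields \<open>t\<close> and
  \<open>cis \<theta>\<close>, and then the fibre coordinate yields \<open>cis \<phi>\<close>. Over
  the pole only the fibre coordinate is left, which is what \<open>same_vector\<close> compares
  there. The domain condition excludes the opposite pole.\<close>

lemma polar_injD:
  assumes "x \<in> polar_box l" "y \<in> polar_box l" "polar l c x = polar l c y" "polar l c x \<in> chart_dom l"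
  shows "(x, y) \<in> same_vector l"
proof -
  obtain t \<phi> \<theta> t' \<phi>' \<theta>' where x: "x = (t, \<phi>, \<theta>)" and y: "y = (t', \<phi>', \<theta>')" by (cases x, cases y) auto
  show ?thesis
  proof (cases c)
    case Pole0
    have e: "of_real t * cis \<theta> = of_real t' * cis \<theta>'" "\<phi> + \<theta> = \<phi>' + \<theta>'" "0 \<le> t" "0 \<le> t'"
      using assms(1-3) x y Pole0 by (auto simp: polar_box_def)
    have "t < l" using assms(1,4) x Pole0 by (auto simp: polar_box_def chart_dom_def norm_mult)
    note e = e this
    show ?thesis
    proof (cases "t = 0")
      case True
      then show ?thesis using e x y by (auto simp: same_vector_def)
    next
      case False
      then have "t = t'" "cis \<theta> = cis \<theta>'" using of_real_mult_cis_eq_iff[of t t' \<theta> \<theta>'] e by auto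
      moreover have "cis \<phi> = cis (\<phi> + \<theta>) / cis \<theta>" "cis \<phi>' = cis (\<phi>' + \<theta>') / cis \<theta>'" by (simp_all add: cis_divide)
      ultimately show ?thesis using e x y False by (auto simp: same_vector_def)
    qed
  next
    case Pole1
    have e: "of_real (l - t) * cis \<theta> = of_real (l - t') * cis \<theta>'" "pi - \<phi> + \<theta> = pi - \<phi>' + \<theta>'" "t \<le> l" "t' \<le> l"
      using assms(1-3) x y Pole1 by (auto simp: polar_box_def)
    have "0 < t" using assms(1,4) x Pole1
      by (auto simp: polar_box_def chart_dom_def norm_mult simp flip: of_real_diff)
    note e = e this
    show ?thesis
    proof (cases "t = l")
      case True
      then have "t' = l" using e(1) by simp
      then show ?thesis using e(3-) x y True by (simp add: same_vector_def e(2))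
    next
      case False
      then have "t = t'" "cis \<theta> = cis \<theta>'" using of_real_mult_cis_eq_iff[of "l - t" "l - t'" \<theta> \<theta>'] e by auto
      moreover have "cis \<phi> = cis (pi + \<theta>) / cis (pi - \<phi> + \<theta>)" "cis \<phi>' = cis (pi + \<theta>') / cis (pi - \<phi>' + \<theta>')"
        by (simp_all add: cis_divide)
      ultimately show ?thesis using e x y False by (auto simp: same_vector_def simp flip: cis_mult)
    qed
  qed
qed

text \<open>By \<open>polar_injD\<close>, all polar preimages of a chart point denote one vector, so
  the description in \<open>chart_pt\<close> is unambiguous.\<close>

lemma chart_pt_polar:
  assumes "x \<in> polar_box l" "polar l c x \<in> chart_dom l"
  shows "chart_pt l c (polar l c x) = pt l x"
  unfolding chart_pt_def
proof (rule the_equality)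
  show "p = pt l x" if "\<exists>y\<in>polar_box l. polar l c y = polar l c x \<and> p = pt l y" for p
    using that polar_injD[OF assms(1) _ _ assms(2)] pt_eq_iff[OF assms(1)] by metis
qed (use assms in auto)

lemma polar_surj:
  assumes "w \<in> chart_dom l"
  obtains x where "x \<in> polar_box l" "polar l c x = w" "fst w \<noteq> 0 \<Longrightarrow> x \<in> polar_interior l"
proof (cases c)
  case Pole0
  \<comment> \<open>Over the pole any angle would do; \<open>Arg\<close> then merely supplies
    one.\<close>
  define x where "x = (norm (fst w), snd w - Arg (fst w), Arg (fst w))"
  show ?thesis
    by (rule that[of x]) (use assms Pole0 rcis_cmod_Arg[of "fst w"] in
        \<open>auto simp: x_def polar_box_def polar_interior_def chart_dom_def rcis_def prod_eq_iff\<close>)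
next
  case Pole1
  define x where "x = (l - norm (fst w), pi + Arg (fst w) - snd w, Arg (fst w))"
  show ?thesis
    by (rule that[of x]) (use assms Pole1 rcis_cmod_Arg[of "fst w"] in
        \<open>auto simp: x_def polar_box_def polar_interior_def chart_dom_def rcis_def prod_eq_iff\<close>)
qed

lemma polar_in_chart_dom: "x \<in> polar_interior l \<Longrightarrow> polar l c x \<in> chart_dom l"
  by (cases c; cases x) (auto simp: polar_interior_def chart_dom_def norm_mult simp flip: of_real_diff)

lemma polar_nonzero: "x \<in> polar_interior l \<Longrightarrow> fst (polar l c x) \<noteq> 0"
  by (cases c; cases x) (auto simp: polar_interior_def simp flip: of_real_diff)

section \<open>The differential of the transition maps, and comparison of chart points\<close>

fun polar_D :: "real \<Rightarrow> pole \<Rightarrow> coords \<Rightarrow> coords \<Rightarrow> complex \<times> real" where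
  "polar_D l Pole0 (t, \<phi>, \<theta>) (a, b, d) = (of_real a * cis \<theta> + of_real (t * d) * (\<i> * cis \<theta>), b + d)"
| "polar_D l Pole1 (t, \<phi>, \<theta>) (a, b, d) = (- of_real a * cis \<theta> + of_real ((l - t) * d) * (\<i> * cis \<theta>), d - b)"

lemma has_derivative_polar: "(polar l c has_derivative polar_D l c x) (at x)"
proof -
  obtain t \<phi> \<theta> where x: "x = (t, \<phi>, \<theta>)" by (cases x) auto
  show ?thesis
  proof (cases c)
    case Pole0
    have p: "polar l c = (\<lambda>x. (of_real (fst x) * cis (snd (snd x)), fst (snd x) + snd (snd x)))"
      by (auto simp: Pole0 fun_eq_iff)
    show ?thesis unfolding p
      by (rule derivative_eq_intros refl | simp add: x Pole0 fun_eq_iff algebra_simps scaleR_conv_of_real)+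
  next
    case Pole1
    have p: "polar l c = (\<lambda>x. (of_real (l - fst x) * cis (snd (snd x)), pi - fst (snd x) + snd (snd x)))"
      by (auto simp: Pole1 fun_eq_iff)
    show ?thesis unfolding p
      by (rule derivative_eq_intros refl | simp add: x Pole1 fun_eq_iff algebra_simps scaleR_conv_of_real)+
  qed
qed

lemma frechet_derivative_polar: "frechet_derivative (polar l c) (at x) = polar_D l c x"
  using frechet_derivative_at[OF has_derivative_polar] by metis

lemma linear_polar_D: "linear (polar_D l c x)"
  using has_derivative_polar has_derivative_linear by blast

lemma polar_inj_interior:
  assumes "x \<in> polar_interior l" "y \<in> polar_interior l" "polar l c x = polar l c y"
  shows "fst x = fst y" "cis (fst (snd x)) = cis (fst (snd y))" "cis (snd (snd x)) = cis (snd (snd y))"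
proof -
  have "(x, y) \<in> same_vector l"
    using assms polar_in_chart_dom polar_interior_subset polar_injD by blast
  then show "fst x = fst y" "cis (fst (snd x)) = cis (fst (snd y))" "cis (snd (snd x)) = cis (snd (snd y))"
    using assms by (cases x; cases y; auto simp: same_vector_def polar_interior_def)+
qed

lemma polar_D_cong:
  assumes "fst x = fst y" "cis (snd (snd x)) = cis (snd (snd y))"
  shows "polar_D l c x = polar_D l c y"
proof
  fix v show "polar_D l c x v = polar_D l c y v"
    using assms by (cases c; cases x; cases y; cases v) auto
qed

text \<open>The chart point lifts to polar coordinates exactly, but these match \<open>x\<close>
  only up to full turns in both angles, as the angles are real.\<close>

lemma chart_pt_eq_interior:
  assumes "w \<in> chart_dom l" "x \<in> polar_interior l" "chart_pt l c w = pt l x"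
  obtains y where "y \<in> polar_interior l" "polar l c y = w" "fst y = fst x" 
    "cis (fst (snd y)) = cis (fst (snd x))" "cis (snd (snd y)) = cis (snd (snd x))"
proof -
  obtain y where y: "y \<in> polar_box l" "polar l c y = w" using polar_surj[OF assms(1)] by metis
  have "pt l y = pt l x" using chart_pt_polar[OF y(1), of c] y(2) assms by auto
  then have "(x, y) \<in> same_vector l" using pt_eq_iff y(1) assms(2) polar_interior_subset by metis
  then show ?thesis using that[of y] assms y
    by (cases x; cases y) (auto simp: same_vector_def polar_interior_def)
qed

text \<open>Equality in the quotient becomes equality of continuous expressions in \<open>w\<close>
  and \<open>x\<close>. This is how the set of times at which two curves agree is seen to be
  closed.\<close>

lemma chart_pt_eq_interior_iff:
  assumes "w \<in> chart_dom l" "x \<in> polar_interior l"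
  shows "chart_pt l c w = pt l x \<longleftrightarrow> fst w = fst (polar l c x) \<and> cis (snd w) = cis (snd (polar l c x))"
proof
  assume "chart_pt l c w = pt l x"
  then obtain y where y: "y \<in> polar_interior l" "polar l c y = w" "fst y = fst x" 
    "cis (fst (snd y)) = cis (fst (snd x))" "cis (snd (snd y)) = cis (snd (snd x))"
    using chart_pt_eq_interior[OF assms] by metis
  show "fst w = fst (polar l c x) \<and> cis (snd w) = cis (snd (polar l c x))"
    using y(2-5) by (cases c; cases x; cases y) (auto simp: simp flip: cis_mult cis_divide)
next
  assume a: "fst w = fst (polar l c x) \<and> cis (snd w) = cis (snd (polar l c x))"
  obtain y where y: "y \<in> polar_interior l" "polar l c y = w"
    using polar_surj[OF assms(1), of c] polar_nonzero[OF assms(2)] a by metis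
  have "pt l y = pt l x"
  proof (cases c)
    case Pole0
    obtain t \<phi> \<theta> t' \<phi>' \<theta>' where xy: "x = (t, \<phi>, \<theta>)" "y = (t', \<phi>', \<theta>')" by (cases x, cases y) auto
    have "t' = t \<and> cis \<theta>' = cis \<theta>" "cis (\<phi>' + \<theta>') = cis (\<phi> + \<theta>)"
      using a y assms Pole0 xy of_real_mult_cis_eq_iff[of t' t] by (auto simp: polar_interior_def)
    then show ?thesis using xy y assms
      by (simp add: polar_interior_def pt_interior_iff flip: cis_mult)
  next
    case Pole1
    obtain t \<phi> \<theta> t' \<phi>' \<theta>' where xy: "x = (t, \<phi>, \<theta>)" "y = (t', \<phi>', \<theta>')" by (cases x, cases y) auto
    have "t' = t \<and> cis \<theta>' = cis \<theta>" "cis (pi - \<phi>' + \<theta>') = cis (pi - \<phi> + \<theta>)"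
      using a y assms Pole1 xy of_real_mult_cis_eq_iff[of "l - t'" "l - t"] by (auto simp: polar_interior_def)
    then show ?thesis using xy y assms
      by (simp add: polar_interior_def pt_interior_iff flip: cis_mult cis_divide)
  qed
  then show "chart_pt l c w = pt l x" 
    using chart_pt_polar[of y l c] y polar_in_chart_dom polar_interior_subset by metis
qed

section \<open>The magnetic field in polar coordinates\<close>

declare nderiv.simps(2) [simp del]

lemma unit_vec_polar: "unit_vec \<gamma> (t, \<phi>, \<theta>) = (cos \<phi>, sin \<phi> / \<gamma> t)"
  by (simp add: unit_vec_def)

locale profile =
  fixes \<gamma> :: "real \<Rightarrow> real" and l :: real
  assumes profile: "normalized_profile \<gamma> l"
begin

abbreviation D\<gamma> :: "nat \<Rightarrow> real \<Rightarrow> real" where "D\<gamma> \<equiv> nderiv {0..l} \<gamma>"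

lemma l_pos: "0 < l"
  and \<gamma>_0 [simp]: "\<gamma> 0 = 0"
  and \<gamma>_l [simp]: "\<gamma> l = 0"
  and D\<gamma>_1_0: "D\<gamma> 1 0 = 1"
  and D\<gamma>_1_l: "D\<gamma> 1 l = - 1"
  using profile unfolding normalized_profile_def by blast+

lemma \<gamma>_pos: "0 < t \<Longrightarrow> t < l \<Longrightarrow> 0 < \<gamma> t"
  using profile by (auto simp: normalized_profile_def)

lemma D\<gamma>_even:
  assumes "even k"
  shows "D\<gamma> k 0 = 0" "D\<gamma> k l = 0"
  using profile assms unfolding normalized_profile_def by blast+

lemma D\<gamma>_deriv:
  assumes "t \<in> {0..l}"
  shows "(D\<gamma> k has_real_derivative D\<gamma> (Suc k) t) (at t within {0..l})"
  using profile assms unfolding normalized_profile_def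
  by (simp add: nderiv.simps has_real_derivative_iff_has_vector_derivative differentiable_on_def
      flip: vector_derivative_works)

lemma D\<gamma>_deriv_at:
  assumes "0 < t" "t < l"
  shows "(D\<gamma> k has_real_derivative D\<gamma> (Suc k) t) (at t)"
  using D\<gamma>_deriv[of t k] assms by (simp add: at_within_Icc_at)

lemma \<gamma>_deriv_at:
  assumes "0 < t" "t < l"
  shows "(\<gamma> has_real_derivative D\<gamma> 1 t) (at t)"
  using D\<gamma>_deriv_at[OF assms, of 0] by simp

lemma continuous_on_D\<gamma>: "continuous_on {0..l} (D\<gamma> k)"
  by (rule DERIV_continuous_on[OF D\<gamma>_deriv])

lemma Gamma_deriv:
  assumes "t \<in> {0..l}"
  shows "(Gamma_prim \<gamma> has_real_derivative \<gamma> t) (at t within {0..l})"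
proof -
  have "((\<lambda>u. integral {0..u} \<gamma>) has_real_derivative \<gamma> t) (at t within {0..l})"
    by (rule integral_has_real_derivative) (use assms continuous_on_D\<gamma>[of 0] in auto)
  from DERIV_add[OF DERIV_const[of "-1"] this] show ?thesis
    by (simp add: Gamma_prim_def[abs_def])
qed

lemma Gamma_deriv_at:
  assumes "0 < t" "t < l"
  shows "(Gamma_prim \<gamma> has_real_derivative \<gamma> t) (at t)"
  using Gamma_deriv[of t] assms by (simp add: at_within_Icc_at)

lemma Gamma_0: "Gamma_prim \<gamma> 0 = -1"
  by (simp add: Gamma_prim_def)

lemma Gamma_l: "Gamma_prim \<gamma> l = 1"
  using profile by (simp add: Gamma_prim_def normalized_profile_def)

section \<open>Metric, connection and geodesic field in coordinates\<close>

lemma has_derivative_\<gamma>_fst: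
  assumes "0 < fst x" "fst x < l"
  shows "((\<lambda>y. \<gamma> (fst y)) has_derivative (\<lambda>v. D\<gamma> 1 (fst x) * fst v)) (at x)"
  by (rule has_derivative_compose[OF has_derivative_fst[OF has_derivative_ident]])
     (use \<gamma>_deriv_at[OF assms] in \<open>simp add: has_field_derivative_def\<close>)

lemma frechet_derivative_metric:
  assumes "0 < fst q" "fst q < l"
  shows "frechet_derivative (\<lambda>q. metric \<gamma> q u w) (at q) e = 2 * \<gamma> (fst q) * D\<gamma> 1 (fst q) * fst e * (snd u * snd w)"
proof -
  have "((\<lambda>q. metric \<gamma> q u w) has_derivative
      (\<lambda>e. 2 * \<gamma> (fst q) * D\<gamma> 1 (fst q) * fst e * (snd u * snd w))) (at q)"
    unfolding metric_def
    by (rule derivative_eq_intros has_derivative_\<gamma>_fst assms refl | simp add: fun_eq_iff)+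
  from frechet_derivative_at[OF this] show ?thesis by metis
qed

lemma christoffel_eq:
  assumes "0 < t" "t < l"
  shows "christoffel \<gamma> (t, \<theta>) u w =
    (- \<gamma> t * D\<gamma> 1 t * snd u * snd w, D\<gamma> 1 t / \<gamma> t * (fst u * snd w + snd u * fst w))" (is "_ = ?c")
proof -
  have g: "\<gamma> t \<noteq> 0" using \<gamma>_pos[OF assms] by simp
  note d = frechet_derivative_metric[of "(t, \<theta>)", unfolded fst_conv, OF assms]
  show ?thesis
    unfolding christoffel_def
  proof (rule the_equality)
    show "\<forall>e. 2 * metric \<gamma> (t, \<theta>) ?c e =
       frechet_derivative (\<lambda>q. metric \<gamma> q w e) (at (t, \<theta>)) u +
       frechet_derivative (\<lambda>q. metric \<gamma> q u e) (at (t, \<theta>)) w -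
       frechet_derivative (\<lambda>q. metric \<gamma> q u w) (at (t, \<theta>)) e"
      using assms g by (simp add: frechet_derivative_metric) (simp add: metric_def field_simps power2_eq_square)
    fix c assume c: "\<forall>e. 2 * metric \<gamma> (t, \<theta>) c e =
       frechet_derivative (\<lambda>q. metric \<gamma> q w e) (at (t, \<theta>)) u +
       frechet_derivative (\<lambda>q. metric \<gamma> q u e) (at (t, \<theta>)) w -
       frechet_derivative (\<lambda>q. metric \<gamma> q u w) (at (t, \<theta>)) e"
    have c': "fst c * fst e + (\<gamma> t)\<^sup>2 * (snd c * snd e) =
        \<gamma> t * D\<gamma> 1 t * (fst u * (snd w * snd e) + fst w * (snd u * snd e) - fst e * (snd u * snd w))" for e
      using spec[OF c, of e, unfolded d, unfolded metric_def fst_conv snd_conv] by (simp only: algebra_simps)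
    \<comment> \<open>The metric is nondegenerate, so testing with the two coordinate vectors
      determines \<open>c\<close>.\<close>
    have "fst c = fst ?c"
      using c'[of "(1, 0)"] by (simp only: fst_conv snd_conv mult_zero_right) simp
    moreover have "(\<gamma> t)\<^sup>2 * snd c = (\<gamma> t)\<^sup>2 * snd ?c"
      using c'[of "(0, 1)"] g by (simp only: fst_conv snd_conv) (simp add: field_simps power2_eq_square)
    then have "snd c = snd ?c" using g by (simp only: mult_cancel_left) simp
    ultimately show "c = ?c" by (rule prod_eqI)
  qed
qed

definition mfield :: "real \<Rightarrow> coords \<Rightarrow> coords" where
  "mfield m = (\<lambda>(t, \<phi>, \<theta>). (m * cos \<phi>, 1 - m * D\<gamma> 1 t / \<gamma> t * sin \<phi>, m * sin \<phi> / \<gamma> t))"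

lemma frechet_derivative_unit_vec:
  assumes "0 < t" "t < l"
  shows "frechet_derivative (unit_vec \<gamma>) (at (t, \<phi>, \<theta>)) (a, b, d) =
    (- sin \<phi> * b, cos \<phi> * b / \<gamma> t - sin \<phi> * D\<gamma> 1 t * a / (\<gamma> t)\<^sup>2)"
proof -
  have g: "\<gamma> t \<noteq> 0" using \<gamma>_pos[OF assms] by simp
  have u: "unit_vec \<gamma> = (\<lambda>x. (cos (fst (snd x)), sin (fst (snd x)) / \<gamma> (fst x)))"
    by (auto simp: unit_vec_def)
  have "(unit_vec \<gamma> has_derivative (\<lambda>v. (- sin \<phi> * fst (snd v),
      cos \<phi> * fst (snd v) / \<gamma> t - sin \<phi> * D\<gamma> 1 t * fst v / (\<gamma> t)\<^sup>2))) (at (t, \<phi>, \<theta>))"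
    unfolding u
    by (rule derivative_eq_intros has_derivative_\<gamma>_fst refl | 
        simp add: assms g fun_eq_iff)+ (simp add: field_simps power2_eq_square g)
  from frechet_derivative_at[OF this, symmetric] show ?thesis by simp
qed

lemma geodesic_field_eq:
  assumes "0 < t" "t < l"
  shows "geodesic_field \<gamma> (t, \<phi>, \<theta>) = (cos \<phi>, - D\<gamma> 1 t / \<gamma> t * sin \<phi>, sin \<phi> / \<gamma> t)" (is "_ = ?x")
proof -
  have g: "\<gamma> t \<noteq> 0" using \<gamma>_pos[OF assms] by simp
  note simps = frechet_derivative_unit_vec[OF assms] christoffel_eq[OF assms] base_pt_def
  show ?thesis
    unfolding geodesic_field_def
  proof (rule the_equality)
    show "base_pt ?x = unit_vec \<gamma> (t, \<phi>, \<theta>) \<and>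
      frechet_derivative (unit_vec \<gamma>) (at (t, \<phi>, \<theta>)) ?x +
       christoffel \<gamma> (base_pt (t, \<phi>, \<theta>)) (unit_vec \<gamma> (t, \<phi>, \<theta>)) (unit_vec \<gamma> (t, \<phi>, \<theta>)) = 0"
      using g by (simp add: simps unit_vec_polar zero_prod_def) (simp add: field_simps power2_eq_square)
    fix \<xi> assume \<xi>: "base_pt \<xi> = unit_vec \<gamma> (t, \<phi>, \<theta>) \<and>
      frechet_derivative (unit_vec \<gamma>) (at (t, \<phi>, \<theta>)) \<xi> +
       christoffel \<gamma> (base_pt (t, \<phi>, \<theta>)) (unit_vec \<gamma> (t, \<phi>, \<theta>)) (unit_vec \<gamma> (t, \<phi>, \<theta>)) = 0"
    obtain a b d where abd: "\<xi> = (a, b, d)" by (cases \<xi>) auto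
    have ad: "a = cos \<phi>" "d = sin \<phi> / \<gamma> t" using \<xi> abd by (auto simp: base_pt_def unit_vec_polar)
    \<comment> \<open>The two components of the parallelism condition determine the
      \<open>\<phi>\<close>-component only after multiplication by the sine and the cosine of
      \<open>\<phi>\<close>, which do not vanish together.\<close>
    have "sin \<phi> * (b + D\<gamma> 1 t / \<gamma> t * sin \<phi>) = 0" "cos \<phi> * (b + D\<gamma> 1 t / \<gamma> t * sin \<phi>) = 0"
      using \<xi> g unfolding abd ad
      by (simp_all add: simps unit_vec_polar zero_prod_def field_simps power2_eq_square)
    moreover have "sin \<phi> \<noteq> 0 \<or> cos \<phi> \<noteq> 0" using sin_zero_abs_cos_one[of \<phi>] by auto
    ultimately have "b + D\<gamma> 1 t / \<gamma> t * sin \<phi> = 0" by fastforce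
    then show "\<xi> = ?x" using abd ad by simp
  qed
qed

lemma magnetic_field_polar_eq:
  assumes "x \<in> polar_interior l"
  shows "magnetic_field_polar \<gamma> m x = mfield m x"
  using assms by (cases x) (auto simp: polar_interior_def magnetic_field_polar_def geodesic_field_eq mfield_def)

lemma mfield_cong:
  assumes "fst x = fst y" "cis (fst (snd x)) = cis (fst (snd y))"
  shows "mfield m x = mfield m y"
proof -
  have "cos (fst (snd x)) = cos (fst (snd y))" "sin (fst (snd x)) = sin (fst (snd y))"
    using assms(2) by (auto simp: complex_eq_iff)
  then show ?thesis using assms(1) by (cases x; cases y) (auto simp: mfield_def)
qed

text \<open>Interior preimages of a chart point differ by full turns, which affect neither
  \<open>mfield\<close> nor the differential of \<open>polar\<close>; hence the description in
  \<open>magnetic_field\<close> determines one vector.\<close>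

lemma magnetic_field_eq:
  assumes "x \<in> polar_interior l"
  shows "magnetic_field \<gamma> l m c (polar l c x) = polar_D l c x (mfield m x)"
proof -
  have "(THE \<eta>. \<exists>y\<in>polar_interior l. polar l c y = polar l c x \<and>
      \<eta> = frechet_derivative (polar l c) (at y) (magnetic_field_polar \<gamma> m y)) = polar_D l c x (mfield m x)"
  proof (rule the_equality)
    show "\<exists>y\<in>polar_interior l. polar l c y = polar l c x \<and>
      polar_D l c x (mfield m x) = frechet_derivative (polar l c) (at y) (magnetic_field_polar \<gamma> m y)"
      using assms by (intro bexI[of _ x]) (auto simp: frechet_derivative_polar magnetic_field_polar_eq)
    fix \<eta> assume "\<exists>y\<in>polar_interior l. polar l c y = polar l c x \<and>
      \<eta> = frechet_derivative (polar l c) (at y) (magnetic_field_polar \<gamma> m y)"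
    then obtain y where y: "y \<in> polar_interior l" "polar l c y = polar l c x" 
        "\<eta> = polar_D l c y (mfield m y)"
      by (auto simp: frechet_derivative_polar magnetic_field_polar_eq)
    show "\<eta> = polar_D l c x (mfield m x)"
      using polar_inj_interior[OF y(1) assms y(2)] mfield_cong[of y x m] polar_D_cong[of y x l c] y(3) by simp
  qed
  then show ?thesis using polar_nonzero[OF assms] by (simp add: magnetic_field_def)
qed

end

section \<open>Existence of a primitive\<close>

definition parity_extension :: "real \<Rightarrow> (nat \<Rightarrow> real \<Rightarrow> real) \<Rightarrow> nat \<Rightarrow> real \<Rightarrow> real" where
  "parity_extension e D k t = (if 0 \<le> t then D k t else e * (-1) ^ k * D k (-t))"

text \<open>The only possible obstruction is a jump at 0. Reflection multiplies entry
  \<open>k\<close> by \<open>e * (-1) ^ k\<close>, since differentiation switches parity. Where this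
  sign is -1 the entry has to vanish at 0, and then the one-sided derivatives at 0 agree.\<close>

lemma smooth_jet_parity_extension:
  assumes D: "\<And>k t. t \<in> {0..l} \<Longrightarrow> (D k has_real_derivative D (Suc k) t) (at t within {0..l})"
    and e: "e = 1 \<or> e = -1" and D0: "\<And>k. e * (-1) ^ k = -1 \<Longrightarrow> D k 0 = 0" and l: "0 < l"
  shows "smooth_jet l (parity_extension e D)"
  unfolding smooth_jet_def
proof (intro allI impI)
  fix k and t :: real assume t: "\<bar>t\<bar> < l"
  let ?E = "parity_extension e D"
  have sign: "e * (-1) ^ k = 1 \<or> e * (-1) ^ k = -1" for k using e by (cases "even k") auto
  have R: "(?E k has_real_derivative ?E (Suc k) t) (at t within {0..<l})" if "t \<in> {0..<l}" for t
  proof -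
    have "(D k has_real_derivative D (Suc k) t) (at t within {0..<l})"
      by (rule DERIV_subset[OF D]) (use that in auto)
    then have "(?E k has_real_derivative D (Suc k) t) (at t within {0..<l})"
      by (rule has_field_derivative_transform_within[OF _ zero_less_one that]) (auto simp: parity_extension_def)
    then show ?thesis using that by (simp add: parity_extension_def)
  qed
  have L: "(?E k has_real_derivative ?E (Suc k) t) (at t within {-l<..0})" if "t \<in> {-l<..0}" for t
  proof -
    have E: "?E j s = e * (-1) ^ j * D j (-s)" if "s \<in> {-l<..0}" for s j
      using that sign[of j] D0[of j] by (cases "s = 0") (auto simp: parity_extension_def)
    have "(D k \<circ> uminus has_real_derivative D (Suc k) (-t) * -1) (at t within {-l<..0})"
    proof (rule DERIV_image_chain)
      show "(D k has_real_derivative D (Suc k) (-t)) (at (-t) within uminus ` {-l<..0})"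
        by (rule DERIV_subset[OF D]) (use that in auto)
    qed (auto intro!: derivative_eq_intros)
    from DERIV_cmult[OF this, of "e * (-1) ^ k"]
    have "((\<lambda>s. e * (-1) ^ k * D k (-s)) has_real_derivative e * (-1) ^ k * (D (Suc k) (-t) * -1)) (at t within {-l<..0})"
      unfolding o_def .
    then have "(?E k has_real_derivative e * (-1) ^ k * (D (Suc k) (-t) * -1)) (at t within {-l<..0})"
      by (rule has_field_derivative_transform_within[OF _ zero_less_one that]) (simp add: E)
    then show ?thesis using E[OF that, of "Suc k"] by simp
  qed
  consider "t > 0" | "t < 0" | "t = 0" by linarith
  then show "(?E k has_real_derivative ?E (Suc k) t) (at t)"
  proof cases
    case 1
    have "(?E k has_real_derivative ?E (Suc k) t) (at t within {0<..<l})"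
      by (rule DERIV_subset[OF R]) (use 1 t in auto)
    then show ?thesis using 1 t by (simp add: at_within_open[of t "{0<..<l}"])
  next
    case 2
    have "(?E k has_real_derivative ?E (Suc k) t) (at t within {-l<..<0})"
      by (rule DERIV_subset[OF L]) (use 2 t in auto)
    then show ?thesis using 2 t by (simp add: at_within_open[of t "{-l<..<0}"])
  next
    case 3
    have "(?E k has_real_derivative ?E (Suc k) 0) (at 0 within ({0..<l} \<union> {-l<..0}))"
      using R[of 0] L[of 0] l unfolding has_field_derivative_iff
      by (simp add: at_within_union filterlim_sup)
    moreover have "{0..<l} \<union> {-l<..0} = {-l<..<l}" using l by auto
    ultimately show ?thesis using 3 l by (simp add: at_within_open[of 0 "{-l<..<l}"])
  qed
qed

lemma parity_extension_uminus:
  assumes "e = 1 \<or> e = -1" "e = -1 \<Longrightarrow> D 0 0 = 0"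
  shows "parity_extension e D 0 (-t) = e * parity_extension e D 0 t"
  using assms by (cases "t = 0") (auto simp: parity_extension_def)

lemma jet_quotient_0: "jet_quotient D 0 0 = D 1 0"
  by (simp add: jet_quotient_def)

text \<open>An even function with a zero at 0 is divisible by \<open>t\<close> twice: the first
  quotient is odd and so vanishes at 0 in its turn.\<close>

lemma even_jet_quotient2:
  assumes P: "smooth_jet l P" "\<And>t. \<bar>t\<bar> < l \<Longrightarrow> P 0 (-t) = P 0 t" "P 0 0 = 0" and l: "0 < l"
  obtains K where "smooth_jet l K" "\<And>t. \<bar>t\<bar> < l \<Longrightarrow> K 0 (-t) = K 0 t" "\<And>t. \<bar>t\<bar> < l \<Longrightarrow> P 0 t = K 0 t * t\<^sup>2"
proof
  let ?Q = "jet_quotient P" and ?K = "jet_quotient (jet_quotient P)"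
  have Q: "smooth_jet l ?Q" "\<And>t. \<bar>t\<bar> < l \<Longrightarrow> ?Q 0 (-t) = - 1 * ?Q 0 t"
    using smooth_jet_quotient[OF P(1)] jet_quotient_parity[OF P(1), of 1] P(2) by auto
  then have Q0: "?Q 0 0 = 0" using Q(2)[of 0] l by simp
  show "smooth_jet l ?K" by (rule smooth_jet_quotient[OF Q(1)])
  show "?K 0 (-t) = ?K 0 t" if "\<bar>t\<bar> < l" for t
    using jet_quotient_parity[OF Q that] by simp
  show "P 0 t = ?K 0 t * t\<^sup>2" if "\<bar>t\<bar> < l" for t
    using jet_quotient_mult[OF P(1,3) that] jet_quotient_mult[OF Q(1) Q0 that]
    by (simp add: power2_eq_square mult_ac)
qed

text \<open>The quotient \<open>D 0 t / t\<close> is even with value \<open>D 1 0 = 1\<close> at 0;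
  subtracting 1 brings it under \<open>even_jet_quotient2\<close>.\<close>

lemma odd_jet_quotient3:
  assumes O: "smooth_jet l D" "\<And>t. \<bar>t\<bar> < l \<Longrightarrow> D 0 (-t) = - D 0 t" "D 1 0 = 1" and l: "0 < l"
  obtains H where "smooth_jet l H" "\<And>t. \<bar>t\<bar> < l \<Longrightarrow> H 0 (-t) = H 0 t" "\<And>t. \<bar>t\<bar> < l \<Longrightarrow> D 0 t = t + H 0 t * t ^ 3"
proof -
  let ?A = "jet_quotient D"
  define P where "P k t = (if k = 0 then ?A k t - 1 else ?A k t)" for k :: nat and t
  have A: "smooth_jet l ?A" by (rule smooth_jet_quotient[OF O(1)])
  have P1: "smooth_jet l P"
    unfolding smooth_jet_def
  proof (intro allI impI)
    fix k and t :: real assume "\<bar>t\<bar> < l"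
    then have "((\<lambda>t. ?A k t - c) has_real_derivative ?A (Suc k) t - 0) (at t)" for c
      using A by (intro DERIV_diff DERIV_const) (auto simp: smooth_jet_def)
    from this[of 1] this[of 0] show "(P k has_real_derivative P (Suc k) t) (at t)"
      by (cases k) (simp_all add: P_def[abs_def])
  qed
  have D0: "D 0 0 = 0" using O(2)[of 0] l by simp
  have P2: "P 0 (-t) = P 0 t" if "\<bar>t\<bar> < l" for t
    using jet_quotient_parity[OF O(1), of "-1" t] O(2) that by (simp add: P_def)
  have P3: "P 0 0 = 0" using O(3) by (simp add: P_def jet_quotient_0)
  from even_jet_quotient2[OF P1 P2 P3 l] obtain H where H: "smooth_jet l H"
    "\<And>t. \<bar>t\<bar> < l \<Longrightarrow> H 0 (-t) = H 0 t" "\<And>t. \<bar>t\<bar> < l \<Longrightarrow> P 0 t = H 0 t * t\<^sup>2" by metis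
  show ?thesis
  proof (rule that[OF H(1,2)])
    fix t assume t: "\<bar>t\<bar> < l"
    have "D 0 t = t * (1 + H 0 t * t\<^sup>2)"
      using jet_quotient_mult[OF O(1) D0 t] H(3)[OF t] by (simp add: P_def algebra_simps)
    then show "D 0 t = t + H 0 t * t ^ 3" by (simp add: algebra_simps power2_eq_square power3_eq_cube)
  qed
qed

text \<open>Stated for an abstract jet in order to serve both poles. The derivatives of
  \<open>p\<close> are those of \<open>D\<close> moved by one place, so the vanishing even
  derivatives of \<open>D\<close> are vanishing odd derivatives of \<open>p\<close>:
  \<open>D 0\<close> extends oddly and \<open>p\<close> evenly.\<close>

lemma profile_jet_expansions:
  fixes p :: "real \<Rightarrow> real"
  assumes D: "\<And>k t. t \<in> {0..l} \<Longrightarrow> (D k has_real_derivative D (Suc k) t) (at t within {0..l})"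
    and even: "\<And>k. even k \<Longrightarrow> D k 0 = 0" and "D 1 0 = 1"
    and p: "\<And>t. t \<in> {0..l} \<Longrightarrow> (p has_real_derivative D 0 t) (at t within {0..l})" "p 0 = 0" and l: "0 < l"
  obtains H K where "smooth_jet l H" "\<And>t. \<bar>t\<bar> < l \<Longrightarrow> H 0 (-t) = H 0 t"
    "smooth_jet l K" "\<And>t. \<bar>t\<bar> < l \<Longrightarrow> K 0 (-t) = K 0 t"
    "\<And>t. 0 \<le> t \<Longrightarrow> t < l \<Longrightarrow> D 0 t = t + H 0 t * t ^ 3" "\<And>t. 0 \<le> t \<Longrightarrow> t < l \<Longrightarrow> p t = K 0 t * t\<^sup>2"
proof -
  have sign: "even k" if "- 1 * (- 1) ^ k = (- 1 :: real)" for k :: nat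
    using that by (cases "even k") auto
  let ?D = "parity_extension (-1) D"
  have D1: "smooth_jet l ?D"
    by (rule smooth_jet_parity_extension[where D = D, OF D _ even[OF sign] l]) auto
  have D2: "?D 0 (-t) = - ?D 0 t" for t
    using parity_extension_uminus[of "-1" D t] even by simp
  from odd_jet_quotient3[OF D1 D2 _ l] obtain H where H: "smooth_jet l H"
    "\<And>t. \<bar>t\<bar> < l \<Longrightarrow> H 0 (-t) = H 0 t" "\<And>t. \<bar>t\<bar> < l \<Longrightarrow> ?D 0 t = t + H 0 t * t ^ 3"
    using \<open>D 1 0 = 1\<close> by (auto simp: parity_extension_def)
  define P where "P k = (case k of 0 \<Rightarrow> p | Suc j \<Rightarrow> D j)" for k
  let ?P = "parity_extension 1 P"
  have P: "(P k has_real_derivative P (Suc k) t) (at t within {0..l})" if "t \<in> {0..l}" for k t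
    using D p that by (cases k) (auto simp: P_def)
  have P0: "P k 0 = 0" if "1 * (- 1) ^ k = (- 1 :: real)" for k
    using that even p(2) by (cases k) (auto simp: P_def minus_one_power_iff split: if_splits)
  have P1: "smooth_jet l ?P"
    by (rule smooth_jet_parity_extension[where D = P, OF P _ P0 l]) auto
  have P2: "?P 0 (-t) = ?P 0 t" for t
    using parity_extension_uminus[of 1 P t] by simp
  have P00: "?P 0 0 = 0" using p(2) by (simp add: parity_extension_def P_def)
  from even_jet_quotient2[OF P1 P2 P00 l] obtain K where K: "smooth_jet l K"
    "\<And>t. \<bar>t\<bar> < l \<Longrightarrow> K 0 (-t) = K 0 t" "\<And>t. \<bar>t\<bar> < l \<Longrightarrow> ?P 0 t = K 0 t * t\<^sup>2"
    by metis
  show ?thesis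
  proof (rule that)
    show "D 0 t = t + H 0 t * t ^ 3" "p t = K 0 t * t\<^sup>2" if "0 \<le> t" "t < l" for t
      using H(3)[of t] K(3)[of t] that by (simp_all add: parity_extension_def P_def)
  qed (fact H(1,2) K(1,2))+
qed

section \<open>The primitive near a pole\<close>

text \<open>The form \<open>m \<alpha> \<plusminus> (d\<psi> - (1 \<plusminus> \<Gamma>) d\<theta>)\<close> around a pole, where \<open>\<gamma> = r + h r\<^sup>3\<close> and \<open>1 \<plusminus> \<Gamma> = k r\<^sup>2\<close> in terms of
  the distance \<open>r = \<bar>z\<bar>\<close> to the pole; it is spelled out with sums and products only, for the closure
  rules of \<open>Ck_on\<close>.\<close>

definition chart_primitive :: "real \<Rightarrow> real \<Rightarrow> (real \<Rightarrow> real) \<Rightarrow> (real \<Rightarrow> real) \<Rightarrow> complex \<times> real \<Rightarrow> complex \<times> real \<Rightarrow> real" where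
  "chart_primitive m e h k w v =
     m * (cos (snd w) * Re (fst v) + sin (snd w) * Im (fst v) +
       h (norm (fst w)) * (sin (snd w) * Re (fst w) + (-1) * (cos (snd w) * Im (fst w))) *
         (Re (fst w) * Im (fst v) + (-1) * (Im (fst w) * Re (fst v)))) +
     e * (snd v + (-1) * (k (norm (fst w)) * (Re (fst w) * Im (fst v) + (-1) * (Im (fst w) * Re (fst v)))))"

lemma smooth_chart_primitive:
  assumes "smooth_jet l H" "\<And>t. \<bar>t\<bar> < l \<Longrightarrow> H 0 (-t) = H 0 t"
    "smooth_jet l K" "\<And>t. \<bar>t\<bar> < l \<Longrightarrow> K 0 (-t) = K 0 t"
  shows "smooth_on (chart_dom l) (\<lambda>w. chart_primitive m e (H 0) (K 0) w v)"
  unfolding smooth_on_def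
proof
  fix j
  note o = open_chart_dom[of l]
  have re: "Ck_on (chart_dom l) j (\<lambda>w. Re (fst w))"
    by (rule Ck_on_linear[OF o bounded_linear_compose[OF bounded_linear_Re bounded_linear_fst]])
  have im: "Ck_on (chart_dom l) j (\<lambda>w. Im (fst w))"
    by (rule Ck_on_linear[OF o bounded_linear_compose[OF bounded_linear_Im bounded_linear_fst]])
  note sc = Ck_on_sin_cos[OF o bounded_linear_snd, where k = j]
  show "Ck_on (chart_dom l) j (\<lambda>w. chart_primitive m e (H 0) (K 0) w v)"
    unfolding chart_primitive_def
    by (rule re im conjunct1[OF sc] conjunct2[OF sc] Ck_on_radial[OF assms(1,2)] Ck_on_radial[OF assms(3,4)]
        Ck_on_const[OF o] Ck_on_add[OF o] Ck_on_mult[OF o] | assumption)+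
qed

lemma linear_chart_primitive: "linear (chart_primitive m e h k w)"
  by (rule linearI) (simp_all add: chart_primitive_def algebra_simps)

lemma chart_primitive_polar:
  fixes r \<psi> \<phi> \<theta> a d b :: real
  assumes "\<psi> = \<phi> + \<theta>" "0 \<le> r"
  shows "chart_primitive m e h k (of_real r * cis \<theta>, \<psi>) (of_real a * cis \<theta> + of_real (r * d) * (\<i> * cis \<theta>), b) =
    m * (a * cos \<phi> + (r + h r * r ^ 3) * sin \<phi> * d) + e * (b - k r * r\<^sup>2 * d)"
proof -
  have p: "sin \<theta> * sin \<theta> + cos \<theta> * cos \<theta> = 1" using sin_cos_squared_add[of \<theta>] by (simp add: power2_eq_square)
  \<comment> \<open>The identities \<open>1\<close>, \<open>2\<close> and \<open>3\<close> compute
    the inner product of \<open>cis \<psi>\<close> with the velocity of \<open>z\<close>, the cross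
    product of \<open>z\<close> with \<open>cis \<psi>\<close>, and the cross product of
    \<open>z\<close> with its velocity. Rotating the plane by \<open>-\<theta>\<close> makes
    \<open>z\<close> real and turns \<open>\<psi>\<close> into \<open>\<phi>\<close>.\<close>
  have "cos \<psi> * (a * cos \<theta> - r * d * sin \<theta>) + sin \<psi> * (a * sin \<theta> + r * d * cos \<theta>) =
     (a * cos \<phi> + r * d * sin \<phi>) * (sin \<theta> * sin \<theta> + cos \<theta> * cos \<theta>)"
    unfolding assms(1) cos_add sin_add by (simp only: algebra_simps)
  then have 1: "cos \<psi> * (a * cos \<theta> - r * d * sin \<theta>) + sin \<psi> * (a * sin \<theta> + r * d * cos \<theta>) =
     a * cos \<phi> + r * d * sin \<phi>" using p by simp
  have "sin \<psi> * (r * cos \<theta>) - cos \<psi> * (r * sin \<theta>) = r * sin \<phi> * (sin \<theta> * sin \<theta> + cos \<theta> * cos \<theta>)"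
    unfolding assms(1) cos_add sin_add by (simp only: algebra_simps)
  then have 2: "sin \<psi> * (r * cos \<theta>) - cos \<psi> * (r * sin \<theta>) = r * sin \<phi>" using p by simp
  have "r * cos \<theta> * (a * sin \<theta> + r * d * cos \<theta>) - r * sin \<theta> * (a * cos \<theta> - r * d * sin \<theta>) =
     r\<^sup>2 * d * (sin \<theta> * sin \<theta> + cos \<theta> * cos \<theta>)"
    by (simp only: algebra_simps power2_eq_square)
  then have 3: "r * cos \<theta> * (a * sin \<theta> + r * d * cos \<theta>) - r * sin \<theta> * (a * cos \<theta> - r * d * sin \<theta>) = r\<^sup>2 * d"
    using p by simp
  have "chart_primitive m e h k (of_real r * cis \<theta>, \<psi>) (of_real a * cis \<theta> + of_real (r * d) * (\<i> * cis \<theta>), b) =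
    m * ((cos \<psi> * (a * cos \<theta> - r * d * sin \<theta>) + sin \<psi> * (a * sin \<theta> + r * d * cos \<theta>)) +
      h r * (sin \<psi> * (r * cos \<theta>) - cos \<psi> * (r * sin \<theta>)) *
      (r * cos \<theta> * (a * sin \<theta> + r * d * cos \<theta>) - r * sin \<theta> * (a * cos \<theta> - r * d * sin \<theta>))) +
    e * (b - k r * (r * cos \<theta> * (a * sin \<theta> + r * d * cos \<theta>) - r * sin \<theta> * (a * cos \<theta> - r * d * sin \<theta>)))"
    using assms(2) by (simp add: chart_primitive_def norm_mult)
  also have "\<dots> = m * (a * cos \<phi> + (r + h r * r ^ 3) * sin \<phi> * d) + e * (b - k r * r\<^sup>2 * d)"
    unfolding 1 2 3 by (simp add: algebra_simps power2_eq_square power3_eq_cube)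
  finally show ?thesis .
qed

lemma frechet_derivative_eq_on_open:
  assumes "open S" "x \<in> S" "\<And>y. y \<in> S \<Longrightarrow> f y = g y" "(g has_derivative g') (at x)"
  shows "frechet_derivative f (at x) = g'"
  using has_derivative_transform_within_open[OF assms(4,1,2), of f] assms(3) frechet_derivative_at by metis

section \<open>The primitive in polar coordinates and its extension over both poles\<close>

context profile
begin

text \<open>This is the classical primitive \<open>m \<alpha> - \<beta> + \<psi>\<close>, with
  connection form \<open>\<psi> = d\<phi> + \<gamma>' d\<theta>\<close> and
  \<open>\<beta> = (\<Gamma> + \<gamma>') d\<theta>\<close>: the terms
  \<open>\<gamma>' d\<theta>\<close> cancel.\<close>

definition polar_primitive :: "real \<Rightarrow> coords \<Rightarrow> coords \<Rightarrow> real" where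
  "polar_primitive m x \<xi> = m * (cos (fst (snd x)) * fst \<xi> + \<gamma> (fst x) * sin (fst (snd x)) * snd (snd \<xi>))
     + fst (snd \<xi>) - Gamma_prim \<gamma> (fst x) * snd (snd \<xi>)"

text \<open>The derivative along \<open>\<xi>\<close> of the coefficients of \<open>alpha\<close>,
  paired with \<open>\<eta>\<close>; antisymmetrising gives \<open>d\<alpha>\<close>.\<close>

definition flat_alpha_deriv :: "coords \<Rightarrow> coords \<Rightarrow> coords \<Rightarrow> real" where
  "flat_alpha_deriv x \<xi> \<eta> = - sin (fst (snd x)) * fst (snd \<xi>) * fst \<eta>
     + (D\<gamma> 1 (fst x) * fst \<xi> * sin (fst (snd x)) + \<gamma> (fst x) * cos (fst (snd x)) * fst (snd \<xi>)) * snd (snd \<eta>)"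

lemma interiorD: "x \<in> polar_interior l \<Longrightarrow> 0 < fst x \<and> fst x < l"
  by (auto simp: polar_interior_def)

lemma alpha_eq:
  assumes "x \<in> polar_interior l"
  shows "alpha \<gamma> x \<xi> = cos (fst (snd x)) * fst \<xi> + \<gamma> (fst x) * sin (fst (snd x)) * snd (snd \<xi>)"
  using interiorD[OF assms] \<gamma>_pos[of "fst x"]
  by (cases x) (simp add: alpha_def metric_def base_pt_def unit_vec_polar power2_eq_square)

lemma has_derivative_alpha_polar:
  assumes "x \<in> polar_interior l"
  shows "((\<lambda>x. cos (fst (snd x)) * fst \<eta> + \<gamma> (fst x) * sin (fst (snd x)) * snd (snd \<eta>))
    has_derivative (\<lambda>\<xi>. flat_alpha_deriv x \<xi> \<eta>)) (at x)"
  using interiorD[OF assms] unfolding flat_alpha_deriv_def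
  by (auto intro!: derivative_eq_intros has_derivative_\<gamma>_fst simp: fun_eq_iff algebra_simps)

lemma omega_eq:
  assumes "x \<in> polar_interior l"
  shows "omega \<gamma> m x \<xi> \<eta> = m * (flat_alpha_deriv x \<xi> \<eta> - flat_alpha_deriv x \<eta> \<xi>)
    - \<gamma> (fst x) * (fst \<xi> * snd (snd \<eta>) - snd (snd \<xi>) * fst \<eta>)"
proof -
  have "frechet_derivative (\<lambda>y. alpha \<gamma> y \<eta>) (at x) = (\<lambda>\<xi>. flat_alpha_deriv x \<xi> \<eta>)" for \<eta>
    by (rule frechet_derivative_eq_on_open[OF open_polar_interior assms alpha_eq has_derivative_alpha_polar[OF assms]])
  then show ?thesis by (simp add: omega_def ext_deriv_def area_form_def base_pt_def)
qed

lemma has_derivative_polar_primitive: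
  assumes "x \<in> polar_interior l"
  shows "((\<lambda>x. polar_primitive m x \<eta>) has_derivative
    (\<lambda>\<xi>. m * flat_alpha_deriv x \<xi> \<eta> - \<gamma> (fst x) * fst \<xi> * snd (snd \<eta>))) (at x)"
proof -
  have "((\<lambda>y. Gamma_prim \<gamma> (fst y)) has_derivative (\<lambda>v. \<gamma> (fst x) * fst v)) (at x)"
    by (rule has_derivative_compose[OF has_derivative_fst[OF has_derivative_ident]])
       (use Gamma_deriv_at interiorD[OF assms] in \<open>simp add: has_field_derivative_def\<close>)
  from has_derivative_mult_left[OF this, of "snd (snd \<eta>)"]
  have G: "((\<lambda>y. Gamma_prim \<gamma> (fst y) * snd (snd \<eta>)) has_derivative (\<lambda>v. \<gamma> (fst x) * fst v * snd (snd \<eta>))) (at x)" .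
  have "((\<lambda>x. polar_primitive m x \<eta>) has_derivative
    (\<lambda>\<xi>. m * flat_alpha_deriv x \<xi> \<eta> + 0 - \<gamma> (fst x) * fst \<xi> * snd (snd \<eta>))) (at x)"
    unfolding polar_primitive_def
    by (intro has_derivative_diff has_derivative_add has_derivative_mult_right has_derivative_const
        has_derivative_alpha_polar[OF assms] G)
  then show ?thesis by simp
qed

lemma primitive_exists: "\<exists>\<tau>. primitive_of_omega \<gamma> l m \<tau>"
proof -
  obtain H0 K0 where 0: "smooth_jet l H0" "\<And>t. \<bar>t\<bar> < l \<Longrightarrow> H0 0 (-t) = H0 0 t"
    "smooth_jet l K0" "\<And>t. \<bar>t\<bar> < l \<Longrightarrow> K0 0 (-t) = K0 0 t"
    "\<And>t. 0 \<le> t \<Longrightarrow> t < l \<Longrightarrow> \<gamma> t = t + H0 0 t * t ^ 3"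
    "\<And>t. 0 \<le> t \<Longrightarrow> t < l \<Longrightarrow> 1 + Gamma_prim \<gamma> t = K0 0 t * t\<^sup>2"
  proof (rule profile_jet_expansions[of l D\<gamma> "\<lambda>t. 1 + Gamma_prim \<gamma> t"])
    show "((\<lambda>t. 1 + Gamma_prim \<gamma> t) has_real_derivative D\<gamma> 0 t) (at t within {0..l})" if "t \<in> {0..l}" for t
      using DERIV_add[OF DERIV_const Gamma_deriv[OF that], of 1] by simp
  qed (use D\<gamma>_deriv D\<gamma>_even D\<gamma>_1_0 Gamma_0 l_pos in auto)
  obtain H1 K1 where 1: "smooth_jet l H1" "\<And>t. \<bar>t\<bar> < l \<Longrightarrow> H1 0 (-t) = H1 0 t"
    "smooth_jet l K1" "\<And>t. \<bar>t\<bar> < l \<Longrightarrow> K1 0 (-t) = K1 0 t"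
    "\<And>t. 0 \<le> t \<Longrightarrow> t < l \<Longrightarrow> \<gamma> (l - t) = t + H1 0 t * t ^ 3"
    "\<And>t. 0 \<le> t \<Longrightarrow> t < l \<Longrightarrow> 1 - Gamma_prim \<gamma> (l - t) = K1 0 t * t\<^sup>2"
  \<comment> \<open>At the second pole the variable is the distance to \<open>l\<close>. The
    reflection alternates the signs of the derivatives, so that the slope -1 at \<open>l\<close>
    becomes 1; the primitive that vanishes there is \<open>1 - \<Gamma>\<close>, as
    \<open>\<Gamma> l = 1\<close>.\<close>
  proof (rule profile_jet_expansions[of l "\<lambda>k t. (-1) ^ k * D\<gamma> k (l - t)" "\<lambda>t. 1 - Gamma_prim \<gamma> (l - t)"])
    have refl: "((\<lambda>t. f (l - t)) has_real_derivative - f' (l - t)) (at t within {0..l})"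
      if "t \<in> {0..l}" "\<And>t. t \<in> {0..l} \<Longrightarrow> (f has_real_derivative f' t) (at t within {0..l})" for f f' t
    proof -
      have "(f \<circ> (\<lambda>t. l - t) has_real_derivative f' (l - t) * -1) (at t within {0..l})"
      proof (rule DERIV_image_chain)
        show "(f has_real_derivative f' (l - t)) (at (l - t) within (\<lambda>t. l - t) ` {0..l})"
          by (rule DERIV_subset[OF that(2)]) (use that in auto)
      qed (auto intro!: derivative_eq_intros)
      then show ?thesis by (simp add: o_def)
    qed
    show "((\<lambda>t. (-1) ^ k * D\<gamma> k (l - t)) has_real_derivative (-1) ^ Suc k * D\<gamma> (Suc k) (l - t)) (at t within {0..l})"
      if "t \<in> {0..l}" for k t
      using DERIV_cmult[OF refl[OF that D\<gamma>_deriv], of "(-1) ^ k" k] by simp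
    show "((\<lambda>t. 1 - Gamma_prim \<gamma> (l - t)) has_real_derivative (-1) ^ 0 * D\<gamma> 0 (l - t)) (at t within {0..l})"
      if "t \<in> {0..l}" for t
      using DERIV_diff[OF DERIV_const refl[OF that Gamma_deriv], of 1] by simp
  qed (use D\<gamma>_even D\<gamma>_1_l Gamma_l l_pos in auto)
  \<comment> \<open>The sign in the second chart comes from its direction angle
    \<open>\<psi> = \<pi> - \<phi> + \<theta>\<close>: there
    \<open>- (d\<psi> - (1 - \<Gamma>) d\<theta>)\<close> is
    \<open>d\<phi> - \<Gamma> d\<theta>\<close>, and so is
    \<open>d\<psi> - (1 + \<Gamma>) d\<theta>\<close> in the first chart, where
    \<open>\<psi> = \<phi> + \<theta>\<close>.\<close>
  define \<tau> where "\<tau> c = (case c of Pole0 \<Rightarrow> chart_primitive m 1 (H0 0) (K0 0) | Pole1 \<Rightarrow> chart_primitive m (-1) (H1 0) (K1 0))" for c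
  have pull: "pullback (polar l c) (\<tau> c) x = polar_primitive m x" if "x \<in> polar_interior l" for c x
  proof
    fix \<xi> :: coords
    obtain t \<phi> \<theta> a b d where x: "x = (t, \<phi>, \<theta>)" and \<xi>: "\<xi> = (a, b, d)" by (cases x, cases \<xi>) auto
    have t: "0 < t" "t < l" using interiorD[OF that] x by auto
    show "pullback (polar l c) (\<tau> c) x \<xi> = polar_primitive m x \<xi>"
    proof (cases c)
      case Pole0
      have "pullback (polar l c) (\<tau> c) x \<xi> = m * (a * cos \<phi> + (t + H0 0 t * t ^ 3) * sin \<phi> * d) + 1 * (b + d - K0 0 t * t\<^sup>2 * d)"
        unfolding pullback_def frechet_derivative_polar x \<xi> Pole0 polar.simps polar_D.simps \<tau>_def pole.case
        by (rule chart_primitive_polar) (use t in auto)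
      also have "\<dots> = m * (a * cos \<phi> + \<gamma> t * sin \<phi> * d) + 1 * (b + d - (1 + Gamma_prim \<gamma> t) * d)"
        using 0(5,6)[of t] t by simp
      finally show ?thesis by (simp add: polar_primitive_def x \<xi> algebra_simps)
    next
      case Pole1
      have "pullback (polar l c) (\<tau> c) x \<xi> = m * ((- a) * cos (pi - \<phi>) + ((l - t) + H1 0 (l - t) * (l - t) ^ 3) * sin (pi - \<phi>) * d)
          + (-1) * (d - b - K1 0 (l - t) * (l - t)\<^sup>2 * d)"
        unfolding pullback_def frechet_derivative_polar x \<xi> Pole1 polar.simps polar_D.simps \<tau>_def pole.case of_real_minus[symmetric]
        by (rule chart_primitive_polar) (use t in auto)
      also have "\<dots> = m * (a * cos \<phi> + \<gamma> t * sin \<phi> * d) + (-1) * (d - b - (1 - Gamma_prim \<gamma> t) * d)"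
        using 1(5,6)[of "l - t"] t by simp
      finally show ?thesis by (simp add: polar_primitive_def x \<xi> algebra_simps)
    qed
  qed
  have "smooth_one_form l \<tau>"
    unfolding smooth_one_form_def
  proof (intro conjI allI ballI)
    show "linear (\<tau> c w)" for c w by (cases c) (simp_all add: \<tau>_def linear_chart_primitive)
    show "smooth_on (chart_dom l) (\<lambda>w. \<tau> c w v)" for c v
      using smooth_chart_primitive[OF 0(1-4)] smooth_chart_primitive[OF 1(1-4)] by (cases c) (simp_all add: \<tau>_def)
    show "\<tau> c (z, \<psi> + 2 * pi) = \<tau> c (z, \<psi>)" for c z \<psi>
      by (cases c) (auto simp: \<tau>_def chart_primitive_def fun_eq_iff)
  qed (simp add: pull)
  moreover have "ext_deriv (pullback (polar l Pole0) (\<tau> Pole0)) x \<xi> \<eta> = omega \<gamma> m x \<xi> \<eta>"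
    if x: "x \<in> polar_interior l" for x \<xi> \<eta>
  proof -
    have "frechet_derivative (\<lambda>y. pullback (polar l Pole0) (\<tau> Pole0) y \<eta>) (at x) =
      (\<lambda>\<xi>. m * flat_alpha_deriv x \<xi> \<eta> - \<gamma> (fst x) * fst \<xi> * snd (snd \<eta>))" for \<eta>
      by (rule frechet_derivative_eq_on_open[OF open_polar_interior x _ has_derivative_polar_primitive[OF x]]) (simp add: pull)
    then show ?thesis by (simp add: ext_deriv_def omega_eq[OF x] algebra_simps)
  qed
  ultimately show ?thesis unfolding primitive_of_omega_def by blast
qed

end

section \<open>Circle integrals of a primitive\<close>

lemma continuous_antiderivative:
  fixes f :: "real \<Rightarrow> real"
  assumes "continuous_on UNIV f"
  obtains F where "\<And>x. (F has_real_derivative f x) (at x)"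
proof -
  have "isCont f x" for x using assms by (simp add: continuous_on_eq_continuous_at)
  then show ?thesis
    using einterval_antiderivative[of "-\<infinity>" "\<infinity>" f] that
    by (auto simp: has_real_derivative_iff_has_vector_derivative)
qed

text \<open>An antiderivative on the whole line allows \<open>c\<close> of either sign; negative
  \<open>c\<close> means a circle traversed backwards.\<close>

lemma integral_by_antiderivative:
  fixes F :: "real \<Rightarrow> real"
  assumes "\<And>x. (F has_real_derivative f x) (at x)" "c \<noteq> 0" "a \<le> b"
  shows "((\<lambda>x. f (d + c * x)) has_integral (F (d + c * b) - F (d + c * a)) / c) {a..b}"
proof -
  have "((\<lambda>x. f (d + c * x)) has_integral (F (d + c * b) / c - F (d + c * a) / c)) {a..b}"
  proof (rule fundamental_theorem_of_calculus[OF assms(3)])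
    fix x
    have "((\<lambda>x. F (d + c * x)) has_real_derivative f (d + c * x) * c) (at x)"
      by (rule DERIV_chain2[OF assms(1)]) (auto intro!: derivative_eq_intros)
    from DERIV_cdivide[OF this, of c]
    show "((\<lambda>x. F (d + c * x) / c) has_vector_derivative f (d + c * x)) (at x within {a..b})"
      using assms(2) by (simp add: has_real_derivative_iff_has_vector_derivative has_vector_derivative_at_within)
  qed
  then show ?thesis by (simp add: diff_divide_distrib)
qed

lemma antiderivative_period:
  fixes F :: "real \<Rightarrow> real"
  assumes "\<And>x. (F has_real_derivative f x) (at x)" "\<And>x. f (x + p) = f x"
  shows "F (x + p) - F x = F p - F 0"
proof -
  have "((\<lambda>x. F (x + p) - F x) has_real_derivative f (x + p) * 1 - f x) (at x)" for x
    by (intro DERIV_diff DERIV_chain2[OF assms(1)] assms(1)) (auto intro!: derivative_eq_intros)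
  then have "((\<lambda>x. F (x + p) - F x) has_real_derivative 0) (at x)" for x by (simp add: assms(2))
  then show ?thesis using DERIV_isconst_all[of "\<lambda>x. F (x + p) - F x" x 0] by simp
qed

lemma integral_periodic_shift:
  fixes f :: "real \<Rightarrow> real"
  assumes "continuous_on UNIV f" "\<And>x. f (x + p) = f x" "0 \<le> p"
  shows "integral {0..p} (\<lambda>s. f (a + s)) = integral {0..p} f"
    and "integral {0..p} (\<lambda>s. f (a - s)) = integral {0..p} f"
proof -
  obtain F where F: "\<And>x. (F has_real_derivative f x) (at x)" using continuous_antiderivative[OF assms(1)] by metis
  note i = integral_unique[OF integral_by_antiderivative[OF F _ assms(3)]]
  show "integral {0..p} (\<lambda>s. f (a + s)) = integral {0..p} f"
    using i[of 1 a] i[of 1 0] antiderivative_period[OF F assms(2), of a] by simp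
  show "integral {0..p} (\<lambda>s. f (a - s)) = integral {0..p} f"
    using i[of "-1" a] i[of 1 0] antiderivative_period[OF F assms(2), of "a - p"] by simp
qed

text \<open>The infinitesimal form of Stokes' theorem on an annulus, for the one-form
  \<open>a dt + b ds\<close> with differential \<open>\<omega> dt ds\<close>. Around the circle, the
  \<open>s\<close>-derivative of \<open>a\<close> integrates to zero by periodicity, and only the
  integral of \<open>\<omega>\<close> is left.\<close>

lemma DERIV_circle_integral:
  fixes a b b' \<omega> :: "real \<Rightarrow> real \<Rightarrow> real"
  assumes "0 < p" and t: "t \<in> {\<alpha><..<\<beta>}"
    and b: "\<And>t s. t \<in> {\<alpha><..<\<beta>} \<Longrightarrow> ((\<lambda>t. b t s) has_real_derivative b' t s) (at t)"
    and a: "\<And>t s. t \<in> {\<alpha><..<\<beta>} \<Longrightarrow> (a t has_real_derivative b' t s - \<omega> t s) (at s)"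
    and cb': "continuous_on ({\<alpha><..<\<beta>} \<times> {0..p}) (\<lambda>(t, s). b' t s)"
    and cb: "\<And>t. t \<in> {\<alpha><..<\<beta>} \<Longrightarrow> continuous_on {0..p} (b t)"
    and per: "a t p = a t 0" and \<omega>: "(\<omega> t has_integral W) {0..p}"
  shows "((\<lambda>t. integral {0..p} (b t)) has_real_derivative W) (at t)"
proof -
  have "((\<lambda>s. b' t s - \<omega> t s) has_integral (a t p - a t 0)) {0..p}"
    by (rule fundamental_theorem_of_calculus)
       (use assms(1) a[OF t] in \<open>auto simp: has_real_derivative_iff_has_vector_derivative has_vector_derivative_at_within\<close>)
  from has_integral_add[OF this \<omega>] have "(b' t has_integral W) {0..p}" by (simp add: per)
  then have W: "integral (cbox 0 p) (b' t) = W" by (simp add: integral_unique)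
  have "((\<lambda>t. integral (cbox 0 p) (b t)) has_field_derivative integral (cbox 0 p) (b' t)) (at t within {\<alpha><..<\<beta>})"
  proof (rule leibniz_rule_field_derivative[where fx = b'])
    show "((\<lambda>t. b t s) has_field_derivative b' t s) (at t within {\<alpha><..<\<beta>})" if "t \<in> {\<alpha><..<\<beta>}" for t s
      using b[OF that] by (rule has_field_derivative_at_within)
    show "b t integrable_on cbox 0 p" if "t \<in> {\<alpha><..<\<beta>}" for t
      using cb[OF that] by (intro integrable_continuous) simp
  qed (use cb' t in \<open>simp_all\<close>)
  then show ?thesis using t W by (simp add: at_within_open[of t "{\<alpha><..<\<beta>}"])
qed

lemma periodic_cis:
  assumes "\<And>x. f (x + 2 * pi) = f x" "cis x = cis y"
  shows "f x = f y"
proof -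
  obtain n :: int where n: "x = y + 2 * pi * n"
    using assms(2) sin_cos_eq_iff[of x y] by (auto simp: complex_eq_iff)
  have nat: "f (y + 2 * pi * of_nat k) = f y" for k y
  proof (induction k)
    case (Suc k)
    have "y + 2 * pi * of_nat (Suc k) = (y + 2 * pi * of_nat k) + 2 * pi" by (simp add: algebra_simps)
    then show ?case using Suc assms(1) by metis
  qed simp
  show ?thesis
  proof (cases "n \<ge> 0")
    case True
    then show ?thesis using nat[of y "nat n"] n by simp
  next
    case False
    then show ?thesis using nat[of x "nat (-n)"] n by (simp add: algebra_simps)
  qed
qed

section \<open>An arbitrary primitive, pulled back to polar coordinates\<close>

locale magnetic_primitive = profile +
  fixes \<tau> :: chart_form and m :: real
  assumes primitive: "primitive_of_omega \<gamma> l m \<tau>"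
begin

lemma linear_\<tau>: "w \<in> chart_dom l \<Longrightarrow> linear (\<tau> c w)"
  and Ck_\<tau>: "Ck_on (chart_dom l) k (\<lambda>w. \<tau> c w v)"
  using primitive unfolding primitive_of_omega_def smooth_one_form_def smooth_on_def by blast+

lemma \<tau>_cis_cong:
  assumes "z \<in> ball 0 l" "cis \<psi> = cis \<psi>'"
  shows "\<tau> c (z, \<psi>) = \<tau> c (z, \<psi>')"
  using primitive assms(1) by (intro periodic_cis[OF _ assms(2)]) (simp add: primitive_of_omega_def smooth_one_form_def)

text \<open>The chart is kept as a parameter because the first one controls the form up to
  \<open>t = 0\<close> and the second one up to \<open>t = l\<close>; in between the two pullbacks
  agree.\<close>

definition pb :: "pole \<Rightarrow> coords \<Rightarrow> coords \<Rightarrow> real" where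
  "pb c x \<xi> = \<tau> c (polar l c x) (polar_D l c x \<xi>)"

lemma pb_eq_pullback: "pb c x = pullback (polar l c) (\<tau> c) x"
  by (auto simp: pb_def pullback_def frechet_derivative_polar)

lemma pb_Pole1: "x \<in> polar_interior l \<Longrightarrow> pb Pole1 x = pb Pole0 x"
  using primitive by (simp add: pb_eq_pullback primitive_of_omega_def smooth_one_form_def)

lemma pb_cong:
  assumes "polar l c x \<in> chart_dom l" "fst x = fst y" "cis (fst (snd x)) = cis (fst (snd y))" "cis (snd (snd x)) = cis (snd (snd y))"
  shows "pb c x = pb c y"
proof -
  have "fst (polar l c x) = fst (polar l c y) \<and> cis (snd (polar l c x)) = cis (snd (polar l c y))"
    using assms(2-) by (cases c; cases x; cases y) (auto simp flip: cis_mult cis_divide)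
  then have "\<tau> c (polar l c x) = \<tau> c (polar l c y)"
    using \<tau>_cis_cong[of "fst (polar l c x)" "snd (polar l c x)" "snd (polar l c y)" c] assms(1)
    by (cases "polar l c x"; cases "polar l c y") (auto simp: chart_dom_def)
  moreover have "polar_D l c x = polar_D l c y" using assms by (intro polar_D_cong)
  ultimately show ?thesis by (auto simp: pb_def)
qed

text \<open>Regularity of \<open>\<tau>\<close> is given for constant vectors; expanding in a basis
  transfers it to vectors that move with the point.\<close>

lemma linear_components:
  assumes "linear (f :: complex \<times> real \<Rightarrow> real)"
  shows "f v = Re (fst v) * f (1, 0) + Im (fst v) * f (\<i>, 0) + snd v * f (0, 1)"
proof -
  have "v = Re (fst v) *\<^sub>R (1, 0) + Im (fst v) *\<^sub>R (\<i>, 0) + snd v *\<^sub>R (0, 1)"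
    by (auto simp: prod_eq_iff complex_eq_iff)
  then have "f v = f (Re (fst v) *\<^sub>R (1, 0) + Im (fst v) *\<^sub>R (\<i>, 0) + snd v *\<^sub>R (0, 1))" by simp
  then show ?thesis by (simp add: linear_add[OF assms] linear_scale[OF assms] del: scaleR_Pair)
qed

lemma continuous_on_polar: "continuous_on S (polar l c)"
  by (intro continuous_at_imp_continuous_on ballI has_derivative_continuous[OF has_derivative_polar])

lemma continuous_on_polar_D: "continuous_on S (\<lambda>x. polar_D l c x \<xi>)"
proof -
  obtain a b d where \<xi>: "\<xi> = (a, b, d)" by (cases \<xi>) auto
  show ?thesis
  proof (cases c)
    case Pole0
    have "(\<lambda>x. polar_D l c x \<xi>) = (\<lambda>x. (of_real a * cis (snd (snd x)) + of_real (fst x * d) * (\<i> * cis (snd (snd x))), b + d))"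
      by (auto simp: Pole0 \<xi>)
    then show ?thesis by (simp only:) (intro continuous_intros)
  next
    case Pole1
    have "(\<lambda>x. polar_D l c x \<xi>) = (\<lambda>x. (- of_real a * cis (snd (snd x)) + of_real ((l - fst x) * d) * (\<i> * cis (snd (snd x))), d - b))"
      by (auto simp: Pole1 \<xi>)
    then show ?thesis by (simp only:) (intro continuous_intros)
  qed
qed

lemma continuous_on_pb:
  assumes "\<And>x. x \<in> S \<Longrightarrow> polar l c x \<in> chart_dom l"
  shows "continuous_on S (\<lambda>x. pb c x \<xi>)"
proof -
  have \<tau>: "continuous_on S (\<lambda>x. \<tau> c (polar l c x) v)" for v
    using assms by (intro continuous_on_compose2[OF Ck_on_imp_continuous_on[OF Ck_\<tau>] continuous_on_polar]) auto
  note D = continuous_on_polar_D[of S c \<xi>]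
  have "continuous_on S (\<lambda>x. Re (fst (polar_D l c x \<xi>)) * \<tau> c (polar l c x) (1, 0)
     + Im (fst (polar_D l c x \<xi>)) * \<tau> c (polar l c x) (\<i>, 0) + snd (polar_D l c x \<xi>) * \<tau> c (polar l c x) (0, 1))"
    by (intro continuous_intros \<tau> D)
  then show ?thesis
    by (rule continuous_on_eq) (simp add: pb_def linear_components[OF linear_\<tau>[OF assms], symmetric])
qed

text \<open>One continuous derivative is what differentiation under the circle integrals requires.
  After expansion in a basis, the compositions with \<open>polar\<close> have a constant vector
  argument, and the chain rule applies.\<close>

lemma Ck_1_pb: "Ck_on (polar_interior l) 1 (\<lambda>x. pb Pole0 x \<xi>)"
proof -
  let ?S = "polar_interior l"
  note o = open_polar_interior[of l]
  obtain a b d where \<xi>: "\<xi> = (a, b, d)" by (cases \<xi>) auto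
  have \<tau>: "Ck_on ?S 1 (\<lambda>x. \<tau> Pole0 (polar l Pole0 x) v)" for v
  proof -
    let ?F = "\<lambda>w. frechet_derivative (\<lambda>w. \<tau> Pole0 w v) (at w)"
    have F: "((\<lambda>w. \<tau> Pole0 w v) has_derivative ?F w) (at w)" if "w \<in> chart_dom l" for w
      by (rule Ck_on_SucD[OF Ck_\<tau>[of 1, unfolded One_nat_def] that])
    have cF: "continuous_on (chart_dom l) (\<lambda>w. ?F w u)" for u
      using Ck_on_frechet_derivative[OF Ck_\<tau>[of "Suc 0" Pole0 v], of u] by (simp only: Ck_on.simps)
    have "Ck_on ?S (Suc 0) (\<lambda>x. \<tau> Pole0 (polar l Pole0 x) v)"
    proof (rule Ck_on_SucI[OF o])
      show "((\<lambda>x. \<tau> Pole0 (polar l Pole0 x) v) has_derivative (\<lambda>u. ?F (polar l Pole0 x) (polar_D l Pole0 x u))) (at x)"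
        if "x \<in> ?S" for x
        by (rule has_derivative_compose[OF has_derivative_polar F[OF polar_in_chart_dom[OF that]]])
      fix u
      have lin: "linear (?F (polar l Pole0 x))" if "x \<in> ?S" for x
        using F[OF polar_in_chart_dom[OF that]] has_derivative_linear by blast
      have c: "continuous_on ?S (\<lambda>x. ?F (polar l Pole0 x) w)" for w
        by (rule continuous_on_compose2[OF cF continuous_on_polar]) (rule image_subsetI, rule polar_in_chart_dom)
      note D = continuous_on_polar_D[of ?S Pole0 u]
      have "continuous_on ?S (\<lambda>x. Re (fst (polar_D l Pole0 x u)) * ?F (polar l Pole0 x) (1, 0)
         + Im (fst (polar_D l Pole0 x u)) * ?F (polar l Pole0 x) (\<i>, 0) + snd (polar_D l Pole0 x u) * ?F (polar l Pole0 x) (0, 1))"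
        by (intro continuous_intros c D)
      then show "Ck_on ?S 0 (\<lambda>x. ?F (polar l Pole0 x) (polar_D l Pole0 x u))"
        unfolding Ck_on.simps by (rule continuous_on_eq) (simp add: linear_components[OF lin, symmetric])
    qed
    then show ?thesis by simp
  qed
  have t: "Ck_on ?S 1 (\<lambda>x. fst x)" by (rule Ck_on_linear[OF o bounded_linear_fst])
  note sc = Ck_on_sin_cos[OF o bounded_linear_compose[OF bounded_linear_snd bounded_linear_snd], where k = 1]
  have "Ck_on ?S 1 (\<lambda>x. (a * cos (snd (snd x)) + (-1) * (fst x * (d * sin (snd (snd x))))) * \<tau> Pole0 (polar l Pole0 x) (1, 0)
     + (a * sin (snd (snd x)) + fst x * (d * cos (snd (snd x)))) * \<tau> Pole0 (polar l Pole0 x) (\<i>, 0)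
     + (b + d) * \<tau> Pole0 (polar l Pole0 x) (0, 1))"
    by (rule \<tau> t conjunct1[OF sc] conjunct2[OF sc] Ck_on_const[OF o] Ck_on_add[OF o] Ck_on_mult[OF o])+
  then show ?thesis
  proof (rule Ck_on_cong[OF o, rotated])
    fix x assume x: "x \<in> ?S"
    show "(a * cos (snd (snd x)) + (-1) * (fst x * (d * sin (snd (snd x))))) * \<tau> Pole0 (polar l Pole0 x) (1, 0)
     + (a * sin (snd (snd x)) + fst x * (d * cos (snd (snd x)))) * \<tau> Pole0 (polar l Pole0 x) (\<i>, 0)
     + (b + d) * \<tau> Pole0 (polar l Pole0 x) (0, 1) = pb Pole0 x \<xi>"
      unfolding pb_def linear_components[OF linear_\<tau>[OF polar_in_chart_dom[OF x]], of Pole0 Pole0 "polar_D l Pole0 x \<xi>"]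
      by (cases x) (simp add: \<xi> mult.assoc)
  qed
qed

text \<open>The first vector is the argument of the form, the second one the direction of
  differentiation.\<close>

abbreviation dpb :: "coords \<Rightarrow> coords \<Rightarrow> coords \<Rightarrow> real" where
  "dpb x \<xi> \<equiv> frechet_derivative (\<lambda>x. pb Pole0 x \<xi>) (at x)"

lemma has_derivative_pb: "x \<in> polar_interior l \<Longrightarrow> ((\<lambda>x. pb Pole0 x \<xi>) has_derivative dpb x \<xi>) (at x)"
  by (rule Ck_on_SucD[OF Ck_1_pb[unfolded One_nat_def]])

lemma DERIV_pb_line:
  assumes "x + s *\<^sub>R u \<in> polar_interior l"
  shows "((\<lambda>s. pb Pole0 (x + s *\<^sub>R u) \<xi>) has_real_derivative dpb (x + s *\<^sub>R u) \<xi> u) (at s)"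
proof -
  have "((\<lambda>s. x + s *\<^sub>R u) has_derivative (\<lambda>h. h *\<^sub>R u)) (at s)"
    by (auto intro!: derivative_eq_intros)
  from has_derivative_compose[OF this has_derivative_pb[OF assms]]
  show ?thesis
    using linear_scale[OF has_derivative_linear[OF has_derivative_pb[OF assms]]]
    by (simp add: has_field_derivative_def mult_commute_abs)
qed

lemma continuous_dpb: "continuous_on (polar_interior l) (\<lambda>x. dpb x \<xi> u)"
  using Ck_on_frechet_derivative[OF Ck_1_pb[unfolded One_nat_def], of \<xi> u] by (simp only: Ck_on.simps)

lemma d_pb:
  assumes "x \<in> polar_interior l"
  shows "dpb x \<eta> \<xi> - dpb x \<xi> \<eta> = omega \<gamma> m x \<xi> \<eta>"
  using primitive assms
  unfolding primitive_of_omega_def ext_deriv_def pb_eq_pullback[symmetric] by blast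

section \<open>Circulation along the coordinate circles\<close>

definition latitude_integral :: "pole \<Rightarrow> real \<Rightarrow> real \<Rightarrow> real" where
  "latitude_integral c \<phi> t = integral {0..2*pi} (\<lambda>\<theta>. pb c (t, \<phi>, \<theta>) (0, 0, 1))"

definition fibre_integral :: "pole \<Rightarrow> real \<Rightarrow> real" where
  "fibre_integral c t = integral {0..2*pi} (\<lambda>\<phi>. pb c (t, \<phi>, 0) (0, 1, 0))"

lemma DERIV_latitude_integral:
  assumes t: "t \<in> {0<..<l}"
  shows "(latitude_integral Pole0 \<phi> has_real_derivative 2 * pi * (m * D\<gamma> 1 t * sin \<phi> - \<gamma> t)) (at t)"
  unfolding latitude_integral_def
proof (rule DERIV_circle_integral[OF _ t, where a = "\<lambda>t \<theta>. pb Pole0 (t, \<phi>, \<theta>) (1, 0, 0)"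
      and b' = "\<lambda>t \<theta>. dpb (t, \<phi>, \<theta>) (0, 0, 1) (1, 0, 0)" and \<omega> = "\<lambda>t \<theta>. m * D\<gamma> 1 t * sin \<phi> - \<gamma> t"])
  fix t \<theta> assume "t \<in> {0<..<l}"
  then have x: "(t, \<phi>, \<theta>) \<in> polar_interior l" by (simp add: polar_interior_def)
  show "((\<lambda>t. pb Pole0 (t, \<phi>, \<theta>) (0, 0, 1)) has_real_derivative dpb (t, \<phi>, \<theta>) (0, 0, 1) (1, 0, 0)) (at t)"
    using DERIV_pb_line[of "(0, \<phi>, \<theta>)" t "(1, 0, 0)"] x by simp
  \<comment> \<open>The subtracted term is \<open>omega\<close> on \<partial>_t and
    \<partial>_\<theta>: its first summand comes from \<open>d\<alpha>\<close>, and
    \<open>\<gamma> t\<close> from the area form.\<close>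
  have "dpb (t, \<phi>, \<theta>) (1, 0, 0) (0, 0, 1) = dpb (t, \<phi>, \<theta>) (0, 0, 1) (1, 0, 0) - (m * D\<gamma> 1 t * sin \<phi> - \<gamma> t)"
    using d_pb[OF x, of "(0, 0, 1)" "(1, 0, 0)"] omega_eq[OF x, of m "(1, 0, 0)" "(0, 0, 1)"]
    by (simp add: flat_alpha_deriv_def algebra_simps)
  then show "((\<lambda>\<theta>. pb Pole0 (t, \<phi>, \<theta>) (1, 0, 0)) has_real_derivative
      dpb (t, \<phi>, \<theta>) (0, 0, 1) (1, 0, 0) - (m * D\<gamma> 1 t * sin \<phi> - \<gamma> t)) (at \<theta>)"
    using DERIV_pb_line[of "(t, \<phi>, 0)" \<theta> "(0, 0, 1)" "(1, 0, 0)"] x by simp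
next
  show "continuous_on ({0<..<l} \<times> {0..2*pi}) (\<lambda>(t, \<theta>). dpb (t, \<phi>, \<theta>) (0, 0, 1) (1, 0, 0))"
    unfolding case_prod_unfold
    by (intro continuous_on_compose2[OF continuous_dpb] continuous_intros) (auto simp: polar_interior_def)
  show "continuous_on {0..2*pi} (\<lambda>\<theta>. pb Pole0 (t, \<phi>, \<theta>) (0, 0, 1))" if "t \<in> {0<..<l}" for t
    by (intro continuous_on_compose2[OF continuous_on_pb[OF polar_in_chart_dom]] continuous_intros)
       (use that in \<open>auto simp: polar_interior_def\<close>)
  show "pb Pole0 (t, \<phi>, 2 * pi) (1, 0, 0) = pb Pole0 (t, \<phi>, 0) (1, 0, 0)"
    using t by (intro fun_cong[OF pb_cong] polar_in_chart_dom) (auto simp: polar_interior_def)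
  show "((\<lambda>\<theta>. m * D\<gamma> 1 t * sin \<phi> - \<gamma> t) has_integral 2 * pi * (m * D\<gamma> 1 t * sin \<phi> - \<gamma> t)) {0..2*pi}"
    using has_integral_const_real[of "m * D\<gamma> 1 t * sin \<phi> - \<gamma> t" 0 "2 * pi"] by simp
qed simp

text \<open>On \<partial>_t and \<partial>_\<phi> the form \<open>omega\<close> is
  \<open>m * sin \<phi>\<close>, which has mean zero over the fibre.\<close>

lemma DERIV_fibre_integral:
  assumes t: "t \<in> {0<..<l}"
  shows "(fibre_integral Pole0 has_real_derivative 0) (at t)"
  unfolding fibre_integral_def
proof (rule DERIV_circle_integral[OF _ t, where a = "\<lambda>t \<phi>. pb Pole0 (t, \<phi>, 0) (1, 0, 0)"
      and b' = "\<lambda>t \<phi>. dpb (t, \<phi>, 0) (0, 1, 0) (1, 0, 0)" and \<omega> = "\<lambda>t \<phi>. m * sin \<phi>"])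
  fix t \<phi> assume "t \<in> {0<..<l}"
  then have x: "(t, \<phi>, 0) \<in> polar_interior l" by (simp add: polar_interior_def)
  show "((\<lambda>t. pb Pole0 (t, \<phi>, 0) (0, 1, 0)) has_real_derivative dpb (t, \<phi>, 0) (0, 1, 0) (1, 0, 0)) (at t)"
    using DERIV_pb_line[of "(0, \<phi>, 0)" t "(1, 0, 0)"] x by simp
  have "dpb (t, \<phi>, 0) (1, 0, 0) (0, 1, 0) = dpb (t, \<phi>, 0) (0, 1, 0) (1, 0, 0) - m * sin \<phi>"
    using d_pb[OF x, of "(0, 1, 0)" "(1, 0, 0)"] omega_eq[OF x, of m "(1, 0, 0)" "(0, 1, 0)"]
    by (simp add: flat_alpha_deriv_def algebra_simps)
  then show "((\<lambda>\<phi>. pb Pole0 (t, \<phi>, 0) (1, 0, 0)) has_real_derivative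
      dpb (t, \<phi>, 0) (0, 1, 0) (1, 0, 0) - m * sin \<phi>) (at \<phi>)"
    using DERIV_pb_line[of "(t, 0, 0)" \<phi> "(0, 1, 0)" "(1, 0, 0)"] x by simp
next
  show "continuous_on ({0<..<l} \<times> {0..2*pi}) (\<lambda>(t, \<phi>). dpb (t, \<phi>, 0) (0, 1, 0) (1, 0, 0))"
    unfolding case_prod_unfold
    by (intro continuous_on_compose2[OF continuous_dpb] continuous_intros) (auto simp: polar_interior_def)
  show "continuous_on {0..2*pi} (\<lambda>\<phi>. pb Pole0 (t, \<phi>, 0) (0, 1, 0))" if "t \<in> {0<..<l}" for t
    by (intro continuous_on_compose2[OF continuous_on_pb[OF polar_in_chart_dom]] continuous_intros)
       (use that in \<open>auto simp: polar_interior_def\<close>)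
  show "pb Pole0 (t, 2 * pi, 0) (1, 0, 0) = pb Pole0 (t, 0, 0) (1, 0, 0)"
    using t by (intro fun_cong[OF pb_cong] polar_in_chart_dom) (auto simp: polar_interior_def)
  have "((\<lambda>\<phi>. m * sin \<phi>) has_integral (- m * cos (2 * pi) - (- m * cos 0))) {0..2*pi}"
    by (rule fundamental_theorem_of_calculus)
       (auto intro!: derivative_eq_intros simp flip: has_real_derivative_iff_has_vector_derivative)
  then show "((\<lambda>\<phi>. m * sin \<phi>) has_integral 0) {0..2*pi}" by simp
qed simp

text \<open>With \<open>T\<close> reaching up to the pole of \<open>c\<close>, this links the
  interior, where derivatives are known, to the value at the pole.\<close>

lemma continuous_circle_integrals:
  assumes "\<And>t \<phi> \<theta>. t \<in> T \<Longrightarrow> polar l c (t, \<phi>, \<theta>) \<in> chart_dom l"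
  shows "continuous_on T (latitude_integral c \<phi>)" "continuous_on T (fibre_integral c)"
proof -
  have "continuous_on T (\<lambda>t. integral (cbox 0 (2*pi)) (\<lambda>\<theta>. pb c (t, \<phi>, \<theta>) (0, 0, 1)))"
    "continuous_on T (\<lambda>t. integral (cbox 0 (2*pi)) (\<lambda>\<phi>. pb c (t, \<phi>, 0) (0, 1, 0)))"
    by (intro integral_continuous_on_param; unfold case_prod_unfold;
        intro continuous_on_compose2[OF continuous_on_pb[of "T \<times> UNIV \<times> UNIV"]] continuous_intros;
        use assms in auto)+
  then show "continuous_on T (latitude_integral c \<phi>)" "continuous_on T (fibre_integral c)"
    by (simp_all add: latitude_integral_def[abs_def] fibre_integral_def[abs_def])
qed

definition pole_integral :: "pole \<Rightarrow> real" where
  "pole_integral c = integral {0..2*pi} (\<lambda>\<psi>. \<tau> c (0, \<psi>) (0, 1))"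

lemma pole_integral_shift:
  "integral {0..2*pi} (\<lambda>s. \<tau> c (0, a + s) (0, 1)) = pole_integral c"
  "integral {0..2*pi} (\<lambda>s. \<tau> c (0, a - s) (0, 1)) = pole_integral c"
proof -
  have c: "continuous_on UNIV (\<lambda>\<psi>. \<tau> c (0, \<psi>) (0, 1))"
    by (intro continuous_on_compose2[OF Ck_on_imp_continuous_on[OF Ck_\<tau>]] continuous_intros)
       (use l_pos in \<open>auto simp: chart_dom_def\<close>)
  have p: "\<tau> c (0, \<psi> + 2 * pi) (0, 1) = \<tau> c (0, \<psi>) (0, 1)" for \<psi>
    using l_pos by (intro fun_cong[OF \<tau>_cis_cong]) (auto simp flip: cis_mult)
  show "integral {0..2*pi} (\<lambda>s. \<tau> c (0, a + s) (0, 1)) = pole_integral c"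
    "integral {0..2*pi} (\<lambda>s. \<tau> c (0, a - s) (0, 1)) = pole_integral c"
    unfolding pole_integral_def using integral_periodic_shift[OF c p] by simp_all
qed

text \<open>At \<open>t = 0\<close> the base point stands still when \<open>\<theta>\<close> varies
  and the direction angle \<open>\<phi> + \<theta>\<close> makes one turn, starting from
  \<open>\<phi>\<close>.\<close>

lemma latitude_integral_0: "latitude_integral Pole0 \<phi> 0 = pole_integral Pole0"
  using pole_integral_shift(1)[of Pole0 \<phi>] by (simp add: latitude_integral_def pb_def)

lemma fibre_integral_0: "fibre_integral Pole0 0 = pole_integral Pole0"
  by (simp add: fibre_integral_def pb_def pole_integral_def)

lemma latitude_integral_l: "latitude_integral Pole1 \<phi> l = pole_integral Pole1"
  using pole_integral_shift(1)[of Pole1 "pi - \<phi>"] by (simp add: latitude_integral_def pb_def)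

text \<open>The direction angle \<open>\<pi> - \<phi> + \<theta>\<close> increases with
  \<open>\<theta>\<close> but decreases with \<open>\<phi>\<close>; hence the sign, in contrast to
  \<open>latitude_integral_l\<close>.\<close>

lemma fibre_integral_l: "fibre_integral Pole1 l = - pole_integral Pole1"
proof -
  have "\<tau> Pole1 (0, \<psi>) (0, -1) = - \<tau> Pole1 (0, \<psi>) (0, 1)" for \<psi>
    using linear_neg[OF linear_\<tau>[of "(0, \<psi>)" Pole1], of "(0, 1)"] l_pos by (simp add: chart_dom_def)
  then show ?thesis
    using pole_integral_shift(2)[of Pole1 pi] by (simp add: fibre_integral_def pb_def)
qed

lemma integrals_Pole1:
  assumes "t \<in> {0<..<l}"
  shows "latitude_integral Pole1 \<phi> t = latitude_integral Pole0 \<phi> t" "fibre_integral Pole1 t = fibre_integral Pole0 t"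
  using assms by (simp_all add: latitude_integral_def fibre_integral_def pb_Pole1 polar_interior_def)

text \<open>The \<open>\<theta>\<close>-circles and the fibres of the bundle both degenerate to the polar fibres; since at the
  second pole the fibre is traversed backwards, comparing the two ends determines all constants.\<close>

lemma latitude_integral_eq:
  assumes t: "t \<in> {0<..<l}"
  shows "latitude_integral Pole0 \<phi> t = 2 * pi * (m * \<gamma> t * sin \<phi> - Gamma_prim \<gamma> t)"
proof -
  let ?G = "\<lambda>t. 2 * pi * (m * \<gamma> t * sin \<phi> - Gamma_prim \<gamma> t)"
  have d0: "polar l Pole0 (s, \<phi>, \<theta>) \<in> chart_dom l" if "s \<in> {0..t}" for s \<phi> \<theta>
    using that t by (auto simp: chart_dom_def norm_mult)
  have d1: "polar l Pole1 (s, \<phi>, \<theta>) \<in> chart_dom l" if "s \<in> {t..l}" for s \<phi> \<theta>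
    using that t by (auto simp: chart_dom_def norm_mult simp flip: of_real_diff)
  have cG: "continuous_on {0..l} ?G"
    using continuous_on_D\<gamma>[of 0] DERIV_continuous_on[OF Gamma_deriv] by (auto intro!: continuous_intros)
  have dG: "(?G has_real_derivative 2 * pi * (m * D\<gamma> 1 s * sin \<phi> - \<gamma> s)) (at s)" if "s \<in> {0<..<l}" for s
    using that by (auto intro!: derivative_eq_intros \<gamma>_deriv_at Gamma_deriv_at)
  have L0: "((\<lambda>s. latitude_integral Pole0 \<phi> s - ?G s) has_real_derivative 0) (at s)" if "s \<in> {0<..<l}" for s
    using DERIV_diff[OF DERIV_latitude_integral[OF that, of \<phi>] dG[OF that]] by simp
  have L1: "((\<lambda>s. latitude_integral Pole1 \<phi> s - ?G s) has_real_derivative 0) (at s)" if "s \<in> {0<..<l}" for s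
    by (rule has_field_derivative_transform_within_open[OF L0[OF that], of "{0<..<l}"])
       (use that in \<open>auto simp: integrals_Pole1\<close>)
  have F1: "(fibre_integral Pole1 has_real_derivative 0) (at s)" if "s \<in> {0<..<l}" for s
    by (rule has_field_derivative_transform_within_open[OF DERIV_fibre_integral[OF that], of "{0<..<l}"])
       (use that in \<open>auto simp: integrals_Pole1\<close>)
  have "latitude_integral Pole0 \<phi> t - ?G t = latitude_integral Pole0 \<phi> 0 - ?G 0"
    by (rule DERIV_isconst_end)
       (use t L0 in \<open>auto intro!: continuous_on_diff continuous_circle_integrals(1)[OF d0] continuous_on_subset[OF cG]\<close>)
  moreover have "latitude_integral Pole1 \<phi> l - ?G l = latitude_integral Pole1 \<phi> t - ?G t"
    by (rule DERIV_isconst_end)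
       (use t L1 in \<open>auto intro!: continuous_on_diff continuous_circle_integrals(1)[OF d1] continuous_on_subset[OF cG]\<close>)
  moreover have "fibre_integral Pole0 t = fibre_integral Pole0 0"
    by (rule DERIV_isconst_end)
       (use t DERIV_fibre_integral in \<open>auto intro!: continuous_circle_integrals(2)[OF d0]\<close>)
  moreover have "fibre_integral Pole1 l = fibre_integral Pole1 t"
    by (rule DERIV_isconst_end)
       (use t F1 in \<open>auto intro!: continuous_circle_integrals(2)[OF d1]\<close>)
  \<comment> \<open>Write \<open>P\<close> and \<open>Q\<close> for the integrals over the first and
    the second polar fibre. The fibres give \<open>P = - Q\<close>. As \<open>?G\<close> is
    \<open>2 * pi\<close> at 0 and \<open>- 2 * pi\<close> at \<open>l\<close>, the latitudes give
    \<open>P - 2 * pi = Q + 2 * pi\<close>. Therefore \<open>P = 2 * pi\<close>, and the constant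
    difference between the latitude integral and \<open>?G\<close> is zero.\<close>
  ultimately show ?thesis
    by (simp add: latitude_integral_0 latitude_integral_l fibre_integral_0 fibre_integral_l
        integrals_Pole1[OF t] Gamma_0 Gamma_l algebra_simps)
qed

end

section \<open>The lifted latitude\<close>

lemma abs_cos_diff_le: "\<bar>cos x - cos y\<bar> \<le> \<bar>x - y :: real\<bar>"
proof -
  have "\<bar>cos x - cos y\<bar> = 2 * (\<bar>sin ((x + y) / 2)\<bar> * \<bar>sin ((y - x) / 2)\<bar>)"
    by (simp add: cos_diff_cos abs_mult)
  also have "\<dots> \<le> 2 * (1 * \<bar>(y - x) / 2\<bar>)"
    by (intro mult_left_mono mult_mono abs_sin_x_le_abs_x) auto
  finally show ?thesis by simp
qed

lemma abs_sin_diff_le: "\<bar>sin x - sin y\<bar> \<le> \<bar>x - y :: real\<bar>"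
  using abs_cos_diff_le[of "pi / 2 - x" "pi / 2 - y"] by (simp add: cos_diff abs_minus_commute)

text \<open>The bound on the absolute value of \<open>f'\<close> works in both time directions: with
  the factor \<open>exp (- C * r)\<close> the function decreases after \<open>s\<close>, and with
  \<open>exp (C * r)\<close> it increases before \<open>s\<close>.\<close>

lemma gronwall_zero:
  fixes f f' :: "real \<Rightarrow> real"
  assumes f: "\<And>r. \<bar>r - s\<bar> < \<epsilon> \<Longrightarrow> (f has_real_derivative f' r) (at r)"
    and b: "\<And>r. \<bar>r - s\<bar> < \<epsilon> \<Longrightarrow> \<bar>f' r\<bar> \<le> C * f r" and "f s = 0" and r: "\<bar>r - s\<bar> < \<epsilon>"
  shows "f r \<le> 0"
proof -
  have d: "((\<lambda>r. exp (k * r) * f r) has_real_derivative exp (k * q) * (k * f q + f' q)) (at q)" if "\<bar>q - s\<bar> < \<epsilon>" for k q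
    using f[OF that] by (auto intro!: derivative_eq_intros simp: algebra_simps)
  show ?thesis
  proof (cases "s \<le> r")
    case True
    have "exp (- C * r) * f r \<le> exp (- C * s) * f s"
    proof (rule DERIV_nonpos_imp_nonincreasing[OF True, where f = "\<lambda>r. exp (- C * r) * f r"])
      fix q assume q: "s \<le> q" "q \<le> r"
      then have "\<bar>q - s\<bar> < \<epsilon>" using r by linarith
      from d[OF this, of "- C"] abs_le_D1[OF b[OF this]]
      show "\<exists>y. ((\<lambda>r. exp (- C * r) * f r) has_real_derivative y) (at q) \<and> y \<le> 0"
        by (intro exI[of _ "exp (- C * q) * (- C * f q + f' q)"]) (simp add: mult_le_0_iff)
    qed
    then show ?thesis using \<open>f s = 0\<close> by (simp add: mult_le_0_iff)
  next
    case False
    have "exp (C * r) * f r \<le> exp (C * s) * f s"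
    proof (rule DERIV_nonneg_imp_nondecreasing[where f = "\<lambda>r. exp (C * r) * f r"])
      fix q assume q: "r \<le> q" "q \<le> s"
      then have "\<bar>q - s\<bar> < \<epsilon>" using r by linarith
      from d[OF this, of C] abs_le_D2[OF b[OF this]]
      show "\<exists>y. ((\<lambda>r. exp (C * r) * f r) has_real_derivative y) (at q) \<and> 0 \<le> y"
        by (intro exI[of _ "exp (C * q) * (C * f q + f' q)"]) (simp add: zero_le_mult_iff)
    qed (use False in simp)
    then show ?thesis using \<open>f s = 0\<close> by (simp add: mult_le_0_iff)
  qed
qed

lemma has_vector_derivative_Pair3_iff:
  fixes f g h :: "real \<Rightarrow> real"
  shows "((\<lambda>r. (f r, g r, h r)) has_vector_derivative (a, b, d)) (at s) \<longleftrightarrow>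
    (f has_real_derivative a) (at s) \<and> (g has_real_derivative b) (at s) \<and> (h has_real_derivative d) (at s)"
proof
  note fst = bounded_linear.has_vector_derivative[OF bounded_linear_fst]
    and snd = bounded_linear.has_vector_derivative[OF bounded_linear_snd]
  assume "((\<lambda>r. (f r, g r, h r)) has_vector_derivative (a, b, d)) (at s)"
  from fst[OF this] fst[OF snd[OF this]] snd[OF snd[OF this]]
  show "(f has_real_derivative a) (at s) \<and> (g has_real_derivative b) (at s) \<and> (h has_real_derivative d) (at s)"
    by (simp add: has_real_derivative_iff_has_vector_derivative)
qed (auto simp: has_real_derivative_iff_has_vector_derivative intro!: has_vector_derivative_Pair)

section \<open>The latitude, its direction angle and its lift\<close>

locale magnetic_latitude = profile +
  fixes t\<^sub>0 m :: real
  assumes t\<^sub>0: "t\<^sub>0 \<in> {0<..<l}" and slope: "D\<gamma> 1 t\<^sub>0 \<noteq> 0" and m: "m = \<bar>\<gamma> t\<^sub>0 / D\<gamma> 1 t\<^sub>0\<bar>"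
begin

definition \<sigma> :: real where "\<sigma> = sgn (D\<gamma> 1 t\<^sub>0)"
definition \<phi>\<^sub>0 :: real where "\<phi>\<^sub>0 = \<sigma> * (pi / 2)"
text \<open>The angular velocity \<open>m * \<sigma> / \<gamma> t\<^sub>0\<close> of the orbit,
  simplified by the choice of \<open>m\<close>.\<close>

definition \<kappa> :: real where "\<kappa> = 1 / D\<gamma> 1 t\<^sub>0"

lemma \<sigma>_cases: "\<sigma> = 1 \<and> D\<gamma> 1 t\<^sub>0 > 0 \<or> \<sigma> = -1 \<and> D\<gamma> 1 t\<^sub>0 < 0"
  using slope by (auto simp: \<sigma>_def sgn_real_def)

definition lat :: "real \<Rightarrow> upoint" where
  "lat \<theta> = pt l (t\<^sub>0, \<phi>\<^sub>0, \<theta>)"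

lemma sin_cos_\<phi>\<^sub>0 [simp]: "sin \<phi>\<^sub>0 = \<sigma>" "cos \<phi>\<^sub>0 = 0"
  using \<sigma>_cases by (auto simp: \<phi>\<^sub>0_def)

lemma \<gamma>_t\<^sub>0: "\<gamma> t\<^sub>0 > 0"
  using \<gamma>_pos t\<^sub>0 by auto

lemma \<gamma>_t\<^sub>0_nonzero [simp]: "\<gamma> t\<^sub>0 \<noteq> 0"
  using \<gamma>_t\<^sub>0 by simp

lemma m_pos: "m > 0"
  using m slope \<gamma>_t\<^sub>0 by simp

text \<open>The second identity is the balance that makes the \<open>\<phi>\<close>-component of the
  field vanish along the latitude; the third one is its \<open>\<theta>\<close>-component.\<close>

lemma m_\<sigma>: "m * \<sigma> = \<gamma> t\<^sub>0 / D\<gamma> 1 t\<^sub>0" "m * D\<gamma> 1 t\<^sub>0 / \<gamma> t\<^sub>0 * \<sigma> = 1" "m * \<sigma> / \<gamma> t\<^sub>0 = \<kappa>"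
  using \<sigma>_cases \<gamma>_t\<^sub>0 unfolding m \<kappa>_def by (auto simp: abs_div_pos abs_if divide_less_0_iff zero_less_divide_iff)

lemma lat_interior: "(t\<^sub>0, \<phi>, \<theta>) \<in> polar_interior l"
  using t\<^sub>0 by (simp add: polar_interior_def)

lemma mfield_lat:
  assumes "cis \<phi> = cis \<phi>\<^sub>0"
  shows "mfield m (t\<^sub>0, \<phi>, \<theta>) = (0, 0, \<kappa>)"
proof -
  have "sin \<phi> = \<sigma>" "cos \<phi> = 0" using assms sin_cos_\<phi>\<^sub>0 by (simp_all add: complex_eq_iff)
  then show ?thesis by (simp only: mfield_def prod.case m_\<sigma>(2,3) mult_zero_right diff_self)
qed

lemma lat_eq_pt_iff:
  "t \<in> {0..l} \<Longrightarrow> lat \<theta> = pt l (t, \<phi>, \<theta>') \<longleftrightarrow> t = t\<^sub>0 \<and> cis \<phi> = cis \<phi>\<^sub>0 \<and> cis \<theta>' = cis \<theta>"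
  using t\<^sub>0 unfolding lat_def by (subst pt_interior_iff) auto

lemma lat_eq_iff: "lat \<theta> = lat \<theta>' \<longleftrightarrow> cis \<theta> = cis \<theta>'"
  using lat_eq_pt_iff[of t\<^sub>0 \<theta> \<phi>\<^sub>0 \<theta>'] t\<^sub>0 by (auto simp: lat_def)

lemma unit_tangent_lift_latitude:
  "unit_tangent_lift \<gamma> l (latitude \<gamma> t\<^sub>0 \<sigma>) s = lat (\<sigma> * s / \<gamma> t\<^sub>0)"
proof -
  have "((\<lambda>s. (t\<^sub>0, \<sigma> * s / \<gamma> t\<^sub>0)) has_vector_derivative (0, \<sigma> / \<gamma> t\<^sub>0)) (at s)"
    by (intro has_vector_derivative_Pair) (auto intro!: derivative_eq_intros simp flip: has_real_derivative_iff_has_vector_derivative)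
  then have d: "vector_derivative (latitude \<gamma> t\<^sub>0 \<sigma>) (at s) = (0, \<sigma> / \<gamma> t\<^sub>0)"
    by (intro vector_derivative_at) (simp add: latitude_def[abs_def])
  have b: "latitude \<gamma> t\<^sub>0 \<sigma> s = (t\<^sub>0, \<sigma> * s / \<gamma> t\<^sub>0)" by (simp add: latitude_def)
  show ?thesis
    unfolding unit_tangent_lift_def d b
  proof (rule the_equality)
    show "\<exists>x\<in>polar_interior l. lat (\<sigma> * s / \<gamma> t\<^sub>0) = pt l x \<and> base_pt x = (t\<^sub>0, \<sigma> * s / \<gamma> t\<^sub>0) \<and> unit_vec \<gamma> x = (0, \<sigma> / \<gamma> t\<^sub>0)"
      using lat_interior by (intro bexI[of _ "(t\<^sub>0, \<phi>\<^sub>0, \<sigma> * s / \<gamma> t\<^sub>0)"]) (auto simp: lat_def base_pt_def unit_vec_polar)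
    fix p assume "\<exists>x\<in>polar_interior l. p = pt l x \<and> base_pt x = (t\<^sub>0, \<sigma> * s / \<gamma> t\<^sub>0) \<and> unit_vec \<gamma> x = (0, \<sigma> / \<gamma> t\<^sub>0)"
    then obtain \<phi> where p: "p = pt l (t\<^sub>0, \<phi>, \<sigma> * s / \<gamma> t\<^sub>0)" "cos \<phi> = 0" "sin \<phi> = \<sigma>"
      using \<gamma>_t\<^sub>0 by (auto simp: base_pt_def unit_vec_polar)
    show "p = lat (\<sigma> * s / \<gamma> t\<^sub>0)"
      using lat_eq_pt_iff[of t\<^sub>0 _ \<phi>] p t\<^sub>0 by (auto simp: complex_eq_iff)
  qed
qed

lemma range_unit_tangent_lift: "range (unit_tangent_lift \<gamma> l (latitude \<gamma> t\<^sub>0 \<sigma>)) = range lat"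
proof -
  have "lat \<theta> = unit_tangent_lift \<gamma> l (latitude \<gamma> t\<^sub>0 \<sigma>) (\<sigma> * \<gamma> t\<^sub>0 * \<theta>)" for \<theta>
    using \<sigma>_cases \<gamma>_t\<^sub>0 by (auto simp: unit_tangent_lift_latitude)
  then show ?thesis
    using unit_tangent_lift_latitude by (intro subset_antisym image_subsetI) (metis rangeI)+
qed

section \<open>Integral curves that meet the latitude\<close>

abbreviation Y :: chart_field where "Y \<equiv> magnetic_field \<gamma> l m"

text \<open>An integral curve comes with a chart, whose complex coordinate is nonzero at an interior
  point. A local logarithm of it yields a differentiable radius and angle, and thus an honest
  differential equation for \<open>mfield\<close> in real coordinates.\<close>

lemma local_polar_lift:
  assumes u: "integral_curve l Y u" and x0: "x0 \<in> polar_interior l" "u s = pt l x0"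
  obtains \<epsilon> x where "\<epsilon> > 0" "fst (x s) = fst x0" "cis (fst (snd (x s))) = cis (fst (snd x0))" "cis (snd (snd (x s))) = cis (snd (snd x0))"
    "\<And>r. \<bar>r - s\<bar> < \<epsilon> \<Longrightarrow> x r \<in> polar_interior l \<and> u r = pt l (x r) \<and> (x has_vector_derivative mfield m (x r)) (at r)"
proof -
  obtain c w \<epsilon>1 where \<epsilon>1: "\<epsilon>1 > 0" and w: "\<And>r. \<bar>r - s\<bar> < \<epsilon>1 \<Longrightarrow> w r \<in> chart_dom l \<and> chart_pt l c (w r) = u r \<and>
        (w has_vector_derivative Y c (w r)) (at r)"
    using u unfolding integral_curve_def by metis
  have ws: "w s \<in> chart_dom l" "chart_pt l c (w s) = pt l x0" using w[of s] \<epsilon>1 x0 by auto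
  obtain y where y: "y \<in> polar_interior l" "polar l c y = w s" "fst y = fst x0"
    "cis (fst (snd y)) = cis (fst (snd x0))" "cis (snd (snd y)) = cis (snd (snd x0))"
    using chart_pt_eq_interior[OF ws(1) x0(1) ws(2)] by metis
  define z where "z r = fst (w r)" for r
  define R where "R r = norm (z r)" for r
  have zs: "z s \<noteq> 0" using polar_nonzero[OF y(1), of c] y(2) by (simp add: z_def)
  have zs': "z s = of_real (R s) * cis (snd (snd y))"
    using y(1) unfolding R_def z_def y(2)[symmetric]
    by (cases c; cases y) (auto simp: polar_interior_def norm_mult simp flip: of_real_diff)
  have "continuous (at s) (\<lambda>r. z r / z s)"
    unfolding z_def using w[of s] \<epsilon>1 has_vector_derivative_continuous zs
    by (intro continuous_intros) (auto simp: z_def)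
  then have "(\<lambda>r. z r / z s) \<midarrow>s\<rightarrow> 1" using zs by (simp add: isCont_def)
  then have "eventually (\<lambda>r. z r / z s \<in> - \<real>\<^sub>\<le>\<^sub>0) (at s)"
    by (rule topological_tendstoD) (auto simp: closed_nonpos_Reals_complex)
  then obtain \<epsilon>2 where \<epsilon>2: "\<epsilon>2 > 0" "\<And>r. r \<noteq> s \<Longrightarrow> dist r s < \<epsilon>2 \<Longrightarrow> z r / z s \<in> - \<real>\<^sub>\<le>\<^sub>0"
    unfolding eventually_at by blast
  have \<epsilon>2': "z r / z s \<notin> \<real>\<^sub>\<le>\<^sub>0" if "\<bar>r - s\<bar> < \<epsilon>2" for r
    using \<epsilon>2(2)[of r] that zs by (cases "r = s") (auto simp: dist_real_def)
  define \<epsilon> where "\<epsilon> = min \<epsilon>1 \<epsilon>2"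
  \<comment> \<open>Division by \<open>z s\<close> moves the value at time \<open>s\<close> to 1,
    and \<open>\<epsilon>2\<close> keeps the quotient off the branch cut of
    \<open>Ln\<close>.\<close>
  define \<Lambda> where "\<Lambda> r = Ln (z r / z s)" for r
  define \<theta> where "\<theta> r = snd (snd y) + Im (\<Lambda> r)" for r
  define x where "x r = (case c of Pole0 \<Rightarrow> (R r, snd (w r) - \<theta> r, \<theta> r) | Pole1 \<Rightarrow> (l - R r, pi + \<theta> r - snd (w r), \<theta> r))" for r
  show ?thesis
  proof (rule that[of \<epsilon> x])
    show "\<epsilon> > 0" using \<epsilon>1 \<epsilon>2 by (simp add: \<epsilon>_def)
    have "\<theta> s = snd (snd y)" using zs by (simp add: \<theta>_def \<Lambda>_def)
    then have xs: "x s = y"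
      using y(1) unfolding x_def R_def z_def y(2)[symmetric]
      by (cases c; cases y) (auto simp: polar_interior_def norm_mult simp flip: of_real_diff)
    show "fst (x s) = fst x0" "cis (fst (snd (x s))) = cis (fst (snd x0))" "cis (snd (snd (x s))) = cis (snd (snd x0))"
      using y xs by auto
    have pol: "x r \<in> polar_interior l \<and> polar l c (x r) = w r \<and> z r = of_real (R r) * cis (\<theta> r) \<and> R r > 0 \<and> R r = R s * exp (Re (\<Lambda> r))"
      if "\<bar>r - s\<bar> < \<epsilon>" for r
    proof -
      have nz: "z r / z s \<noteq> 0" using \<epsilon>2'[of r] that by (auto simp: \<epsilon>_def)
      then have "z r = z s * exp (\<Lambda> r)" using zs by (simp add: \<Lambda>_def)
      then have zr: "z r = of_real (R s * exp (Re (\<Lambda> r))) * cis (\<theta> r)"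
        unfolding zs' by (simp add: \<theta>_def exp_eq_polar cis_mult[symmetric] mult_ac)
      have R: "R r = R s * exp (Re (\<Lambda> r))" unfolding R_def[of r] zr using R_def by (simp add: norm_mult)
      have "R r > 0" "R r < l" using nz w[of r] that by (auto simp: R_def z_def \<epsilon>_def chart_dom_def)
      then show ?thesis using zr R
        by (cases c) (auto simp: x_def polar_interior_def z_def prod_eq_iff)
    qed
    fix r assume r: "\<bar>r - s\<bar> < \<epsilon>"
    have r1: "\<bar>r - s\<bar> < \<epsilon>1" using r by (simp add: \<epsilon>_def)
    have xr: "x r \<in> polar_interior l" "polar l c (x r) = w r" using pol[OF r] by auto
    obtain a b d where abd: "mfield m (x r) = (a, b, d)" by (cases "mfield m (x r)") auto
    have wd0: "(w has_vector_derivative polar_D l c (x r) (a, b, d)) (at r)"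
      using w[OF r1] magnetic_field_eq[OF xr(1), of m c] xr(2) abd by simp
    have wd: "(z has_vector_derivative fst (polar_D l c (x r) (a, b, d))) (at r)"
      "((\<lambda>r. snd (w r)) has_real_derivative snd (polar_D l c (x r) (a, b, d))) (at r)"
      unfolding z_def has_real_derivative_iff_has_vector_derivative
      by (rule bounded_linear.has_vector_derivative[OF bounded_linear_fst wd0]
          bounded_linear.has_vector_derivative[OF bounded_linear_snd wd0])+
    \<comment> \<open>The radius in the chart is \<open>t\<close> or \<open>l - t\<close>, so it
      changes at the rate \<open>e * a\<close>. The logarithmic derivative of \<open>z\<close> then
      has the relative change of the radius as real part and the angular velocity as imaginary
      part.\<close>
    define e :: real where "e = (case c of Pole0 \<Rightarrow> 1 | Pole1 \<Rightarrow> -1)"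
    have Rr: "R r > 0" "z r = of_real (R r) * cis (\<theta> r)" using pol[OF r] by auto
    have Dz: "fst (polar_D l c (x r) (a, b, d)) = z r * Complex (e * a / R r) d"
      using Rr by (cases c) (auto simp: x_def e_def complex_eq_iff field_simps)
    have L: "(\<Lambda> has_vector_derivative Complex (e * a / R r) d) (at r)"
    proof -
      have "((\<lambda>r. z r / z s) has_vector_derivative z r * Complex (e * a / R r) d / z s) (at r)"
        using wd(1) unfolding Dz by (rule has_vector_derivative_divide)
      moreover have "(Ln has_field_derivative inverse (z r / z s)) (at (z r / z s))"
        using \<epsilon>2'[of r] r by (intro has_field_derivative_Ln) (auto simp: \<epsilon>_def)
      ultimately have "(Ln \<circ> (\<lambda>r. z r / z s) has_vector_derivative z r * Complex (e * a / R r) d / z s * inverse (z r / z s)) (at r)"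
        by (rule field_vector_diff_chain_at)
      moreover have "z r \<noteq> 0" using Rr by auto
      ultimately show ?thesis using zs by (simp add: o_def \<Lambda>_def[abs_def] field_simps)
    qed
    have "((\<lambda>r. Im (\<Lambda> r)) has_real_derivative d) (at r)"
      using bounded_linear.has_vector_derivative[OF bounded_linear_Im L]
      by (simp add: has_real_derivative_iff_has_vector_derivative)
    from DERIV_add[OF DERIV_const[of "snd (snd y)"] this]
    have th: "(\<theta> has_real_derivative d) (at r)" by (simp add: \<theta>_def[abs_def])
    have "((\<lambda>r. Re (\<Lambda> r)) has_real_derivative e * a / R r) (at r)"
      using bounded_linear.has_vector_derivative[OF bounded_linear_Re L]
      by (simp add: has_real_derivative_iff_has_vector_derivative)
    from DERIV_cmult[OF DERIV_fun_exp[OF this], of "R s"]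
    have "((\<lambda>r. R s * exp (Re (\<Lambda> r))) has_real_derivative R s * (exp (Re (\<Lambda> r)) * (e * a / R r))) (at r)" .
    then have "((\<lambda>r. R s * exp (Re (\<Lambda> r))) has_real_derivative e * a) (at r)"
      using pol[OF r] Rr(1) zs by (simp add: R_def[of s])
    then have Rd: "(R has_real_derivative e * a) (at r)"
    proof (rule has_field_derivative_transform_within_open)
      show "R s * exp (Re (\<Lambda> q)) = R q" if "q \<in> ball s \<epsilon>" for q
        using pol[of q] that by (simp only: mem_ball dist_real_def abs_minus_commute)
    qed (use r in \<open>simp_all add: dist_real_def abs_minus_commute\<close>)
    have "(x has_vector_derivative (a, b, d)) (at r)"
    proof (cases c)
      case Pole0
      have "((\<lambda>r. snd (w r) - \<theta> r) has_real_derivative (b + d) - d) (at r)"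
        using wd(2) by (intro DERIV_diff th) (simp add: Pole0 x_def)
      then show ?thesis using Rd th by (simp add: x_def[abs_def] Pole0 has_vector_derivative_Pair3_iff e_def)
    next
      case Pole1
      have "((\<lambda>r. pi + \<theta> r - snd (w r)) has_real_derivative (0 + d) - (d - b)) (at r)"
        using wd(2) by (intro DERIV_diff DERIV_add DERIV_const th) (simp add: Pole1 x_def)
      moreover have "((\<lambda>r. l - R r) has_real_derivative 0 - e * a) (at r)"
        by (intro DERIV_diff DERIV_const Rd)
      ultimately show ?thesis using th by (simp add: x_def[abs_def] Pole1 has_vector_derivative_Pair3_iff e_def)
    qed
    moreover have "u r = pt l (x r)"
      using chart_pt_polar[OF polar_interior_subset[OF xr(1)] polar_in_chart_dom[OF xr(1)]] w[OF r1] xr(2) by metis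
    ultimately show "x r \<in> polar_interior l \<and> u r = pt l (x r) \<and> (x has_vector_derivative mfield m (x r)) (at r)"
      using xr abd by simp
  qed
qed

text \<open>On the left is the derivative along the field of the squared distance to
  \<open>(t\<^sub>0, \<phi>1)\<close>, so this is the inequality for \<open>gronwall_zero\<close>.
  It holds because the first two components of the field vanish on the latitude and grow at most
  linearly away from it. The angle \<open>\<phi>1\<close> may be any representative, as a lift need
  not start at \<open>\<phi>\<^sub>0\<close> itself.\<close>

lemma mfield_bound:
  assumes "cos \<phi>1 = 0" "sin \<phi>1 = \<sigma>"
  obtains \<delta> C where "\<delta> > 0"
    "\<And>t \<phi> \<theta>. \<bar>t - t\<^sub>0\<bar> < \<delta> \<Longrightarrow> \<bar>2 * (t - t\<^sub>0) * fst (mfield m (t, \<phi>, \<theta>)) + 2 * (\<phi> - \<phi>1) * fst (snd (mfield m (t, \<phi>, \<theta>)))\<bar>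
       \<le> C * ((t - t\<^sub>0)\<^sup>2 + (\<phi> - \<phi>1)\<^sup>2)"
proof -
  define q where "q t = D\<gamma> 1 t / \<gamma> t" for t
  have "(q has_real_derivative (D\<gamma> 2 t\<^sub>0 * \<gamma> t\<^sub>0 - D\<gamma> 1 t\<^sub>0 * D\<gamma> 1 t\<^sub>0) / (\<gamma> t\<^sub>0 * \<gamma> t\<^sub>0)) (at t\<^sub>0)" (is "(_ has_real_derivative ?Q) _")
    unfolding q_def using D\<gamma>_deriv_at[of t\<^sub>0 1] \<gamma>_deriv_at[of t\<^sub>0] t\<^sub>0 \<gamma>_t\<^sub>0
    by (intro DERIV_divide) (auto simp: numeral_2_eq_2)
  \<comment> \<open>Error bound 1 in the definition of the derivative gives a linear estimate around
    \<open>t\<^sub>0\<close> with constant \<open>\<bar>?Q\<bar> + 1\<close>.\<close>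
  then obtain \<delta> where \<delta>: "\<delta> > 0" "\<And>t. \<bar>t - t\<^sub>0\<bar> < \<delta> \<Longrightarrow> \<bar>q t - q t\<^sub>0 - ?Q * (t - t\<^sub>0)\<bar> \<le> 1 * \<bar>t - t\<^sub>0\<bar>"
    unfolding has_field_derivative_def has_derivative_at_alt by (metis real_norm_def zero_less_one)
  define C1 where "C1 = \<bar>?Q\<bar> + 1"
  have q: "\<bar>q t - q t\<^sub>0\<bar> \<le> C1 * \<bar>t - t\<^sub>0\<bar>" if "\<bar>t - t\<^sub>0\<bar> < \<delta>" for t
  proof -
    have "\<bar>a\<bar> \<le> \<bar>x\<bar> + e" if "\<bar>a - x\<bar> \<le> e" for a x e :: real using that by linarith
    from this[OF \<delta>(2)[OF that]] show ?thesis by (simp add: C1_def abs_mult distrib_right)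
  qed
  show ?thesis
  proof (rule that[OF \<delta>(1)])
    fix t \<phi> \<theta> :: real assume t: "\<bar>t - t\<^sub>0\<bar> < \<delta>"
    define A B where "A = \<bar>t - t\<^sub>0\<bar>" and "B = \<bar>\<phi> - \<phi>1\<bar>"
    have AB: "A \<ge> 0" "B \<ge> 0" by (simp_all add: A_def B_def)
    have c: "\<bar>cos \<phi>\<bar> \<le> B" using abs_cos_diff_le[of \<phi> \<phi>1] assms by (simp add: B_def)
    \<comment> \<open>The \<open>\<phi>\<close>-component is compared with its value 0 on the
      latitude, separating the change of \<open>q\<close> from that of the sine.\<close>
    have "m * q t\<^sub>0 * \<sigma> = 1" using m_\<sigma>(2) by (simp only: q_def times_divide_eq_right)
    then have "1 - m * q t * sin \<phi> = m * ((q t\<^sub>0 - q t) * sin \<phi>) + m * (q t\<^sub>0 * (sin \<phi>1 - sin \<phi>))"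
      by (simp add: assms algebra_simps)
    also have "\<bar>\<dots>\<bar> \<le> m * (C1 * A * 1) + m * (\<bar>q t\<^sub>0\<bar> * B)"
    proof (rule order_trans[OF abs_triangle_ineq add_mono])
      show "\<bar>m * ((q t\<^sub>0 - q t) * sin \<phi>)\<bar> \<le> m * (C1 * A * 1)"
        unfolding abs_mult using m_pos q[OF t] by (intro mult_mono) (auto simp: A_def abs_minus_commute C1_def)
      show "\<bar>m * (q t\<^sub>0 * (sin \<phi>1 - sin \<phi>))\<bar> \<le> m * (\<bar>q t\<^sub>0\<bar> * B)"
        unfolding abs_mult using m_pos abs_sin_diff_le[of \<phi>1 \<phi>] by (intro mult_mono) (auto simp: B_def abs_minus_commute)
    qed
    finally have p: "\<bar>1 - m * q t * sin \<phi>\<bar> \<le> m * C1 * A + m * \<bar>q t\<^sub>0\<bar> * B" by (simp add: mult_ac)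
    have "\<bar>2 * (t - t\<^sub>0) * (m * cos \<phi>) + 2 * (\<phi> - \<phi>1) * (1 - m * q t * sin \<phi>)\<bar> \<le>
      2 * A * (m * \<bar>cos \<phi>\<bar>) + 2 * B * \<bar>1 - m * q t * sin \<phi>\<bar>"
      using abs_of_pos[OF m_pos]
      by (intro order_trans[OF abs_triangle_ineq]) (simp only: abs_mult abs_numeral A_def B_def order_refl)
    also have "\<dots> \<le> 2 * A * (m * B) + 2 * B * (m * C1 * A + m * \<bar>q t\<^sub>0\<bar> * B)"
      using c p m_pos AB by (intro add_mono mult_left_mono) auto
    also have "\<dots> = m * (1 + C1) * (2 * A * B) + 2 * m * \<bar>q t\<^sub>0\<bar> * B\<^sup>2"
      by (simp add: algebra_simps power2_eq_square)
    also have "\<dots> \<le> m * (1 + C1) * (A\<^sup>2 + B\<^sup>2) + 2 * m * \<bar>q t\<^sub>0\<bar> * (A\<^sup>2 + B\<^sup>2)"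
      using m_pos sum_squares_bound[of A B] by (intro add_mono mult_left_mono) (auto simp: C1_def)
    also have "\<dots> = (m * (1 + C1) + 2 * m * \<bar>q t\<^sub>0\<bar>) * ((t - t\<^sub>0)\<^sup>2 + (\<phi> - \<phi>1)\<^sup>2)"
      by (simp add: A_def B_def algebra_simps)
    finally show "\<bar>2 * (t - t\<^sub>0) * fst (mfield m (t, \<phi>, \<theta>)) + 2 * (\<phi> - \<phi>1) * fst (snd (mfield m (t, \<phi>, \<theta>)))\<bar>
       \<le> (m * (1 + C1) + 2 * m * \<bar>q t\<^sub>0\<bar>) * ((t - t\<^sub>0)\<^sup>2 + (\<phi> - \<phi>1)\<^sup>2)"
      by (simp add: mfield_def q_def)
  qed
qed

text \<open>Gronwall's lemma freezes \<open>t\<close> and \<open>\<phi>\<close> at their initial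
  values; on the latitude the remaining component of the field is the constant
  \<open>\<kappa>\<close>.\<close>

lemma local_uniqueness:
  assumes u: "integral_curve l Y u" and us: "u s = lat \<theta>s"
  obtains \<epsilon> where "\<epsilon> > 0" "\<And>r. \<bar>r - s\<bar> < \<epsilon> \<Longrightarrow> u r = lat (\<theta>s + \<kappa> * (r - s))"
proof -
  from local_polar_lift[OF u lat_interior us[unfolded lat_def]]
  obtain \<epsilon>1 x where x: "\<epsilon>1 > 0" "fst (x s) = t\<^sub>0" "cis (fst (snd (x s))) = cis \<phi>\<^sub>0" "cis (snd (snd (x s))) = cis \<theta>s"
    "\<And>r. \<bar>r - s\<bar> < \<epsilon>1 \<Longrightarrow> x r \<in> polar_interior l \<and> u r = pt l (x r) \<and> (x has_vector_derivative mfield m (x r)) (at r)"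
    by (metis fst_conv snd_conv)
  define t \<phi> \<theta> where "t r = fst (x r)" and "\<phi> r = fst (snd (x r))" and "\<theta> r = snd (snd (x r))" for r
  have xr: "x r = (t r, \<phi> r, \<theta> r)" for r by (simp add: t_def \<phi>_def \<theta>_def)
  have D: "(t has_real_derivative fst (mfield m (x r))) (at r)" "(\<phi> has_real_derivative fst (snd (mfield m (x r)))) (at r)"
    "(\<theta> has_real_derivative snd (snd (mfield m (x r)))) (at r)" if "\<bar>r - s\<bar> < \<epsilon>1" for r
  proof -
    have "(\<lambda>r. (t r, \<phi> r, \<theta> r)) = x" by (simp add: xr fun_eq_iff)
    with x(5)[OF that] have "((\<lambda>r. (t r, \<phi> r, \<theta> r)) has_vector_derivative
        (fst (mfield m (x r)), fst (snd (mfield m (x r))), snd (snd (mfield m (x r))))) (at r)"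
      by (simp only: prod.collapse)
    then show "(t has_real_derivative fst (mfield m (x r))) (at r)" "(\<phi> has_real_derivative fst (snd (mfield m (x r)))) (at r)"
      "(\<theta> has_real_derivative snd (snd (mfield m (x r)))) (at r)"
      unfolding has_vector_derivative_Pair3_iff by blast+
  qed
  have \<phi>s: "cos (\<phi> s) = 0" "sin (\<phi> s) = \<sigma>" using x(3) sin_cos_\<phi>\<^sub>0 by (auto simp: \<phi>_def complex_eq_iff)
  obtain \<delta> C where \<delta>: "\<delta> > 0"
    "\<And>t \<phi>' \<theta>. \<bar>t - t\<^sub>0\<bar> < \<delta> \<Longrightarrow> \<bar>2 * (t - t\<^sub>0) * fst (mfield m (t, \<phi>', \<theta>)) + 2 * (\<phi>' - \<phi> s) * fst (snd (mfield m (t, \<phi>', \<theta>)))\<bar>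
       \<le> C * ((t - t\<^sub>0)\<^sup>2 + (\<phi>' - \<phi> s)\<^sup>2)"
    using mfield_bound[OF \<phi>s] by metis
  have "isCont t s" using D(1)[of s] x(1) by (auto intro: DERIV_isCont)
  then obtain \<epsilon>2 where \<epsilon>2: "\<epsilon>2 > 0" "\<And>r. \<bar>r - s\<bar> < \<epsilon>2 \<Longrightarrow> \<bar>t r - t\<^sub>0\<bar> < \<delta>"
    using \<delta>(1) x(2) unfolding continuous_at_eps_delta by (metis dist_real_def t_def)
  define \<epsilon> where "\<epsilon> = min \<epsilon>1 \<epsilon>2"
  have \<epsilon>: "\<epsilon> > 0" "\<bar>r - s\<bar> < \<epsilon>1" "\<bar>r - s\<bar> < \<epsilon>2" if "\<bar>r - s\<bar> < \<epsilon>" for r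
    using that x(1) \<epsilon>2(1) by (auto simp: \<epsilon>_def)
  have const: "t r = t\<^sub>0 \<and> \<phi> r = \<phi> s" if r: "\<bar>r - s\<bar> < \<epsilon>" for r
  proof -
    have "(t r - t\<^sub>0)\<^sup>2 + (\<phi> r - \<phi> s)\<^sup>2 \<le> 0"
    proof (rule gronwall_zero[where f = "\<lambda>r. (t r - t\<^sub>0)\<^sup>2 + (\<phi> r - \<phi> s)\<^sup>2" and s = s and \<epsilon> = \<epsilon> and C = C])
      fix r assume r: "\<bar>r - s\<bar> < \<epsilon>"
      show "((\<lambda>r. (t r - t\<^sub>0)\<^sup>2 + (\<phi> r - \<phi> s)\<^sup>2) has_real_derivative
          2 * (t r - t\<^sub>0) * fst (mfield m (x r)) + 2 * (\<phi> r - \<phi> s) * fst (snd (mfield m (x r)))) (at r)"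
        using D[OF \<epsilon>(2)[OF r]] by (auto intro!: derivative_eq_intros simp: algebra_simps)
      show "\<bar>2 * (t r - t\<^sub>0) * fst (mfield m (x r)) + 2 * (\<phi> r - \<phi> s) * fst (snd (mfield m (x r)))\<bar>
          \<le> C * ((t r - t\<^sub>0)\<^sup>2 + (\<phi> r - \<phi> s)\<^sup>2)"
        using \<delta>(2)[OF \<epsilon>2(2)[OF \<epsilon>(3)[OF r]]] by (simp add: xr)
    qed (use r x(2) in \<open>simp_all add: t_def\<close>)
    then show ?thesis by (simp add: sum_power2_le_zero_iff)
  qed
  have D\<theta>: "((\<lambda>r. \<theta> r - \<kappa> * r) has_real_derivative 0) (at r)" if r: "\<bar>r - s\<bar> < \<epsilon>" for r
  proof -
    have "cis (\<phi> s) = cis \<phi>\<^sub>0" using x(3) by (simp add: \<phi>_def)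
    then have "mfield m (x r) = (0, 0, \<kappa>)" using const[OF r] mfield_lat by (simp add: xr)
    then show ?thesis using D(3)[OF \<epsilon>(2)[OF r]] by (auto intro!: derivative_eq_intros)
  qed
  show ?thesis
  proof (rule that)
    show "\<epsilon> > 0" using x(1) \<epsilon>2(1) by (simp add: \<epsilon>_def)
    fix r assume r: "\<bar>r - s\<bar> < \<epsilon>"
    have "\<theta> r - \<kappa> * r = \<theta> s - \<kappa> * s"
      by (rule DERIV_isconst3[of "s - \<epsilon>" "s + \<epsilon>"]) (use r \<epsilon>(1)[OF r] D\<theta> in \<open>auto simp: abs_less_iff\<close>)
    then have \<theta>r: "\<theta> r = \<theta> s + \<kappa> * (r - s)" by (simp add: right_diff_distrib)
    have "lat (\<theta>s + \<kappa> * (r - s)) = pt l (x r)"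
      unfolding xr using const[OF r] x(3,4) t\<^sub>0 \<theta>r
      by (subst lat_eq_pt_iff) (auto simp: \<phi>_def \<theta>_def simp flip: cis_mult)
    then show "u r = lat (\<theta>s + \<kappa> * (r - s))" using x(5)[OF \<epsilon>(2)[OF r]] by simp
  qed
qed

text \<open>The times at which \<open>u\<close> agrees with the rotation form an open set by
  \<open>local_uniqueness\<close> and a closed one by continuity in a chart; the real line is
  connected.\<close>

lemma uniqueness:
  assumes u: "integral_curve l Y u" and u0: "u 0 = lat \<theta>0"
  shows "u s = lat (\<theta>0 + \<kappa> * s)"
proof -
  define S where "S = {s. u s = lat (\<theta>0 + \<kappa> * s)}"
  have "open S"
    unfolding open_dist
  proof
    fix s assume "s \<in> S"
    then obtain \<epsilon> where "\<epsilon> > 0" "\<And>r. \<bar>r - s\<bar> < \<epsilon> \<Longrightarrow> u r = lat (\<theta>0 + \<kappa> * s + \<kappa> * (r - s))"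
      using local_uniqueness[OF u, of s "\<theta>0 + \<kappa> * s"] by (auto simp: S_def)
    then show "\<exists>e>0. \<forall>y. dist y s < e \<longrightarrow> y \<in> S"
      by (intro exI[of _ \<epsilon>]) (auto simp: S_def dist_real_def algebra_simps)
  qed
  moreover have "open (- S)"
    unfolding open_dist
  proof
    fix s assume s: "s \<in> - S"
    obtain c w \<epsilon> where \<epsilon>: "\<epsilon> > 0" and w: "\<And>r. \<bar>r - s\<bar> < \<epsilon> \<Longrightarrow> w r \<in> chart_dom l \<and> chart_pt l c (w r) = u r \<and>
        (w has_vector_derivative Y c (w r)) (at r)"
      using u unfolding integral_curve_def by metis
    \<comment> \<open>The fibre coordinate of a chart is a real lift and is compared through
      \<open>cis\<close>. Near \<open>s\<close>, the zeros of the continuous function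
      \<open>g\<close> are exactly the points of \<open>S\<close>.\<close>
    define g where "g r = (fst (w r) - fst (polar l c (t\<^sub>0, \<phi>\<^sub>0, \<theta>0 + \<kappa> * r)), cis (snd (w r)) - cis (snd (polar l c (t\<^sub>0, \<phi>\<^sub>0, \<theta>0 + \<kappa> * r))))" for r
    have g: "r \<in> S \<longleftrightarrow> g r = 0" if "\<bar>r - s\<bar> < \<epsilon>" for r
      using chart_pt_eq_interior_iff[OF _ lat_interior, of "w r" c \<phi>\<^sub>0 "\<theta>0 + \<kappa> * r"] w[OF that]
      by (simp add: S_def lat_def g_def zero_prod_def)
    have "isCont g s"
    proof -
      have "isCont w s" using w[of s] \<epsilon> has_vector_derivative_continuous by fastforce
      moreover have "isCont (\<lambda>r. polar l c (t\<^sub>0, \<phi>\<^sub>0, \<theta>0 + \<kappa> * r)) s"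
        by (rule isCont_o2[OF _ has_derivative_continuous[OF has_derivative_polar]]) (intro continuous_intros)
      moreover have "isCont (\<lambda>r. cis (f r)) s" if "isCont f s" for f
        using that by (auto simp: cis_conv_exp intro!: continuous_intros)
      ultimately show ?thesis unfolding g_def by (intro continuous_intros) auto
    qed
    moreover have "g s \<noteq> 0" using g[of s] \<epsilon> s by simp
    ultimately obtain e where "e > 0" "\<And>r. dist s r < e \<Longrightarrow> g r \<noteq> 0"
      using continuous_at_avoid[of s g 0] by auto
    then show "\<exists>e>0. \<forall>y. dist y s < e \<longrightarrow> y \<in> - S"
      using g \<epsilon> by (intro exI[of _ "min e \<epsilon>"]) (auto simp: dist_real_def abs_minus_commute)
  qed
  ultimately have "S = {} \<or> S = UNIV" using clopen[of S] by (simp add: closed_def)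
  moreover have "0 \<in> S" using u0 by (simp add: S_def)
  ultimately have "s \<in> S" by auto
  then show ?thesis by (simp add: S_def)
qed

lemma integral_curve_lat: "integral_curve l Y (\<lambda>s. lat (\<kappa> * s))"
  unfolding integral_curve_def
proof
  fix s :: real
  define w where "w r = polar l Pole0 (t\<^sub>0, \<phi>\<^sub>0, \<kappa> * r)" for r
  have "w r \<in> chart_dom l \<and> chart_pt l Pole0 (w r) = lat (\<kappa> * r) \<and> (w has_vector_derivative Y Pole0 (w r)) (at r)" for r
  proof (intro conjI)
    show "w r \<in> chart_dom l" unfolding w_def by (rule polar_in_chart_dom[OF lat_interior])
    show "chart_pt l Pole0 (w r) = lat (\<kappa> * r)"
      unfolding w_def lat_def by (rule chart_pt_polar[OF polar_interior_subset polar_in_chart_dom]) (rule lat_interior)+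
    have "((\<lambda>r. (t\<^sub>0, \<phi>\<^sub>0, \<kappa> * r)) has_vector_derivative (0, 0, \<kappa>)) (at r)"
      unfolding has_vector_derivative_Pair3_iff by (auto intro!: derivative_eq_intros)
    then have "((\<lambda>r. (t\<^sub>0, \<phi>\<^sub>0, \<kappa> * r)) has_derivative (\<lambda>h. h *\<^sub>R (0, 0, \<kappa>))) (at r)"
      by (simp add: has_vector_derivative_def)
    from has_derivative_compose[OF this has_derivative_polar]
    have "(w has_vector_derivative polar_D l Pole0 (t\<^sub>0, \<phi>\<^sub>0, \<kappa> * r) (0, 0, \<kappa>)) (at r)"
      unfolding has_vector_derivative_def w_def linear_scale[OF linear_polar_D] .
    then show "(w has_vector_derivative Y Pole0 (w r)) (at r)"
      unfolding w_def magnetic_field_eq[OF lat_interior] by (simp add: mfield_lat)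
  qed
  then show "\<exists>c w. \<exists>\<epsilon>>0. \<forall>r. \<bar>r - s\<bar> < \<epsilon> \<longrightarrow> w r \<in> chart_dom l \<and> chart_pt l c (w r) = lat (\<kappa> * r) \<and>
      (w has_vector_derivative Y c (w r)) (at r)"
    using zero_less_one by blast
qed

text \<open>The period is the time \<open>2 * pi / \<bar>\<kappa>\<bar>\<close> of one full
  turn.\<close>

lemma periodic_orbit_exists: "periodic_orbit l Y (\<lambda>s. lat (\<kappa> * s)) (2 * pi * \<bar>D\<gamma> 1 t\<^sub>0\<bar>)" "range (\<lambda>s. lat (\<kappa> * s)) = range lat"
proof -
  have "cis (\<kappa> * (s + 2 * pi * \<bar>D\<gamma> 1 t\<^sub>0\<bar>)) = cis (\<kappa> * s)" for s
  proof -
    have "\<kappa> * (s + 2 * pi * \<bar>D\<gamma> 1 t\<^sub>0\<bar>) = \<kappa> * s + \<sigma> * (2 * pi)"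
      using \<sigma>_cases by (auto simp: distrib_left \<kappa>_def)
    moreover have "cis (\<sigma> * (2 * pi)) = 1" using \<sigma>_cases by (auto simp: complex_eq_iff)
    ultimately show ?thesis by (simp flip: cis_mult)
  qed
  then show "periodic_orbit l Y (\<lambda>s. lat (\<kappa> * s)) (2 * pi * \<bar>D\<gamma> 1 t\<^sub>0\<bar>)"
    using slope by (simp add: periodic_orbit_def integral_curve_lat lat_eq_iff)
  have "lat \<theta> = lat (\<kappa> * (D\<gamma> 1 t\<^sub>0 * \<theta>))" for \<theta> using slope by (simp add: \<kappa>_def)
  then show "range (\<lambda>s. lat (\<kappa> * s)) = range lat" by blast
qed

section \<open>The sign of the action and the value of the first integral\<close>

lemma positive_of_magnetic_curvature:
  assumes "\<And>t. t \<in> {0..l} \<Longrightarrow> magnetic_curvature \<gamma> l m t > 0"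
  shows "(\<gamma> t\<^sub>0)\<^sup>2 - D\<gamma> 1 t\<^sub>0 * Gamma_prim \<gamma> t\<^sub>0 > 0"
proof -
  have K: "m\<^sup>2 * D\<gamma> 2 t < \<gamma> t" if "t \<in> {0<..<l}" for t
    using assms[of t] that \<gamma>_pos[of t] by (simp add: magnetic_curvature_def curvature_def field_simps)
  define \<epsilon> where "\<epsilon> = \<sigma>"
  have \<epsilon>: "\<epsilon> = 1 \<or> \<epsilon> = -1" using \<sigma>_cases by (auto simp: \<epsilon>_def)
  define N where "N t = \<epsilon> * m * D\<gamma> 1 t - \<gamma> t" for t
  \<comment> \<open>By the choice of \<open>m\<close>, the point \<open>t\<^sub>0\<close> is
    critical for the function whose derivative is \<open>N\<close>.\<close>
  have N0: "N t\<^sub>0 = 0" using m_\<sigma>(2) \<gamma>_t\<^sub>0 by (simp add: N_def \<epsilon>_def field_simps)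
  have dJ: "((\<lambda>t. \<epsilon> * m * \<gamma> t - Gamma_prim \<gamma> t) has_real_derivative N t) (at t)" if "t \<in> {0<..<l}" for t
    using that unfolding N_def by (auto intro!: derivative_eq_intros \<gamma>_deriv_at Gamma_deriv_at)
  have cJ: "continuous_on {0..l} (\<lambda>t. \<epsilon> * m * \<gamma> t - Gamma_prim \<gamma> t)"
    using continuous_on_D\<gamma>[of 0] DERIV_continuous_on[OF Gamma_deriv] by (auto intro!: continuous_intros)
  \<comment> \<open>Since \<open>\<epsilon>\<close> has square 1,
    \<open>N' + \<epsilon> / m * N\<close> equals \<open>\<epsilon> / m\<close> times
    \<open>m\<^sup>2 * \<gamma>'' - \<gamma>\<close>: the integrating factor cancels the first
    derivative of \<open>\<gamma>\<close>.\<close>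
  have dN: "((\<lambda>t. - \<epsilon> * exp (\<epsilon> * t / m) * N t) has_real_derivative exp (\<epsilon> * t / m) / m * (\<gamma> t - m\<^sup>2 * D\<gamma> 2 t)) (at t)"
    if "t \<in> {0<..<l}" for t
    using that \<epsilon> m_pos unfolding N_def
    by (auto intro!: derivative_eq_intros \<gamma>_deriv_at D\<gamma>_deriv_at simp: numeral_2_eq_2 field_simps power2_eq_square)
  have dNpos: "exp (\<epsilon> * t / m) / m * (\<gamma> t - m\<^sup>2 * D\<gamma> 2 t) > 0" if "t \<in> {0<..<l}" for t
    using K[OF that] m_pos by simp
  have mono: "- \<epsilon> * exp (\<epsilon> * s / m) * N s < - \<epsilon> * exp (\<epsilon> * t / m) * N t" if "s < t" "0 < s" "t < l" for s t
    by (rule DERIV_pos_imp_increasing[OF that(1), where f = "\<lambda>t. - \<epsilon> * exp (\<epsilon> * t / m) * N t"]) (use dN dNpos that in \<open>force intro!: exI\<close>)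
  have J: "\<epsilon> * m * \<gamma> t\<^sub>0 - Gamma_prim \<gamma> t\<^sub>0 = ((\<gamma> t\<^sub>0)\<^sup>2 - D\<gamma> 1 t\<^sub>0 * Gamma_prim \<gamma> t\<^sub>0) / D\<gamma> 1 t\<^sub>0"
    using m_\<sigma>(1) slope by (simp add: \<epsilon>_def field_simps power2_eq_square)
  consider "\<epsilon> = 1" "D\<gamma> 1 t\<^sub>0 > 0" | "\<epsilon> = -1" "D\<gamma> 1 t\<^sub>0 < 0" using \<sigma>_cases \<epsilon>_def by metis
  then show ?thesis
  proof cases
    case 1
    \<comment> \<open>At the pole \<open>\<gamma>\<close> vanishes, so the value compared with is
      \<open>- Gamma_prim \<gamma> 0 = 1\<close>, positive like the slope.\<close>
    have "\<epsilon> * m * \<gamma> 0 - Gamma_prim \<gamma> 0 < \<epsilon> * m * \<gamma> t\<^sub>0 - Gamma_prim \<gamma> t\<^sub>0"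
    proof (rule DERIV_pos_imp_increasing_open[where f = "\<lambda>t. \<epsilon> * m * \<gamma> t - Gamma_prim \<gamma> t"])
      fix s assume s: "0 < s" "s < t\<^sub>0"
      have "N s > 0" using mono[of s t\<^sub>0] s t\<^sub>0 N0 1 by (simp add: zero_less_mult_iff mult_less_0_iff)
      then show "\<exists>y. ((\<lambda>t. \<epsilon> * m * \<gamma> t - Gamma_prim \<gamma> t) has_real_derivative y) (at s) \<and> 0 < y"
        using dJ[of s] s t\<^sub>0 by auto
    qed (use t\<^sub>0 in \<open>auto intro: continuous_on_subset[OF cJ]\<close>)
    then have "((\<gamma> t\<^sub>0)\<^sup>2 - D\<gamma> 1 t\<^sub>0 * Gamma_prim \<gamma> t\<^sub>0) / D\<gamma> 1 t\<^sub>0 > 0"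
      using J Gamma_0 by simp
    then show ?thesis using 1 by (simp add: zero_less_divide_iff)
  next
    case 2
    \<comment> \<open>The comparison now runs to the other pole, where the value is
      \<open>- Gamma_prim \<gamma> l = -1\<close>, negative like the slope.\<close>
    have "\<epsilon> * m * \<gamma> t\<^sub>0 - Gamma_prim \<gamma> t\<^sub>0 < \<epsilon> * m * \<gamma> l - Gamma_prim \<gamma> l"
    proof (rule DERIV_pos_imp_increasing_open[where f = "\<lambda>t. \<epsilon> * m * \<gamma> t - Gamma_prim \<gamma> t"])
      fix s assume s: "t\<^sub>0 < s" "s < l"
      have "N s > 0" using mono[of t\<^sub>0 s] s t\<^sub>0 N0 2 by (simp add: zero_less_mult_iff)
      then show "\<exists>y. ((\<lambda>t. \<epsilon> * m * \<gamma> t - Gamma_prim \<gamma> t) has_real_derivative y) (at s) \<and> 0 < y"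
        using dJ[of s] s t\<^sub>0 by auto
    qed (use t\<^sub>0 in \<open>auto intro: continuous_on_subset[OF cJ]\<close>)
    then have "((\<gamma> t\<^sub>0)\<^sup>2 - D\<gamma> 1 t\<^sub>0 * Gamma_prim \<gamma> t\<^sub>0) / D\<gamma> 1 t\<^sub>0 < 0"
      using J Gamma_l by simp
    then show ?thesis using 2 by (simp add: divide_less_0_iff)
  qed
qed

lemma I_fun_lat: "I_fun \<gamma> m (lat \<theta>) = ((\<gamma> t\<^sub>0)\<^sup>2 - D\<gamma> 1 t\<^sub>0 * Gamma_prim \<gamma> t\<^sub>0) / D\<gamma> 1 t\<^sub>0"
proof -
  let ?f = "\<lambda>(t, \<phi>, \<theta>). m * \<gamma> t * sin \<phi> - Gamma_prim \<gamma> t"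
  have "lat \<theta> = {(t, \<phi>, \<theta>'). t = t\<^sub>0 \<and> cis \<phi> = cis \<phi>\<^sub>0 \<and> cis \<theta>' = cis \<theta>}"
    using t\<^sub>0 by (auto simp: lat_def pt_def same_vector_def)
  then have ne: "(t\<^sub>0, \<phi>\<^sub>0, \<theta>) \<in> lat \<theta>" and c: "\<And>x. x \<in> lat \<theta> \<Longrightarrow> ?f x = m * \<gamma> t\<^sub>0 * \<sigma> - Gamma_prim \<gamma> t\<^sub>0"
    using sin_cos_\<phi>\<^sub>0(1) by (auto simp: complex_eq_iff)
  have "f ` A = {v}" if "y \<in> A" "\<And>x. x \<in> A \<Longrightarrow> f x = v" for f :: "coords \<Rightarrow> real" and A y v
    using that by blast
  from this[OF ne c] have "?f ` lat \<theta> = {m * \<gamma> t\<^sub>0 * \<sigma> - Gamma_prim \<gamma> t\<^sub>0}" .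
  then show ?thesis
    using m_\<sigma>(1) slope by (simp add: I_fun_def on_SS_def field_simps power2_eq_square)
qed

end

section \<open>The orbit measure and its action\<close>

lemma openin_SS_top: "openin (SS_top l) U \<longleftrightarrow> SS_open l U"
  by (simp add: SS_top_def topology_inverse'[OF istopology_SS_open])

lemma topspace_SS_top: "topspace (SS_top l) = SS l"
proof -
  have "{x \<in> polar_box l. pt l x \<in> SS l} = polar_box l" using pt_in_SS by auto
  then have "SS_open l (SS l)" by (simp add: SS_open_def)
  then show ?thesis unfolding topspace_def openin_SS_top by (auto simp: SS_open_def)
qed

lemma space_SS_borel: "space (SS_borel l) = SS l"
  and sets_SS_borel: "sets (SS_borel l) = sigma_sets (SS l) {U. openin (SS_top l) U}"
  unfolding SS_borel_def using openin_subset[of "SS_top l"]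
  by (subst space_measure_of sets_measure_of; auto simp: topspace_SS_top)+

lemma openin_sets_SS_borel: "openin (SS_top l) U \<Longrightarrow> U \<in> sets (SS_borel l)"
  by (auto simp: sets_SS_borel)

lemma measurable_SS_borel:
  assumes "\<And>U. openin (SS_top l) U \<Longrightarrow> f -` U \<inter> space M \<in> sets M" "f \<in> space M \<rightarrow> SS l"
  shows "f \<in> measurable M (SS_borel l)"
  unfolding SS_borel_def
  by (rule measurable_measure_of) (use assms openin_subset[of "SS_top l"] in \<open>auto simp: topspace_SS_top\<close>)

lemma measurable_SS_continuous_map:
  assumes "continuous_map (SS_top l) (SS_top l) f"
  shows "f \<in> measurable (SS_borel l) (SS_borel l)"
proof (rule measurable_SS_borel)
  show "f -` U \<inter> space (SS_borel l) \<in> sets (SS_borel l)" if "openin (SS_top l) U" for U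
    using openin_continuous_map_preimage[OF assms that]
    by (intro openin_sets_SS_borel) (simp add: space_SS_borel topspace_SS_top vimage_def Int_def conj_commute)
qed (use assms in \<open>auto simp: continuous_map_def space_SS_borel topspace_SS_top\<close>)

lemma openin_SS_Collect:
  assumes "openin (top_of_set (polar_box l)) {x \<in> polar_box l. P (pt l x)}"
  shows "openin (SS_top l) {p \<in> SS l. P p}"
proof -
  have "{x \<in> polar_box l. pt l x \<in> {p \<in> SS l. P p}} = {x \<in> polar_box l. P (pt l x)}" using pt_in_SS by auto
  then show ?thesis using assms by (simp add: openin_SS_top SS_open_def)
qed

lemma sets_SS_Collect_closedin:
  assumes "closedin (top_of_set (polar_box l)) {x \<in> polar_box l. P (pt l x)}"
  shows "{p \<in> SS l. P p} \<in> sets (SS_borel l)"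
proof -
  have "polar_box l - {x \<in> polar_box l. P (pt l x)} = {x \<in> polar_box l. \<not> P (pt l x)}" by auto
  then have "openin (SS_top l) {p \<in> SS l. \<not> P p}"
    using assms by (intro openin_SS_Collect) (simp add: closedin_def)
  then have "SS l - {p \<in> SS l. \<not> P p} \<in> sets (SS_borel l)"
    using sets.compl_sets[OF openin_sets_SS_borel] by (metis space_SS_borel)
  moreover have "SS l - {p \<in> SS l. \<not> P p} = {p \<in> SS l. P p}" by auto
  ultimately show ?thesis by simp
qed

lemma fst_eq_of_pt_eq: "x \<in> polar_box l \<Longrightarrow> y \<in> polar_box l \<Longrightarrow> pt l x = pt l y \<Longrightarrow> fst x = fst y"
  by (auto simp: pt_eq_iff same_vector_def)

definition polar_height :: "real \<Rightarrow> upoint \<Rightarrow> real" where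
  "polar_height l p = fst (SOME x. x \<in> polar_box l \<and> p = pt l x)"

lemma polar_height_pt: "x \<in> polar_box l \<Longrightarrow> polar_height l (pt l x) = fst x"
  unfolding polar_height_def using someI[of "\<lambda>y. y \<in> polar_box l \<and> pt l x = pt l y" x] fst_eq_of_pt_eq by metis

text \<open>The interior and the two polar fibres are Borel, so continuity on each piece is enough.
  Each piece can thus be treated in the coordinates suited to it.\<close>

lemma borel_measurable_SS:
  assumes int: "continuous_on (polar_interior l) (\<lambda>x. f (pt l x))"
    and 0: "continuous_on ({0} \<times> UNIV \<times> UNIV) (\<lambda>x. f (pt l x))"
    and l: "continuous_on ({l} \<times> UNIV \<times> UNIV) (\<lambda>x. f (pt l x))" and "0 < l"
  shows "f \<in> borel_measurable (SS_borel l)"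
proof (rule borel_measurableI)
  fix S :: "'a set" assume S: "open S"
  let ?h = "polar_height l"
  \<comment> \<open>A polar fibre is closed but not open; a relatively open part of it is written as
    a difference of two closed sets.\<close>
  have fibre: "{p \<in> SS l. ?h p = a} - {p \<in> SS l. ?h p = a \<and> f p \<in> - S} \<in> sets (SS_borel l)"
    if a: "a \<in> {0..l}" and c: "continuous_on ({a} \<times> UNIV \<times> UNIV) (\<lambda>x. f (pt l x))" for a
  proof (intro sets.Diff sets_SS_Collect_closedin)
    have "{x \<in> polar_box l. ?h (pt l x) = a} = {a} \<times> UNIV \<times> UNIV"
      using a by (auto simp: polar_height_pt polar_box_def)
    then show "closedin (top_of_set (polar_box l)) {x \<in> polar_box l. ?h (pt l x) = a}"
      using a by (auto intro!: closed_subset closed_Times simp: polar_box_def)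
    have "{x \<in> polar_box l. ?h (pt l x) = a \<and> f (pt l x) \<in> - S} = ({a} \<times> UNIV \<times> UNIV) \<inter> (\<lambda>x. f (pt l x)) -` (- S)"
      using a by (auto simp: polar_height_pt polar_box_def)
    moreover have "closed (({a} \<times> UNIV \<times> UNIV) \<inter> (\<lambda>x. f (pt l x)) -` (- S))"
      by (intro continuous_closed_preimage c closed_Times) (use S in auto)
    ultimately show "closedin (top_of_set (polar_box l)) {x \<in> polar_box l. ?h (pt l x) = a \<and> f (pt l x) \<in> - S}"
      using a by (auto intro!: closed_subset simp: polar_box_def)
  qed
  have "{x \<in> polar_box l. ?h (pt l x) \<in> {0<..<l} \<and> f (pt l x) \<in> S} = polar_interior l \<inter> (\<lambda>x. f (pt l x)) -` S"
    by (auto simp: polar_height_pt polar_box_def polar_interior_def)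
  moreover have "open (polar_interior l \<inter> (\<lambda>x. f (pt l x)) -` S)"
    by (intro continuous_open_preimage int open_polar_interior S)
  ultimately have "{p \<in> SS l. ?h p \<in> {0<..<l} \<and> f p \<in> S} \<in> sets (SS_borel l)"
    using polar_interior_subset by (intro openin_sets_SS_borel openin_SS_Collect) (auto intro!: open_subset)
  moreover have "f -` S \<inter> space (SS_borel l) = {p \<in> SS l. ?h p \<in> {0<..<l} \<and> f p \<in> S} \<union>
      ({p \<in> SS l. ?h p = 0} - {p \<in> SS l. ?h p = 0 \<and> f p \<in> - S}) \<union>
      ({p \<in> SS l. ?h p = l} - {p \<in> SS l. ?h p = l \<and> f p \<in> - S})"
  proof -
    have "?h p = 0 \<or> ?h p = l \<or> ?h p \<in> {0<..<l}" if p: "p \<in> SS l" for p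
    proof -
      obtain x where "x \<in> polar_box l" "p = pt l x" using SS_E[OF p] by blast
      then show ?thesis by (auto simp: polar_height_pt polar_box_def)
    qed
    then show ?thesis by (auto simp: space_SS_borel)
  qed
  ultimately show "f -` S \<inter> space (SS_borel l) \<in> sets (SS_borel l)"
    using fibre[OF _ 0] fibre[OF _ l] \<open>0 < l\<close> by simp
qed

section \<open>Lebesgue measure of periodic sets and averages over an interval\<close>

lemma emeasure_lborel_shift:
  assumes "C \<in> sets borel"
  shows "emeasure lborel {r. r + c \<in> C} = emeasure lborel (C :: real set)"
proof -
  have "emeasure (distr lborel borel ((+) c)) C = emeasure lborel ((+) c -` C \<inter> space lborel)"
    by (rule emeasure_distr) (use assms in auto)
  then show ?thesis by (simp add: lborel_distr_plus vimage_def add.commute)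
qed

text \<open>Any window of length \<open>T\<close> sees the same amount of \<open>B\<close>:
  translations by whole periods reduce its start to \<open>{0..<T}\<close>, and the overhang is then
  moved back by one period.\<close>

lemma emeasure_periodic_shift:
  assumes B: "B \<in> sets borel" and T: "0 < T" and per: "\<And>x. x + T \<in> B \<longleftrightarrow> x \<in> B"
  shows "emeasure lborel ({0..T} \<inter> {r. r + s \<in> B}) = emeasure lborel ({0..T} \<inter> (B :: real set))"
proof -
  interpret periodic_fun_simple "\<lambda>x. x \<in> B" T by standard (simp add: per)
  define \<mu> where "\<mu> a = emeasure lborel ({a..<a+T} \<inter> B)" for a
  \<comment> \<open>Half-open windows can be cut and joined without overlap; the endpoint of the
    closed interval is null.\<close>
  have closed: "emeasure lborel ({0..T} \<inter> C) = emeasure lborel ({0..<T} \<inter> C)" if "C \<in> sets borel" for C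
  proof (rule emeasure_eq_AE)
    have "AE x in lborel. x \<noteq> T" by (rule AE_lborel_singleton)
    then show "AE x in lborel. x \<in> {0..T} \<inter> C \<longleftrightarrow> x \<in> {0..<T} \<inter> C" by eventually_elim auto
  qed (use that in auto)
  have shift_B: "{r. r + s \<in> B} \<in> sets borel" for s
    using measurable_sets[of "\<lambda>r. r + s" borel borel B] B by (simp add: vimage_def)
  have \<mu>_int: "\<mu> (a + of_int k * T) = \<mu> a" for a k
  proof -
    have "{r. r + of_int k * T \<in> {a + of_int k * T..<a + of_int k * T + T} \<inter> B} = {a..<a+T} \<inter> B"
      by (auto simp: plus_of_int)
    then show ?thesis
      using emeasure_lborel_shift[of "{a + of_int k * T..<a + of_int k * T + T} \<inter> B" "of_int k * T"] B by (simp add: \<mu>_def)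
  qed
  have \<mu>_b: "\<mu> b = \<mu> 0" if b: "0 \<le> b" "b < T" for b
  proof -
    have "{r. r + T \<in> {T..<b+T} \<inter> B} = {0..<b} \<inter> B" by (auto simp: per)
    then have 1: "emeasure lborel ({T..<b+T} \<inter> B) = emeasure lborel ({0..<b} \<inter> B)"
      using emeasure_lborel_shift[of "{T..<b+T} \<inter> B" T] B by simp
    have "\<mu> b = emeasure lborel (({b..<T} \<inter> B) \<union> ({T..<b+T} \<inter> B))"
      unfolding \<mu>_def by (rule arg_cong[of _ _ "emeasure lborel"]) (use b in auto)
    also have "\<dots> = emeasure lborel ({b..<T} \<inter> B) + emeasure lborel ({0..<b} \<inter> B)"
      unfolding 1[symmetric] by (rule plus_emeasure[symmetric]) (use B in auto)
    also have "\<dots> = emeasure lborel (({b..<T} \<inter> B) \<union> ({0..<b} \<inter> B))"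
      by (rule plus_emeasure) (use B in auto)
    also have "\<dots> = \<mu> 0"
      unfolding \<mu>_def by (rule arg_cong[of _ _ "emeasure lborel"]) (use b in auto)
    finally show ?thesis .
  qed
  have "\<mu> s = \<mu> (s - of_int \<lfloor>s / T\<rfloor> * T)"
    using \<mu>_int[of "s - of_int \<lfloor>s / T\<rfloor> * T" "\<lfloor>s / T\<rfloor>"] by simp
  also have "\<dots> = \<mu> 0"
    using T floor_divide_lower[of T s] floor_divide_upper[of T s] by (intro \<mu>_b) (auto simp: algebra_simps)
  finally have "\<mu> s = \<mu> 0" .
  have "{0..<T} \<inter> {r. r + s \<in> B} = {r. r + s \<in> {s..<s+T} \<inter> B}" by auto
  then have "emeasure lborel ({0..<T} \<inter> {r. r + s \<in> B}) = \<mu> s"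
    using emeasure_lborel_shift[of "{s..<s+T} \<inter> B" s] B by (simp add: \<mu>_def)
  then show ?thesis using \<open>\<mu> s = \<mu> 0\<close> closed[OF shift_B] closed[OF B] by (simp add: \<mu>_def)
qed

lemma integral_uniform_measure_Icc:
  fixes f :: "real \<Rightarrow> real"
  assumes "0 < T" "f \<in> borel_measurable borel" "continuous_on {0..T} f"
  shows "integral\<^sup>L (uniform_measure lborel {0..T}) f = integral {0..T} f / T"
proof -
  have "uniform_measure lborel {0..T} = density lborel (\<lambda>x. ennreal (indicator {0..T} x / T))"
    unfolding uniform_measure_def using assms(1)
    by (intro density_cong) (auto simp: divide_ennreal[symmetric] ennreal_indicator)
  then have "integral\<^sup>L (uniform_measure lborel {0..T}) f = (\<integral>x. (indicator {0..T} x / T) *\<^sub>R f x \<partial>lborel)"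
    using assms by (simp add: integral_density)
  also have "\<dots> = (\<integral>x. (indicator {0..T} x *\<^sub>R f x) / T \<partial>lborel)" by (simp add: field_simps)
  also have "\<dots> = (LINT x : {0..T} | lborel. f x) / T"
    by (simp add: set_lebesgue_integral_def)
  finally show ?thesis
    using set_borel_integral_eq_integral(2)[OF borel_integrable_atLeastAtMost'[OF assms(3)]] by simp
qed

section \<open>The integrand of the action and its measurability\<close>

context magnetic_primitive
begin

abbreviation \<iota> :: "upoint \<Rightarrow> real" where
  "\<iota> \<equiv> contraction l \<tau> (magnetic_field \<gamma> l m)"

text \<open>The description in \<open>contraction\<close> admits both charts and all lifts of the
  angles; compatibility of the charts and periodicity of \<open>\<tau>\<close> make all candidates
  equal.\<close>

lemma contraction_interior:
  assumes x: "x \<in> polar_interior l"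
  shows "\<iota> (pt l x) = pb Pole0 x (mfield m x)"
  unfolding contraction_def
proof (rule the_equality)
  show "\<exists>c. \<exists>w\<in>chart_dom l. chart_pt l c w = pt l x \<and> pb Pole0 x (mfield m x) = \<tau> c w (magnetic_field \<gamma> l m c w)"
    by (intro exI[of _ Pole0] bexI[of _ "polar l Pole0 x"] conjI chart_pt_polar polar_interior_subset polar_in_chart_dom x)
       (simp add: pb_def magnetic_field_eq[OF x])
  fix a assume "\<exists>c. \<exists>w\<in>chart_dom l. chart_pt l c w = pt l x \<and> a = \<tau> c w (magnetic_field \<gamma> l m c w)"
  then obtain c w where w: "w \<in> chart_dom l" "chart_pt l c w = pt l x" "a = \<tau> c w (magnetic_field \<gamma> l m c w)" by blast
  obtain y where y: "y \<in> polar_interior l" "polar l c y = w" "fst y = fst x"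
    "cis (fst (snd y)) = cis (fst (snd x))" "cis (snd (snd y)) = cis (snd (snd x))"
    using chart_pt_eq_interior[OF w(1) x w(2)] by metis
  have "a = pb c y (mfield m y)" using w(3) magnetic_field_eq[OF y(1), of m c] y(2) by (simp add: pb_def)
  also have "\<dots> = pb Pole0 y (mfield m y)" using pb_Pole1[OF y(1)] by (cases c) auto
  also have "\<dots> = pb Pole0 x (mfield m x)"
    using pb_cong[OF polar_in_chart_dom[OF y(1)] y(3-5)] mfield_cong[OF y(3,4)] by simp
  finally show "a = pb Pole0 x (mfield m x)" .
qed

lemma contraction_pole:
  assumes x: "x \<in> polar_box l" "polar l c x = (0, \<psi>)"
  shows "\<iota> (pt l x) = \<tau> c (0, \<psi>) (of_real m * cis \<psi>, case c of Pole0 \<Rightarrow> 1 | Pole1 \<Rightarrow> -1)"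
  unfolding contraction_def
proof (rule the_equality)
  have dom: "(0, \<psi>) \<in> chart_dom l" using l_pos by (simp add: chart_dom_def)
  show "\<exists>c'. \<exists>w\<in>chart_dom l. chart_pt l c' w = pt l x \<and>
      \<tau> c (0, \<psi>) (of_real m * cis \<psi>, case c of Pole0 \<Rightarrow> 1 | Pole1 \<Rightarrow> -1) = \<tau> c' w (magnetic_field \<gamma> l m c' w)"
    using chart_pt_polar[OF x(1), of c] dom x(2)
    by (intro exI[of _ c] bexI[of _ "(0, \<psi>)"]) (auto simp: magnetic_field_def)
  fix a assume "\<exists>c'. \<exists>w\<in>chart_dom l. chart_pt l c' w = pt l x \<and> a = \<tau> c' w (magnetic_field \<gamma> l m c' w)"
  then obtain c' w where w: "w \<in> chart_dom l" "chart_pt l c' w = pt l x" "a = \<tau> c' w (magnetic_field \<gamma> l m c' w)" by blast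
  obtain y where y: "y \<in> polar_box l" "polar l c' y = w" using polar_surj[OF w(1)] by metis
  have "pt l y = pt l x" using chart_pt_polar[OF y(1), of c'] y(2) w by auto
  then have yx: "(x, y) \<in> same_vector l" using pt_eq_iff[OF x(1) y(1)] by simp
  \<comment> \<open>A vector over a pole is visible only in the chart of that pole, since in the
    other chart the pole would have radius \<open>l\<close>, outside the disc.\<close>
  have "c' = c \<and> fst w = 0 \<and> cis (snd w) = cis \<psi>"
    using yx x y w(1) l_pos
    by (cases c; cases c'; cases x; cases y) (auto simp: same_vector_def chart_dom_def norm_mult split: if_splits)
  then obtain \<psi>' where w': "c' = c" "w = (0, \<psi>')" "cis \<psi>' = cis \<psi>" by (cases w) auto
  then have "\<tau> c (0, \<psi>') = \<tau> c (0, \<psi>)" using l_pos by (intro \<tau>_cis_cong) auto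
  then show "a = \<tau> c (0, \<psi>) (of_real m * cis \<psi>, case c of Pole0 \<Rightarrow> 1 | Pole1 \<Rightarrow> -1)"
    using w(3) w' by (simp add: magnetic_field_def)
qed

lemma continuous_on_contraction_pole:
  assumes "S \<subseteq> polar_box l" "\<And>x. x \<in> S \<Longrightarrow> fst (polar l c x) = 0"
  shows "continuous_on S (\<lambda>x. \<iota> (pt l x))"
proof -
  define \<psi> where "\<psi> x = snd (polar l c x)" for x
  define \<epsilon> :: real where "\<epsilon> = (case c of Pole0 \<Rightarrow> 1 | Pole1 \<Rightarrow> -1)"
  have \<psi>: "continuous_on S \<psi>" unfolding \<psi>_def by (intro continuous_intros continuous_on_polar)
  have dom: "(0, a) \<in> chart_dom l" for a using l_pos by (simp add: chart_dom_def)
  have \<tau>: "continuous_on S (\<lambda>x. \<tau> c (0, \<psi> x) v)" for v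
    using dom by (intro continuous_on_compose2[OF Ck_on_imp_continuous_on[OF Ck_\<tau>]] continuous_intros \<psi>) auto
  have "continuous_on S (\<lambda>x. Re (of_real m * cis (\<psi> x)) * \<tau> c (0, \<psi> x) (1, 0)
      + Im (of_real m * cis (\<psi> x)) * \<tau> c (0, \<psi> x) (\<i>, 0) + \<epsilon> * \<tau> c (0, \<psi> x) (0, 1))"
    by (intro continuous_intros \<tau> \<psi>)
  then show ?thesis
  proof (rule continuous_on_eq)
    fix x assume "x \<in> S"
    then have "\<iota> (pt l x) = \<tau> c (0, \<psi> x) (of_real m * cis (\<psi> x), \<epsilon>)"
      using assms by (subst contraction_pole[of x c "\<psi> x"]) (auto simp: \<psi>_def \<epsilon>_def prod_eq_iff)
    then show "Re (of_real m * cis (\<psi> x)) * \<tau> c (0, \<psi> x) (1, 0)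
      + Im (of_real m * cis (\<psi> x)) * \<tau> c (0, \<psi> x) (\<i>, 0) + \<epsilon> * \<tau> c (0, \<psi> x) (0, 1) = \<iota> (pt l x)"
      using linear_components[OF linear_\<tau>[OF dom[of "\<psi> x"]], of c "(of_real m * cis (\<psi> x), \<epsilon>)"] by simp
  qed
qed

lemma linear_pb: "x \<in> polar_interior l \<Longrightarrow> linear (pb Pole0 x)"
  unfolding pb_def
  using linear_compose[OF linear_polar_D linear_\<tau>[OF polar_in_chart_dom]] by (auto simp: o_def)

lemma borel_measurable_contraction: "\<iota> \<in> borel_measurable (SS_borel l)"
proof (rule borel_measurable_SS[OF _ _ _ l_pos])
  show "continuous_on ({0} \<times> UNIV \<times> UNIV) (\<lambda>x. \<iota> (pt l x))"
    by (rule continuous_on_contraction_pole[where c = Pole0]) (use l_pos in \<open>auto simp: polar_box_def\<close>)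
  show "continuous_on ({l} \<times> UNIV \<times> UNIV) (\<lambda>x. \<iota> (pt l x))"
    by (rule continuous_on_contraction_pole[where c = Pole1]) (use l_pos in \<open>auto simp: polar_box_def\<close>)
  let ?S = "polar_interior l"
  have D: "continuous_on ?S (\<lambda>x. D\<gamma> k (fst x))" for k
    by (rule continuous_on_compose2[OF continuous_on_D\<gamma>]) (auto simp: polar_interior_def intro!: continuous_intros)
  have pb: "continuous_on ?S (\<lambda>x. pb Pole0 x v)" for v
    by (rule continuous_on_pb[OF polar_in_chart_dom])
  have "continuous_on ?S (\<lambda>x. m * cos (fst (snd x)) * pb Pole0 x (1, 0, 0)
      + (1 - m * D\<gamma> 1 (fst x) / \<gamma> (fst x) * sin (fst (snd x))) * pb Pole0 x (0, 1, 0)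
      + (m * sin (fst (snd x)) / \<gamma> (fst x)) * pb Pole0 x (0, 0, 1))"
    using D[of 0] D[of 1] \<gamma>_pos by (intro continuous_intros pb) (auto simp: polar_interior_def less_imp_neq[symmetric])
  then show "continuous_on ?S (\<lambda>x. \<iota> (pt l x))"
  proof (rule continuous_on_eq)
    fix x assume x: "x \<in> ?S"
    obtain a b d where abd: "mfield m x = (a, b, d)" by (cases "mfield m x") auto
    have "mfield m x = a *\<^sub>R (1, 0, 0) + b *\<^sub>R (0, 1, 0) + d *\<^sub>R (0, 0, 1)" by (simp add: abd)
    then have "\<iota> (pt l x) = a * pb Pole0 x (1, 0, 0) + b * pb Pole0 x (0, 1, 0) + d * pb Pole0 x (0, 0, 1)"
      unfolding contraction_interior[OF x]
      by (simp add: linear_add[OF linear_pb[OF x]] linear_scale[OF linear_pb[OF x]] del: scaleR_Pair)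
    moreover have "a = m * cos (fst (snd x))" "b = 1 - m * D\<gamma> 1 (fst x) / \<gamma> (fst x) * sin (fst (snd x))"
      "d = m * sin (fst (snd x)) / \<gamma> (fst x)"
      using abd by (auto simp: mfield_def case_prod_unfold)
    ultimately show "m * cos (fst (snd x)) * pb Pole0 x (1, 0, 0)
      + (1 - m * D\<gamma> 1 (fst x) / \<gamma> (fst x) * sin (fst (snd x))) * pb Pole0 x (0, 1, 0)
      + (m * sin (fst (snd x)) / \<gamma> (fst x)) * pb Pole0 x (0, 0, 1) = \<iota> (pt l x)" by simp
  qed
qed

end

section \<open>The measure carried by the orbit, its support and its action\<close>

context magnetic_latitude
begin

lemma open_lat_vimage:
  assumes "openin (SS_top l) U"
  shows "open {s. lat (a + k * s) \<in> U}"
proof -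
  obtain W where W: "open W" "{x \<in> polar_box l. pt l x \<in> U} = polar_box l \<inter> W"
    using assms by (auto simp: openin_SS_top SS_open_def openin_open)
  have "{s. lat (a + k * s) \<in> U} = (\<lambda>s. (t\<^sub>0, \<phi>\<^sub>0, a + k * s)) -` W"
    using W(2) polar_interior_subset[OF lat_interior] by (auto simp: lat_def)
  then show ?thesis by (simp add: W(1) open_vimage continuous_intros)
qed

lemma lat_in_SS: "lat \<theta> \<in> SS l"
  unfolding lat_def by (rule pt_in_SS[OF polar_interior_subset[OF lat_interior]])

lemma measurable_lat: "(\<lambda>s. lat (a + k * s)) \<in> measurable borel (SS_borel l)"
  by (rule measurable_SS_borel) (use open_lat_vimage lat_in_SS in \<open>auto simp: vimage_def\<close>)

text \<open>The latitude is described by \<open>t\<close> and \<open>cis \<phi>\<close>, which are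
  continuous in the coordinates; the ambiguity of \<open>\<phi>\<close> over the poles is harmless
  because \<open>t\<close> already differs there.\<close>

lemma openin_complement_lat: "openin (SS_top l) {p \<in> SS l. p \<notin> range lat}"
proof (rule openin_SS_Collect)
  have "pt l x \<notin> range lat \<longleftrightarrow> (fst x, cis (fst (snd x))) \<noteq> (t\<^sub>0, cis \<phi>\<^sub>0)" if "x \<in> polar_box l" for x
    using that lat_eq_pt_iff[of "fst x" _ "fst (snd x)" "snd (snd x)"]
    by (force simp: polar_box_def)
  then have "{x \<in> polar_box l. pt l x \<notin> range lat} =
      polar_box l \<inter> (\<lambda>x. (fst x, cis (fst (snd x)))) -` (- {(t\<^sub>0, cis \<phi>\<^sub>0)})" by auto
  also have "openin (top_of_set (polar_box l)) \<dots>"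
    by (intro continuous_openin_preimage_gen continuous_intros)
  finally show "openin (top_of_set (polar_box l)) {x \<in> polar_box l. pt l x \<notin> range lat}" .
qed

context
  fixes u :: "real \<Rightarrow> upoint" and T :: real
  assumes orbit: "periodic_orbit l Y u T" and range_u: "range u = range lat"
begin

lemma T_pos: "T > 0" and u_periodic: "u (s + T) = u s" and u_curve: "integral_curve l Y u"
  using orbit by (auto simp: periodic_orbit_def)

definition \<theta>\<^sub>u :: real where "\<theta>\<^sub>u = (SOME \<theta>. u 0 = lat \<theta>)"

text \<open>The given orbit is the explicit rotation up to a phase, whatever period it comes
  with.\<close>

lemma u_eq: "u s = lat (\<theta>\<^sub>u + \<kappa> * s)"
proof -
  have "\<exists>\<theta>. u 0 = lat \<theta>" using range_u by blast
  then have "u 0 = lat \<theta>\<^sub>u" unfolding \<theta>\<^sub>u_def by (rule someI_ex)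
  then show ?thesis using uniqueness[OF u_curve] by blast
qed

lemma measurable_u: "u \<in> measurable (uniform_measure lborel {0..T}) (SS_borel l)"
proof -
  have u: "u = (\<lambda>s. lat (\<theta>\<^sub>u + \<kappa> * s))" by (rule ext) (rule u_eq)
  show ?thesis by (subst u) (simp add: measurable_lat cong: measurable_cong_sets)
qed

lemma sets_orbit_measure: "sets (orbit_measure l u T) = sets (SS_borel l)"
  by (simp add: orbit_measure_def)

lemma emeasure_orbit_measure:
  assumes "A \<in> sets (SS_borel l)"
  shows "u -` A \<in> sets borel" 
    "emeasure (orbit_measure l u T) A = emeasure lborel ({0..T} \<inter> u -` A) / emeasure lborel {0..T}"
proof -
  show *: "u -` A \<in> sets borel" using measurable_sets[OF measurable_u assms] by simp
  show "emeasure (orbit_measure l u T) A = emeasure lborel ({0..T} \<inter> u -` A) / emeasure lborel {0..T}"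
    using * assms by (simp add: orbit_measure_def emeasure_distr[OF measurable_u])
qed

lemma invariant_prob_orbit_measure: "invariant_prob l Y (orbit_measure l u T)"
  unfolding invariant_prob_def
proof (intro conjI allI impI sets_orbit_measure)
  have "prob_space (uniform_measure lborel {0..T})"
    by (rule prob_space_uniform_measure) (use T_pos in auto)
  then show "prob_space (orbit_measure l u T)"
    unfolding orbit_measure_def by (rule prob_space.prob_space_distr[OF _ measurable_u])
  fix \<Phi> s assume \<Phi>: "flow_of l Y \<Phi>"
  \<comment> \<open>Uniqueness is applied to the trajectory of \<open>u r\<close>, with phase
    \<open>\<theta>\<^sub>u + \<kappa> * r\<close>: on the orbit every flow is the shift of the
    parameter.\<close>
  have flow: "\<Phi> s (u r) = u (r + s)" for r
  proof -
    have p: "integral_curve l Y (\<lambda>s. \<Phi> s (u r))" "\<Phi> 0 (u r) = lat (\<theta>\<^sub>u + \<kappa> * r)"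
      using \<Phi> lat_in_SS by (auto simp: flow_of_def u_eq)
    show ?thesis using uniqueness[OF p(1), of "\<theta>\<^sub>u + \<kappa> * r" s] p(2) by (simp add: u_eq algebra_simps)
  qed
  have m: "\<Phi> s \<in> measurable (SS_borel l) (SS_borel l)"
    using \<Phi> by (intro measurable_SS_continuous_map) (simp add: flow_of_def)
  have m': "\<Phi> s \<in> measurable (orbit_measure l u T) (SS_borel l)"
    using m by (simp add: sets_orbit_measure cong: measurable_cong_sets)
  show "distr (orbit_measure l u T) (SS_borel l) (\<Phi> s) = orbit_measure l u T"
  proof (rule measure_eqI)
    fix A assume "A \<in> sets (distr (orbit_measure l u T) (SS_borel l) (\<Phi> s))"
    then have A: "A \<in> sets (SS_borel l)" by simp
    define A' where "A' = \<Phi> s -` A \<inter> SS l"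
    have A': "A' \<in> sets (SS_borel l)" using measurable_sets[OF m A] by (simp add: A'_def space_SS_borel)
    have "u -` A' = {r. r + s \<in> u -` A}"
      using lat_in_SS by (auto simp: A'_def flow) (simp add: u_eq)
    have "emeasure (distr (orbit_measure l u T) (SS_borel l) (\<Phi> s)) A = emeasure (orbit_measure l u T) A'"
      using emeasure_distr[OF m' A] by (simp add: A'_def orbit_measure_def space_SS_borel)
    also have "\<dots> = emeasure lborel ({0..T} \<inter> {r. r + s \<in> u -` A}) / emeasure lborel {0..T}"
      using emeasure_orbit_measure(2)[OF A'] \<open>u -` A' = _\<close> by simp
    also have "\<dots> = emeasure lborel ({0..T} \<inter> u -` A) / emeasure lborel {0..T}"
      using emeasure_periodic_shift[OF emeasure_orbit_measure(1)[OF A] T_pos] u_periodic by simp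
    also have "\<dots> = emeasure (orbit_measure l u T) A"
      using emeasure_orbit_measure(2)[OF A] by simp
    finally show "emeasure (distr (orbit_measure l u T) (SS_borel l) (\<Phi> s)) A = emeasure (orbit_measure l u T) A" .
  qed (simp add: sets_orbit_measure)
qed

lemma measure_support_orbit_measure: "measure_support l (orbit_measure l u T) = range lat"
proof (intro set_eqI iffI)
  fix p assume p: "p \<in> measure_support l (orbit_measure l u T)"
  show "p \<in> range lat"
  proof (rule ccontr)
    assume n: "p \<notin> range lat"
    let ?U = "{p \<in> SS l. p \<notin> range lat}"
    have "emeasure (orbit_measure l u T) ?U > 0"
      using p n openin_complement_lat unfolding measure_support_def by blast
    moreover have "u -` ?U = {}" by (auto simp: u_eq)
    ultimately show False
      unfolding emeasure_orbit_measure(2)[OF openin_sets_SS_borel[OF openin_complement_lat]] by (simp only: Int_empty_right) simp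
  qed
next
  fix p assume "p \<in> range lat"
  then obtain r where r: "p = u r" using range_u by blast
  interpret periodic_fun_simple u T by standard (rule u_periodic)
  define r0 where "r0 = r - of_int \<lfloor>r / T\<rfloor> * T"
  have r0: "0 \<le> r0" "r0 < T" "u r0 = p"
    using T_pos floor_divide_lower[of T r] floor_divide_upper[of T r] plus_of_int[of r0 "\<lfloor>r / T\<rfloor>"] r
    by (auto simp: r0_def algebra_simps)
  have "emeasure (orbit_measure l u T) U > 0" if U: "openin (SS_top l) U" "p \<in> U" for U
  proof -
    have "u -` U = {s. lat (\<theta>\<^sub>u + \<kappa> * s) \<in> U}" by (auto simp: u_eq)
    then have "open (u -` U)" using open_lat_vimage[OF U(1)] by simp
    moreover have "r0 \<in> u -` U" using r0(3) U(2) by simp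
    ultimately obtain e where e: "e > 0" "ball r0 e \<subseteq> u -` U" by (rule openE)
    \<comment> \<open>As \<open>r0 < T\<close>, a short interval to the right of \<open>r0\<close>
      has positive length and stays in \<open>{0..T}\<close>.\<close>
    define r1 where "r1 = min T (r0 + e)"
    have "{r0..<r1} \<subseteq> {0..T} \<inter> u -` U" using e(2) r0 by (auto simp: r1_def dist_real_def)
    then have "emeasure lborel {r0..<r1} \<le> emeasure lborel ({0..T} \<inter> u -` U)"
      using emeasure_orbit_measure(1)[OF openin_sets_SS_borel[OF U(1)]] by (intro emeasure_mono) auto
    moreover have "emeasure lborel {r0..<r1} > 0" using r0 e by (simp add: r1_def)
    ultimately show ?thesis
      using T_pos by (simp add: emeasure_orbit_measure(2)[OF openin_sets_SS_borel[OF U(1)]] ennreal_zero_less_divide)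
  qed
  then show "p \<in> measure_support l (orbit_measure l u T)"
    using r lat_in_SS by (auto simp: measure_support_def u_eq)
qed

lemma action_orbit_measure:
  "action \<gamma> l m (orbit_measure l u T) = ((\<gamma> t\<^sub>0)\<^sup>2 - D\<gamma> 1 t\<^sub>0 * Gamma_prim \<gamma> t\<^sub>0) / (D\<gamma> 1 t\<^sub>0)\<^sup>2"
proof -
  define \<tau> where "\<tau> = (SOME \<tau>. primitive_of_omega \<gamma> l m \<tau>)"
  have "primitive_of_omega \<gamma> l m \<tau>" unfolding \<tau>_def using primitive_exists by (rule someI_ex)
  then interpret P: magnetic_primitive \<gamma> l \<tau> m by unfold_locales
  define b where "b \<theta> = P.pb Pole0 (t\<^sub>0, \<phi>\<^sub>0, \<theta>) (0, 0, 1)" for \<theta>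
  have cb: "continuous_on UNIV b"
    unfolding b_def
    by (intro continuous_on_compose2[OF P.continuous_on_pb[OF polar_in_chart_dom]] continuous_intros)
       (use lat_interior in auto)
  have b_per: "b (\<theta> + 2 * pi) = b \<theta>" for \<theta>
    unfolding b_def by (intro fun_cong[OF P.pb_cong] polar_in_chart_dom lat_interior) (auto simp flip: cis_mult)
  obtain F where F: "\<And>x. (F has_real_derivative b x) (at x)" using continuous_antiderivative[OF cb] by metis
  define A where "A = 2 * pi * (m * \<gamma> t\<^sub>0 * \<sigma> - Gamma_prim \<gamma> t\<^sub>0)"
  have "integral {0..2*pi} b = A"
    using P.latitude_integral_eq[OF t\<^sub>0, of \<phi>\<^sub>0] by (simp add: P.latitude_integral_def b_def[abs_def] A_def)
  then have FA: "F (x + 2 * pi) - F x = A" for x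
    using integral_unique[OF integral_by_antiderivative[OF F, of 1 0 "2 * pi" 0]] antiderivative_period[OF F b_per, of x] by simp
  \<comment> \<open>\<open>F\<close> gains \<open>A\<close> with every turn, so removing the linear
    growth leaves a periodic function. This evaluates \<open>F\<close> over any number of turns at
    once, in either direction.\<close>
  define G where "G x = F x - A * x / (2 * pi)" for x
  have "G (x + 2 * pi) = G x" for x using FA[of x] by (simp add: G_def field_simps)
  moreover have "cis (\<theta>\<^sub>u + \<kappa> * T) = cis \<theta>\<^sub>u" using u_periodic[of 0] by (simp add: u_eq lat_eq_iff)
  ultimately have "G (\<theta>\<^sub>u + \<kappa> * T) = G \<theta>\<^sub>u" by (rule periodic_cis)
  then have FT: "F (\<theta>\<^sub>u + \<kappa> * T) - F \<theta>\<^sub>u = A * (\<kappa> * T) / (2 * pi)" by (simp add: G_def field_simps)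
  have \<kappa>: "\<kappa> \<noteq> 0" using slope by (simp add: \<kappa>_def)
  have \<iota>: "P.\<iota> (u s) = \<kappa> * b (\<theta>\<^sub>u + \<kappa> * s)" for s
  proof -
    let ?x = "(t\<^sub>0, \<phi>\<^sub>0, \<theta>\<^sub>u + \<kappa> * s)"
    have "P.\<iota> (u s) = P.\<iota> (pt l ?x)" by (simp only: u_eq[of s] lat_def)
    also have "\<dots> = P.pb Pole0 ?x (mfield m ?x)" by (rule P.contraction_interior[OF lat_interior])
    also have "mfield m ?x = \<kappa> *\<^sub>R (0, 0, 1)" by (simp add: mfield_lat)
    also have "P.pb Pole0 ?x \<dots> = \<kappa> *\<^sub>R P.pb Pole0 ?x (0, 0, 1)"
      by (rule linear_scale[OF P.linear_pb[OF lat_interior]])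
    finally show ?thesis by (simp add: b_def)
  qed
  have cb': "continuous_on S (\<lambda>s. \<kappa> * b (\<theta>\<^sub>u + \<kappa> * s))" for S
    by (intro continuous_intros continuous_on_compose2[OF cb]) auto
  have "action \<gamma> l m (orbit_measure l u T) = (\<integral>p. P.\<iota> p \<partial>orbit_measure l u T)"
    by (simp add: action_def \<tau>_def)
  also have "\<dots> = (\<integral>s. P.\<iota> (u s) \<partial>uniform_measure lborel {0..T})"
    unfolding orbit_measure_def by (rule integral_distr[OF measurable_u P.borel_measurable_contraction])
  also have "\<dots> = integral {0..T} (\<lambda>s. \<kappa> * b (\<theta>\<^sub>u + \<kappa> * s)) / T"
    unfolding \<iota> by (rule integral_uniform_measure_Icc[OF T_pos borel_measurable_continuous_onI[OF cb'] cb'])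
  also have "integral {0..T} (\<lambda>s. \<kappa> * b (\<theta>\<^sub>u + \<kappa> * s)) = F (\<theta>\<^sub>u + \<kappa> * T) - F \<theta>\<^sub>u"
    using integral_unique[OF integral_by_antiderivative[OF F \<kappa>, of 0 T \<theta>\<^sub>u]] \<kappa> T_pos by simp
  also have "\<dots> / T = \<kappa> * (m * \<gamma> t\<^sub>0 * \<sigma> - Gamma_prim \<gamma> t\<^sub>0)"
    unfolding FT using T_pos by (simp add: A_def)
  also have "\<dots> = ((\<gamma> t\<^sub>0)\<^sup>2 - D\<gamma> 1 t\<^sub>0 * Gamma_prim \<gamma> t\<^sub>0) / (D\<gamma> 1 t\<^sub>0)\<^sup>2"
  proof -
    have "m * \<gamma> t\<^sub>0 * \<sigma> = \<gamma> t\<^sub>0 * (\<gamma> t\<^sub>0 / D\<gamma> 1 t\<^sub>0)" using m_\<sigma>(1) by (metis mult.assoc mult.commute)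
    then show ?thesis using slope by (simp add: \<kappa>_def field_simps power2_eq_square)
  qed
  finally show ?thesis .
qed

end

end

theorem proposition4p7:
  fixes \<gamma> :: "real \<Rightarrow> real" and l t\<^sub>0 m :: real and L :: "upoint set"
  assumes "normalized_profile \<gamma> l"
    and "t\<^sub>0 \<in> {0<..<l}"
    and "nderiv {0..l} \<gamma> 1 t\<^sub>0 \<noteq> 0"
    and "m = \<bar>\<gamma> t\<^sub>0 / nderiv {0..l} \<gamma> 1 t\<^sub>0\<bar>"
    and "L = range (unit_tangent_lift \<gamma> l (latitude \<gamma> t\<^sub>0 (sgn (nderiv {0..l} \<gamma> 1 t\<^sub>0))))"
  shows "(\<exists>u T. periodic_orbit l (magnetic_field \<gamma> l m) u T \<and> range u = L) \<and>
    (\<forall>u T \<zeta>. periodic_orbit l (magnetic_field \<gamma> l m) u T \<and> range u = L \<and> \<zeta> = orbit_measure l u T \<longrightarrow>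
       invariant_prob l (magnetic_field \<gamma> l m) \<zeta> \<and>
       measure_support l \<zeta> = L \<and>
       action \<gamma> l m \<zeta> =
         ((\<gamma> t\<^sub>0)\<^sup>2 - nderiv {0..l} \<gamma> 1 t\<^sub>0 * Gamma_prim \<gamma> t\<^sub>0) / (nderiv {0..l} \<gamma> 1 t\<^sub>0)\<^sup>2 \<and>
       (\<forall>p\<in>measure_support l \<zeta>. I_fun \<gamma> m p = nderiv {0..l} \<gamma> 1 t\<^sub>0 * action \<gamma> l m \<zeta>) \<and>
       ((\<forall>t\<in>{0..l}. magnetic_curvature \<gamma> l m t > 0) \<longrightarrow> action \<gamma> l m \<zeta> > 0))"
proof -
  interpret magnetic_latitude \<gamma> l t\<^sub>0 m
    using assms by unfold_locales
  have L: "L = range lat"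
    using assms(5) range_unit_tangent_lift by (simp add: \<sigma>_def)
  show ?thesis
  proof (intro conjI allI impI)
    show "\<exists>u T. periodic_orbit l Y u T \<and> range u = L"
      using periodic_orbit_exists L by blast
    fix u T \<zeta> assume h: "periodic_orbit l Y u T \<and> range u = L \<and> \<zeta> = orbit_measure l u T"
    then have u: "periodic_orbit l Y u T" "range u = range lat" and \<zeta>: "\<zeta> = orbit_measure l u T"
      using L by auto
    show "invariant_prob l Y \<zeta>" unfolding \<zeta> by (rule invariant_prob_orbit_measure[OF u])
    show supp: "measure_support l \<zeta> = L" unfolding \<zeta> L by (rule measure_support_orbit_measure[OF u])
    show act: "action \<gamma> l m \<zeta> = ((\<gamma> t\<^sub>0)\<^sup>2 - D\<gamma> 1 t\<^sub>0 * Gamma_prim \<gamma> t\<^sub>0) / (D\<gamma> 1 t\<^sub>0)\<^sup>2"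
      unfolding \<zeta> by (rule action_orbit_measure[OF u])
    show "\<forall>p\<in>measure_support l \<zeta>. I_fun \<gamma> m p = D\<gamma> 1 t\<^sub>0 * action \<gamma> l m \<zeta>"
      unfolding supp L act using slope by (auto simp: I_fun_lat power2_eq_square)
    assume "\<forall>t\<in>{0..l}. magnetic_curvature \<gamma> l m t > 0"
    then show "action \<gamma> l m \<zeta> > 0"
      unfolding act using positive_of_magnetic_curvature slope by (simp add: zero_less_divide_iff)
  qed
qed

end
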